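(* There exist an explicit family of polynomials $\{\mathcal{Q}_n\}_n$ and an absolute constant $\epsilon>0$ such that $\mathcal{Q}_n$ is of degree $\Theta(n)$, in $N=\Theta(n^2)$ variables, and is computed by a $\mathrm{poly}(n)$ size homogeneous $\Sigma\Pi\Sigma\Pi(\log n)$ circuit (in particular, a homogeneous arithmetic formula); and for every $t$ such that $\omega(\log n)\le t\le\epsilon n$, any homogeneous $\Sigma\Pi\Sigma\Pi^{[t]}$ circuit computing $\mathcal{Q}_n$ must have top fan-in at least $$\exp\left(\Omega\left(\frac{n}{t}\log N\right)\right).$$
   Context: An arithmetic circuit over a field $\mathbb{F}$ is a directed acyclic graph whose leaves are labelled by variables or field elements and whose other nodes are labelled by $+$ or $\times$; it is a formula if the underlying undirected graph is a tree, and it is homogeneous if the polynomial computed at every node is homogeneous. A depth 4 ($\Sigma\Pi\Sigma\Pi$) circuit computes a polynomial in the form $P=\sum_{i=1}^{r}\prod_{j=1}^{d_i}Q_{i,j}$, where each $Q_{i,j}$ is computed as a sum of monomials ($\Sigma\Pi$ circuit). The number $r$ is its top fan-in. It is a $\Sigma\Pi\Sigma\Pi(r')$ circuit if its top fan-in is bounded by $r'$ (with no restriction on the bottom fan-in), and a $\Sigma\Pi\Sigma\Pi^{[t]}$ circuit if each $Q_{i,j}$ is a polynomial of degree at most $t$. Depth 4 circuits and depth 4 formulas are equivalent up to a polynomial blow-up in size. The condition $\omega(\log n)\le t$ means that $t$ grows asymptotically faster than $\log n$. *)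

theory Defs
  imports Complex_Main "HOL-Library.Poly_Mapping" "HOL-Library.Landau_Symbols"
begin

section \<open>Multivariate polynomials\<close>

text \<open>A monomial is a finitely supported exponent vector; the ring structure on
  polynomials is the convolution product of \<^theory>\<open>HOL-Library.Poly_Mapping\<close>.\<close>

type_synonym monomial = "nat \<Rightarrow>\<^sub>0 nat"
type_synonym 'a mpoly = "monomial \<Rightarrow>\<^sub>0 'a"

definition poly_var :: "nat \<Rightarrow> 'a::comm_ring_1 mpoly" where
  "poly_var i = Poly_Mapping.single (Poly_Mapping.single i 1) 1"

definition poly_const :: "'a::comm_ring_1 \<Rightarrow> 'a mpoly" where
  "poly_const a = Poly_Mapping.single 0 a"

definition monomial_degree :: "monomial \<Rightarrow> nat" where
  "monomial_degree m = (\<Sum>i\<in>Poly_Mapping.keys m. Poly_Mapping.lookup m i)"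

text \<open>The zero polynomial has total degree 0 and is homogeneous.\<close>

definition total_degree :: "'a::zero mpoly \<Rightarrow> nat" where
  "total_degree p = Max (insert 0 (monomial_degree ` Poly_Mapping.keys p))"

definition homogeneous :: "'a::zero mpoly \<Rightarrow> bool" where
  "homogeneous p \<longleftrightarrow> (\<exists>d. \<forall>m\<in>Poly_Mapping.keys p. monomial_degree m = d)"

definition poly_vars :: "'a::zero mpoly \<Rightarrow> nat set" where
  "poly_vars p = (\<Union>m\<in>Poly_Mapping.keys p. Poly_Mapping.keys m)"


section \<open>Arithmetic circuits\<close>

text \<open>A circuit is a directed acyclic graph given in topological order: node \<open>v\<close> is
  the \<open>v\<close>-th gate of the list, a gate lists the nodes feeding it, all of which are
  smaller than \<open>v\<close>, and the last node is the output.\<close>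

datatype 'a gate = Input nat | Scalar 'a | Sum_Gate "nat list" | Prod_Gate "nat list"

type_synonym 'a circuit = "'a gate list"

fun children :: "'a gate \<Rightarrow> nat list" where
  "children (Input i) = []"
| "children (Scalar a) = []"
| "children (Sum_Gate us) = us"
| "children (Prod_Gate us) = us"

fun leaf_gate :: "'a gate \<Rightarrow> bool" where
  "leaf_gate (Input i) = True"
| "leaf_gate (Scalar a) = True"
| "leaf_gate (Sum_Gate us) = False"
| "leaf_gate (Prod_Gate us) = False"

definition arith_circuit :: "nat \<Rightarrow> 'a circuit \<Rightarrow> bool" where
  "arith_circuit N C \<longleftrightarrow> C \<noteq> [] \<and>
     (\<forall>v<length C.
        (\<forall>i. C ! v = Input i \<longrightarrow> i < N) \<and>
        (\<not> leaf_gate (C ! v) \<longrightarrow> children (C ! v) \<noteq> []) \<and>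
        (\<forall>u\<in>set (children (C ! v)). u < v))"

text \<open>The guard \<open>u < v\<close> only serves termination; it holds in every
  \<^const>\<open>arith_circuit\<close>.\<close>

fun node_poly :: "'a::comm_ring_1 circuit \<Rightarrow> nat \<Rightarrow> 'a mpoly" where
  "node_poly C v = (case C ! v of
      Input i \<Rightarrow> poly_var i
    | Scalar a \<Rightarrow> poly_const a
    | Sum_Gate us \<Rightarrow> (\<Sum>u\<leftarrow>us. if u < v then node_poly C u else 0)
    | Prod_Gate us \<Rightarrow> (\<Prod>u\<leftarrow>us. if u < v then node_poly C u else 0))"

declare node_poly.simps [simp del]

definition computes :: "'a::comm_ring_1 circuit \<Rightarrow> 'a mpoly \<Rightarrow> bool" where
  "computes C p \<longleftrightarrow> node_poly C (length C - 1) = p"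

definition homogeneous_circuit :: "'a::comm_ring_1 circuit \<Rightarrow> bool" where
  "homogeneous_circuit C \<longleftrightarrow> (\<forall>v<length C. homogeneous (node_poly C v))"

text \<open>Number of nodes plus number of edges.\<close>

definition circuit_size :: "'a circuit \<Rightarrow> nat" where
  "circuit_size C = length C + (\<Sum>g\<leftarrow>C. length (children g))"

definition adjacent :: "'a circuit \<Rightarrow> nat \<Rightarrow> nat \<Rightarrow> bool" where
  "adjacent C u v \<longleftrightarrow>
     (v < length C \<and> u \<in> set (children (C ! v))) \<or>
     (u < length C \<and> v \<in> set (children (C ! u)))"

text \<open>The underlying undirected graph is a tree: no parallel edges, connected, and
  without cycles.\<close>

definition is_formula :: "'a circuit \<Rightarrow> bool" where
  "is_formula C \<longleftrightarrow>
     (\<forall>v<length C. distinct (children (C ! v))) \<and>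
     (\<forall>u<length C. \<forall>v<length C. (adjacent C)\<^sup>*\<^sup>* u v) \<and>
     \<not> (\<exists>vs. 3 \<le> length vs \<and> distinct vs \<and>
          (\<forall>i<length vs. adjacent C (vs ! i) (vs ! (Suc i mod length vs))))"

text \<open>Depth 4 circuits, output at the left. Gates of fan-in 1 are allowed, so products
  or sums with a single operand are covered.\<close>

definition sigma_pi_sigma_pi :: "'a circuit \<Rightarrow> bool" where
  "sigma_pi_sigma_pi C \<longleftrightarrow>
     (\<exists>us. last C = Sum_Gate us \<and>
       (\<forall>u\<in>set us. \<exists>vs. C ! u = Prod_Gate vs \<and>
         (\<forall>v\<in>set vs. \<exists>ws. C ! v = Sum_Gate ws \<and>
           (\<forall>w\<in>set ws. \<exists>xs. C ! w = Prod_Gate xs \<and>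
             (\<forall>x\<in>set xs. leaf_gate (C ! x))))))"

definition top_fan_in :: "'a circuit \<Rightarrow> nat" where
  "top_fan_in C = length (children (last C))"

text \<open>In \<open>P = \<Sum>\<^sub>i \<Prod>\<^sub>j Q\<^sub>i\<^sub>j\<close>, every \<open>Q\<^sub>i\<^sub>j\<close> has degree at most \<open>t\<close>.\<close>

definition bottom_degree_le :: "'a::comm_ring_1 circuit \<Rightarrow> nat \<Rightarrow> bool" where
  "bottom_degree_le C t \<longleftrightarrow>
     (\<forall>u\<in>set (children (last C)). \<forall>v\<in>set (children (C ! u)).
        total_degree (node_poly C v) \<le> t)"


section \<open>Explicit families\<close>

text \<open>A family is explicit if the coefficient of a given monomial can be computed in
  polynomial time, uniformly in \<open>n\<close>. The machine model is the unit-cost random access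
  machine with addition and truncated subtraction, in structured form; its polynomial
  time is that of Turing machines. (Unit-cost multiplication would make the model too
  strong.) A state consists of registers and of a separate indirectly addressed
  memory.\<close>

datatype ram =
    Set_Const nat nat
  | Set_Plus nat nat nat
  | Set_Minus nat nat nat
  | Load nat nat
  | Store nat nat
  | Seq ram ram
  | If_Pos nat ram ram
  | While_Pos nat ram

type_synonym ram_state = "(nat \<Rightarrow> nat) \<times> (nat \<Rightarrow> nat)"

text \<open>\<open>ram_exec P s T s'\<close>: started in \<open>s\<close>, program \<open>P\<close> halts in \<open>s'\<close> after \<open>T\<close> steps.\<close>

inductive ram_exec :: "ram \<Rightarrow> ram_state \<Rightarrow> nat \<Rightarrow> ram_state \<Rightarrow> bool" where
  Set_Const: "ram_exec (Set_Const d k) (R, M) 1 (R(d := k), M)"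
| Set_Plus: "ram_exec (Set_Plus d a b) (R, M) 1 (R(d := R a + R b), M)"
| Set_Minus: "ram_exec (Set_Minus d a b) (R, M) 1 (R(d := R a - R b), M)"
| Load: "ram_exec (Load d a) (R, M) 1 (R(d := M (R a)), M)"
| Store: "ram_exec (Store d a) (R, M) 1 (R, M(R d := R a))"
| Seq: "ram_exec P s T1 s' \<Longrightarrow> ram_exec Q s' T2 s'' \<Longrightarrow> ram_exec (Seq P Q) s (T1 + T2) s''"
| If_True: "R a > 0 \<Longrightarrow> ram_exec P (R, M) T s' \<Longrightarrow> ram_exec (If_Pos a P Q) (R, M) (Suc T) s'"
| If_False: "R a = 0 \<Longrightarrow> ram_exec Q (R, M) T s' \<Longrightarrow> ram_exec (If_Pos a P Q) (R, M) (Suc T) s'"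
| While_False: "R a = 0 \<Longrightarrow> ram_exec (While_Pos a P) (R, M) 1 (R, M)"
| While_True: "R a > 0 \<Longrightarrow> ram_exec P (R, M) T1 s' \<Longrightarrow> ram_exec (While_Pos a P) s' T2 s''
    \<Longrightarrow> ram_exec (While_Pos a P) (R, M) (Suc (T1 + T2)) s''"

text \<open>The input is \<open>n\<close> in register 0 and the exponent vector in memory; the output is
  the integer (register 0) - (register 1), read in the coefficient ring. Both \<open>n\<close> and the
  exponents count in unary, as usual for polynomials of degree polynomial in \<open>n\<close>. One
  program serves all \<open>n\<close>, and it is not given the number \<open>N n\<close> of variables.\<close>

definition explicit_family :: "(nat \<Rightarrow> nat) \<Rightarrow> (nat \<Rightarrow> 'a::comm_ring_1 mpoly) \<Rightarrow> bool" where
  "explicit_family N Q \<longleftrightarrow>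
     (\<exists>P k. \<forall>n m. Poly_Mapping.keys m \<subseteq> {..<N n} \<longrightarrow>
        (\<exists>T R M. ram_exec P ((\<lambda>_. 0)(0 := n), Poly_Mapping.lookup m) T (R, M) \<and>
           T \<le> (n + monomial_degree m + 2) ^ k \<and>
           Poly_Mapping.lookup (Q n) m = of_int (int (R 0) - int (R 1))))"

end

theory Submission
  imports Defs "HOL-Library.FuncSet"
begin

text \<open>The polynomial of level \<open>h\<close> is a sum over the scales \<open>i \<le> h\<close>, in disjoint sets of
  variables, of products of \<open>4 ^ (h - i)\<close> factors, each a sum of \<open>2 ^ h\<close> disjoint monomials
  of degree \<open>4 ^ i\<close>. For bottom degree \<open>t\<close> only one scale is used, the one with \<open>d = 4 ^ i\<close>
  about \<open>33 t\<close>; let \<open>m = 4 ^ (h - i)\<close> and \<open>K = 2 ^ h\<close>.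

  The measure is a form of shifted partial derivatives: extract the coefficients of the \<open>K ^ m\<close>
  monomials in the first variables of the blocks, and multiply them by all monomials of degree
  at most \<open>e\<close>. For a product of few factors of degree at most \<open>t\<close>, all results lie in the span
  of few multiples of monomials of degree at most \<open>e + t m\<close>. For the polynomial itself, the
  coefficients are monomials that pairwise differ in at least \<open>d - 1\<close> variables, and their
  shifts are mostly distinct. The ratio between the numbers of monomials of degree at most
  \<open>e + 1\<close> and \<open>e\<close> in \<open>N\<close> variables is about \<open>1 + N / e\<close>, and since \<open>d\<close> is much larger than \<open>t\<close>,
  \<open>e\<close> can be chosen such that the \<open>t m\<close>-th power of this is below \<open>K ^ (m / 2)\<close> but its
  \<open>(d - 1)\<close>-st power exceeds \<open>2 m K\<close>.\<close>

section \<open>Monomials and coefficient extraction\<close>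

text \<open>If d is at most t, a product of blocks is itself a single product of factors of degree
  at most t; if d is much larger than t, multiplying it out gives K ^ m summands with m = n / d,
  which is too few. So a product of blocks is hard only for t slightly below d, whereas one
  polynomial has to serve all t between log n and \<epsilon> n. This forces the sum over the scales:
  powers of 4 hit every t up to a constant factor, and the h + 1 scales account for the top fan-in
  log n. As the scales have disjoint variables, extracting coefficients in one of them is blind to
  all others.

  The degree is 4 ^ h and N is 16 ^ h, so log K is a quarter of log N, and with m of order n / t the
  required bound is a constant power of K ^ m. Losses that are only exponential in m, such as the
  number of subsets of O(m) factors, are harmless because K grows with n.

  Coefficients are extracted instead of taking derivatives because derivatives introduce integer
  factors, which may vanish in positive characteristic.\<close>

abbreviation lookup where "lookup \<equiv> Poly_Mapping.lookup"
abbreviation keys where "keys \<equiv> Poly_Mapping.keys"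
abbreviation single where "single \<equiv> Poly_Mapping.single"

text \<open>Three instances occur: \<open>UNIV\<close> gives the total degree, the set of extracted
  variables gives the degree relevant for slices, and degree 0 in \<open>- {..<N}\<close> says that
  only the first \<open>N\<close> variables occur. The same lemmas on sums and products serve all of
  them.\<close>

definition deg_in :: "nat set \<Rightarrow> monomial \<Rightarrow> nat" where
  "deg_in Y m = (\<Sum>i\<in>keys m \<inter> Y. lookup m i)"

lemma monomial_degree_eq_deg_in: "monomial_degree m = deg_in UNIV m"
  by (simp add: monomial_degree_def deg_in_def)

lemma deg_in_superset:
  assumes "finite S" "keys m \<subseteq> S"
  shows "deg_in Y m = (\<Sum>i\<in>S \<inter> Y. lookup m i)"
  unfolding deg_in_def
  by (rule sum.mono_neutral_left) (use assms in \<open>auto simp: in_keys_iff\<close>)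

lemma deg_in_add: "deg_in Y (a + b) = deg_in Y a + deg_in Y b"
proof -
  have "finite (keys a \<union> keys b)" by simp
  then show ?thesis
    using deg_in_superset[of "keys a \<union> keys b" a Y] deg_in_superset[of "keys a \<union> keys b" b Y]
      deg_in_superset[of "keys a \<union> keys b" "a + b" Y] Poly_Mapping.keys_add[of a b]
    by (simp add: lookup_add sum.distrib)
qed

lemma deg_in_0 [simp]: "deg_in Y 0 = 0"
  by (simp add: deg_in_def)

lemma deg_in_single [simp]: "deg_in Y (single i c) = (if i \<in> Y then c else 0)"
  by (auto simp: deg_in_def)

lemma deg_in_sum: "deg_in Y (sum f A) = (\<Sum>x\<in>A. deg_in Y (f x))"
  by (induction A rule: infinite_finite_induct) (auto simp: deg_in_add)

lemma deg_in_eq_0_iff: "deg_in Y m = 0 \<longleftrightarrow> keys m \<inter> Y = {}"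
  by (auto simp: deg_in_def in_keys_iff)

lemma deg_in_eq_0_lookup: "deg_in Y m = 0 \<longleftrightarrow> (\<forall>i\<in>Y. lookup m i = 0)"
  by (auto simp: deg_in_eq_0_iff in_keys_iff)

lemma deg_in_subset: "keys m \<subseteq> Y \<Longrightarrow> deg_in Y m = deg_in UNIV m"
  by (simp add: deg_in_def Int_absorb2)

lemma keys_prodD:
  assumes "finite A" "w \<in> keys (\<Prod>j\<in>A. q j)"
  shows "\<exists>f. (\<forall>j\<in>A. f j \<in> keys (q j)) \<and> w = sum f A"
  using assms
proof (induction A arbitrary: w rule: finite_induct)
  case empty
  then show ?case by (auto split: if_splits)
next
  case (insert x A)
  from insert.prems insert.hyps have "w \<in> keys (q x * prod q A)" by simp
  with keys_mult obtain a b where ab: "a \<in> keys (q x)" "b \<in> keys (prod q A)" "w = a + b" by blast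
  from insert.IH[OF ab(2)] obtain f where f: "\<forall>j\<in>A. f j \<in> keys (q j)" "b = sum f A" by blast
  have "sum (f(x := a)) A = sum f A" using insert.hyps by (intro sum.cong) auto
  then have "sum (f(x := a)) (insert x A) = a + sum f A"
    using insert.hyps by simp
  with f ab insert.hyps show ?case
    by (intro exI[of _ "f(x := a)"]) auto
qed

lemma deg_in_prod_ge:
  assumes "finite A" "w \<in> keys (\<Prod>j\<in>A. q j)" "\<And>j v. j \<in> A \<Longrightarrow> v \<in> keys (q j) \<Longrightarrow> c j \<le> deg_in Y v"
  shows "sum c A \<le> deg_in Y w"
proof -
  from keys_prodD[OF assms(1,2)] obtain f where "\<forall>j\<in>A. f j \<in> keys (q j)" "w = sum f A" by blast
  then show ?thesis by (auto simp: deg_in_sum intro!: sum_mono assms(3))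
qed

lemma deg_in_prod_le:
  assumes "finite A" "w \<in> keys (\<Prod>j\<in>A. q j)" "\<And>j v. j \<in> A \<Longrightarrow> v \<in> keys (q j) \<Longrightarrow> deg_in Y v \<le> c j"
  shows "deg_in Y w \<le> sum c A"
proof -
  from keys_prodD[OF assms(1,2)] obtain f where "\<forall>j\<in>A. f j \<in> keys (q j)" "w = sum f A" by blast
  then show ?thesis by (auto simp: deg_in_sum intro!: sum_mono assms(3))
qed

lemma poly_eq_sum_single: "f = (\<Sum>k\<in>keys f. single k (lookup f k))"
proof (rule poly_mapping_eqI)
  fix k
  have "(\<Sum>x\<in>keys f. lookup (single x (lookup f x)) k) = (\<Sum>x\<in>keys f. if x = k then lookup f k else 0)"
    by (intro sum.cong) (auto simp: lookup_single)
  then show "lookup f k = lookup (\<Sum>x\<in>keys f. single x (lookup f x)) k"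
    by (simp add: lookup_sum in_keys_iff)
qed

lemma prod_single:
  "(\<Prod>x\<in>A. single (f x) (g x)) = single (sum f A) (prod g A :: 'a::comm_semiring_1)"
  by (induction A rule: infinite_finite_induct) (auto simp: mult_single)

text \<open>For \<mu> with variables in \<open>Y\<close>, this is the coefficient of \<mu> when
  \<open>f\<close> is read as a polynomial in the variables \<open>Y\<close> over the polynomials in
  the other variables. In particular \<open>slice Y 0\<close> sets the variables in \<open>Y\<close>
  to zero.\<close>

definition slice :: "nat set \<Rightarrow> monomial \<Rightarrow> 'a::zero mpoly \<Rightarrow> 'a mpoly" where
  "slice Y \<mu> f = Abs_poly_mapping (\<lambda>\<nu>. if deg_in Y \<nu> = 0 then lookup f (\<mu> + \<nu>) else 0)"

lemma lookup_slice: "lookup (slice Y \<mu> f) \<nu> = (if deg_in Y \<nu> = 0 then lookup f (\<mu> + \<nu>) else 0)"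
proof -
  have "{\<nu>. (if deg_in Y \<nu> = 0 then lookup f (\<mu> + \<nu>) else 0) \<noteq> 0} \<subseteq> (\<lambda>w. w - \<mu>) ` keys f"
    by (force simp: in_keys_iff split: if_splits)
  then have "finite {\<nu>. (if deg_in Y \<nu> = 0 then lookup f (\<mu> + \<nu>) else 0) \<noteq> 0}"
    by (rule finite_subset) simp
  then show ?thesis unfolding slice_def by simp
qed

lemma slice_add: "slice Y \<mu> (f + g) = slice Y \<mu> f + slice Y \<mu> (g :: 'a::comm_monoid_add mpoly)"
  by (rule poly_mapping_eqI) (simp add: lookup_slice lookup_add)

lemma slice_0 [simp]: "slice Y \<mu> 0 = 0"
  by (rule poly_mapping_eqI) (simp add: lookup_slice)

lemma slice_sum: "slice Y \<mu> (sum f A) = (\<Sum>x\<in>A. slice Y \<mu> (f x :: 'a::comm_monoid_add mpoly))"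
  by (induction A rule: infinite_finite_induct) (auto simp: slice_add)

lemma slice_single_decomposed:
  assumes "deg_in Y \<nu> = 0"
  shows "slice Y \<mu> (single (\<mu> + \<nu>) c) = single \<nu> c"
  by (rule poly_mapping_eqI) (use assms in \<open>auto simp: lookup_slice lookup_single when_def\<close>)

lemma slice_single_0:
  assumes "\<And>\<nu>. deg_in Y \<nu> = 0 \<Longrightarrow> w \<noteq> \<mu> + \<nu>"
  shows "slice Y \<mu> (single w c) = 0"
  by (rule poly_mapping_eqI) (use assms in \<open>auto simp: lookup_slice lookup_single when_def\<close>)

text \<open>Since \<alpha> avoids \<open>Y\<close> and \<mu> lies inside \<open>Y\<close>, an
  equation \<alpha> + \<beta> = \<mu> + \<nu> can be solved for \<beta>: inside \<open>Y\<close> the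
  exponents of \<alpha> vanish, outside those of \<mu> do. So both sides are zero for the same
  \<beta>.\<close>

lemma slice_mult_single:
  assumes \<alpha>: "deg_in Y \<alpha> = 0" and \<mu>: "keys \<mu> \<subseteq> Y"
  shows "slice Y \<mu> (single \<alpha> a * single \<beta> b) = single \<alpha> a * slice Y \<mu> (single \<beta> (b :: 'a::comm_semiring_1))"
proof (cases "\<exists>\<nu>. deg_in Y \<nu> = 0 \<and> \<beta> = \<mu> + \<nu>")
  case True
  then obtain \<nu> where \<nu>: "deg_in Y \<nu> = 0" "\<beta> = \<mu> + \<nu>" by blast
  have "slice Y \<mu> (single \<alpha> a * single \<beta> b) = slice Y \<mu> (single (\<mu> + (\<alpha> + \<nu>)) (a * b))"
    by (simp add: mult_single \<nu>(2) add_ac)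
  also have "\<dots> = single (\<alpha> + \<nu>) (a * b)"
    by (rule slice_single_decomposed) (simp add: deg_in_add \<alpha> \<nu>)
  also have "\<dots> = single \<alpha> a * slice Y \<mu> (single \<beta> b)"
    unfolding \<nu>(2) by (subst slice_single_decomposed[OF \<nu>(1)]) (simp add: mult_single)
  finally show ?thesis .
next
  case False
  have "\<alpha> + \<beta> \<noteq> \<mu> + \<nu>" if \<nu>: "deg_in Y \<nu> = 0" for \<nu>
  proof
    assume eq: "\<alpha> + \<beta> = \<mu> + \<nu>"
    have "\<beta> = \<mu> + (\<nu> - \<alpha>)"
    proof (rule poly_mapping_eqI)
      fix i
      from eq have "lookup \<alpha> i + lookup \<beta> i = lookup \<mu> i + lookup \<nu> i"
        by (metis lookup_add)
      moreover have "lookup \<alpha> i = 0 \<or> lookup \<mu> i = 0"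
        using \<alpha> \<mu> by (cases "i \<in> Y") (auto simp: deg_in_eq_0_lookup in_keys_iff subset_eq)
      moreover have "i \<in> Y \<Longrightarrow> lookup \<alpha> i = 0" using \<alpha> by (simp add: deg_in_eq_0_lookup)
      moreover have "i \<notin> Y \<Longrightarrow> lookup \<mu> i = 0" using \<mu> by (auto simp: in_keys_iff)
      ultimately show "lookup \<beta> i = lookup (\<mu> + (\<nu> - \<alpha>)) i"
        by (cases "i \<in> Y") (auto simp: lookup_add lookup_minus)
    qed
    moreover have "deg_in Y (\<nu> - \<alpha>) = 0" using \<nu> by (simp add: deg_in_eq_0_lookup lookup_minus)
    ultimately show False using False by blast
  qed
  then have "slice Y \<mu> (single (\<alpha> + \<beta>) (a * b)) = 0" by (rule slice_single_0)
  moreover have "slice Y \<mu> (single \<beta> b) = 0" using False by (intro slice_single_0) blast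
  ultimately show ?thesis by (simp add: mult_single)
qed

lemma slice_mult:
  fixes f g :: "'a::comm_semiring_1 mpoly"
  assumes f: "\<And>\<alpha>. \<alpha> \<in> keys f \<Longrightarrow> deg_in Y \<alpha> = 0" and \<mu>: "keys \<mu> \<subseteq> Y"
  shows "slice Y \<mu> (f * g) = f * slice Y \<mu> g"
proof -
  have "f * g = (\<Sum>\<alpha>\<in>keys f. \<Sum>\<beta>\<in>keys g. single \<alpha> (lookup f \<alpha>) * single \<beta> (lookup g \<beta>))"
    by (subst poly_eq_sum_single[of f], subst poly_eq_sum_single[of g])
      (rule sum_product)
  then have "slice Y \<mu> (f * g) =
      (\<Sum>\<alpha>\<in>keys f. \<Sum>\<beta>\<in>keys g. single \<alpha> (lookup f \<alpha>) * slice Y \<mu> (single \<beta> (lookup g \<beta>)))"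
    by (simp add: slice_sum slice_mult_single f \<mu>)
  also have "\<dots> = (\<Sum>\<alpha>\<in>keys f. single \<alpha> (lookup f \<alpha>)) * (\<Sum>\<beta>\<in>keys g. slice Y \<mu> (single \<beta> (lookup g \<beta>)))"
    by (rule sum_product[symmetric])
  also have "\<dots> = f * slice Y \<mu> g"
    using poly_eq_sum_single[of f] poly_eq_sum_single[of g] by (metis slice_sum)
  finally show ?thesis .
qed

section \<open>Counting monomials of bounded degree\<close>

definition mons :: "nat \<Rightarrow> nat \<Rightarrow> monomial set" where
  "mons N e = {\<nu>. keys \<nu> \<subseteq> {..<N} \<and> deg_in UNIV \<nu> \<le> e}"

lemma mons_add: "\<alpha> \<in> mons N d \<Longrightarrow> \<beta> \<in> mons N e \<Longrightarrow> \<alpha> + \<beta> \<in> mons N (d + e)"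
  using Poly_Mapping.keys_add[of \<alpha> \<beta>] by (auto simp: mons_def deg_in_add)

lemma lookup_le_deg: "lookup \<nu> i \<le> deg_in UNIV \<nu>"
  by (cases "i \<in> keys \<nu>") (auto simp: deg_in_def in_keys_iff intro!: member_le_sum)

lemma mons_0_left: "mons 0 e = {0}"
  by (auto simp: mons_def)

lemma mons_0_right: "mons N 0 = {0}"
  using lookup_le_deg by (auto simp: mons_def intro!: poly_mapping_eqI) (metis le_0_eq)

text \<open>Pascal's rule: a monomial either omits the variable \<open>N\<close> or is divisible by
  it.\<close>

lemma mons_Suc_Suc:
  "mons (Suc N) (Suc e) = mons N (Suc e) \<union> (\<lambda>\<nu>. single N 1 + \<nu>) ` mons (Suc N) e"
proof (intro equalityI subsetI)
  fix \<nu> assume \<nu>: "\<nu> \<in> mons (Suc N) (Suc e)"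
  show "\<nu> \<in> mons N (Suc e) \<union> (\<lambda>\<nu>. single N 1 + \<nu>) ` mons (Suc N) e"
  proof (cases "lookup \<nu> N = 0")
    case True
    then have "N \<notin> keys \<nu>" by (simp add: in_keys_iff)
    moreover have "keys \<nu> \<subseteq> insert N {..<N}" using \<nu> by (simp add: mons_def lessThan_Suc)
    ultimately have "keys \<nu> \<subseteq> {..<N}" by blast
    with \<nu> show ?thesis by (auto simp: mons_def)
  next
    case False
    have eq: "\<nu> = single N 1 + (\<nu> - single N 1)"
      by (rule poly_mapping_eqI) (use False in \<open>auto simp: lookup_add lookup_minus lookup_single when_def\<close>)
    from arg_cong[OF eq, of "deg_in UNIV"] have "deg_in UNIV \<nu> = 1 + deg_in UNIV (\<nu> - single N 1)"
      by (simp add: deg_in_add)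
    moreover have "keys (\<nu> - single N 1) \<subseteq> keys \<nu>" by (auto simp: in_keys_iff lookup_minus)
    ultimately have "\<nu> - single N 1 \<in> mons (Suc N) e" using \<nu> by (auto simp: mons_def)
    then show ?thesis using eq by blast
  qed
next
  fix \<nu> assume "\<nu> \<in> mons N (Suc e) \<union> (\<lambda>\<nu>. single N 1 + \<nu>) ` mons (Suc N) e"
  then show "\<nu> \<in> mons (Suc N) (Suc e)"
  proof
    assume "\<nu> \<in> mons N (Suc e)" then show ?thesis by (auto simp: mons_def)
  next
    assume "\<nu> \<in> (\<lambda>\<nu>. single N 1 + \<nu>) ` mons (Suc N) e"
    moreover have "single N 1 \<in> mons (Suc N) 1" by (simp add: mons_def)
    ultimately show ?thesis using mons_add[of _ "Suc N" 1 _ e] by auto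
  qed
qed

lemma finite_card_mons: "finite (mons N e) \<and> card (mons N e) = (N + e) choose N"
proof (induction "N + e" arbitrary: N e rule: less_induct)
  case less
  consider "N = 0" | "e = 0" | N' e' where "N = Suc N'" "e = Suc e'"
    by (cases N; cases e) auto
  then show ?case
  proof cases
    case 1 then show ?thesis by (simp add: mons_0_left)
  next
    case 2 then show ?thesis by (simp add: mons_0_right)
  next
    case 3
    have a: "finite (mons N' (Suc e')) \<and> card (mons N' (Suc e')) = (N' + Suc e') choose N'"
      by (rule less) (use 3 in auto)
    have b: "finite (mons (Suc N') e') \<and> card (mons (Suc N') e') = (Suc N' + e') choose (Suc N')"
      by (rule less) (use 3 in auto)
    have "inj_on (\<lambda>\<nu>. single N' (1::nat) + \<nu>) (mons (Suc N') e')" by (auto simp: inj_on_def)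
    then have c: "card ((\<lambda>\<nu>. single N' (1::nat) + \<nu>) ` mons (Suc N') e') = (Suc N' + e') choose (Suc N')"
      using b by (simp add: card_image)
    have "mons N' (Suc e') \<inter> (\<lambda>\<nu>. single N' 1 + \<nu>) ` mons (Suc N') e' = {}"
      by (auto simp: mons_def subset_eq in_keys_iff lookup_add)
    then show ?thesis unfolding 3 mons_Suc_Suc
      using a b c by (simp add: card_Un_disjoint)
  qed
qed

lemmas finite_mons [simp] = finite_card_mons[THEN conjunct1]
lemmas card_mons = finite_card_mons[THEN conjunct2]

text \<open>The ratio of consecutive counts is 1 + N / (e + 1). It decreases with the degree, so the
  ratio at a fixed degree bounds all later ones from above and all earlier ones from below.\<close>

lemma card_mons_Suc: "Suc e * card (mons N (Suc e)) = (N + Suc e) * card (mons N e)"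
proof -
  have "Suc e * ((N + Suc e) choose Suc e) = (N + Suc e) * ((N + e) choose e)"
    using Suc_times_binomial_eq[of "N + e" e] by (simp add: mult.commute)
  moreover have "(N + Suc e) choose Suc e = (N + Suc e) choose N"
    using binomial_symmetric[of N "N + Suc e"] by simp
  moreover have "(N + e) choose e = (N + e) choose N"
    using binomial_symmetric[of N "N + e"] by simp
  ultimately show ?thesis by (simp add: card_mons)
qed

lemma card_mons_growth_le:
  assumes "l > 0"
  shows "real (card (mons N (l + j))) \<le> (1 + real N / real l) ^ j * real (card (mons N l))"
proof (induction j)
  case (Suc j)
  have "real (card (mons N (Suc (l + j)))) = (1 + real N / real (Suc (l + j))) * real (card (mons N (l + j)))"
    using arg_cong[OF card_mons_Suc[of "l + j" N], of real] by (simp add: field_simps)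
  also have "\<dots> \<le> (1 + real N / real l) * real (card (mons N (l + j)))"
    using assms by (intro mult_right_mono add_left_mono divide_left_mono) auto
  also have "\<dots> \<le> (1 + real N / real l) * ((1 + real N / real l) ^ j * real (card (mons N l)))"
    by (intro mult_left_mono Suc) auto
  finally show ?case by (simp add: mult.assoc)
qed simp

text \<open>All degrees passed on the way down are at most \<open>l\<close>, so each step shrinks
  the count at least by 1 + N / l. For \<open>l' = l\<close> the base is the same as in the upper
  bound, which makes gains and losses comparable.\<close>

lemma card_mons_growth_ge:
  assumes "0 < l'" "l' \<le> l" "j \<le> l'"
  shows "(1 + real N / real l) ^ j * real (card (mons N (l' - j))) \<le> real (card (mons N l'))"
  using assms(3)
proof (induction j)
  case (Suc j)
  obtain e where e: "l' - j = Suc e" using Suc.prems by (metis Suc_diff_Suc Suc_le_lessD)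
  then have e': "l' - Suc j = e" by simp
  have "(1 + real N / real l) * real (card (mons N e)) \<le> (1 + real N / real (Suc e)) * real (card (mons N e))"
    using assms e by (intro mult_right_mono add_left_mono divide_left_mono) auto
  also have "\<dots> = real (card (mons N (Suc e)))"
    using arg_cong[OF card_mons_Suc[of e N], of real] by (simp add: field_simps)
  finally have "(1 + real N / real l) ^ j * ((1 + real N / real l) * real (card (mons N e)))
      \<le> (1 + real N / real l) ^ j * real (card (mons N (Suc e)))"
    by (intro mult_left_mono) auto
  then show ?case using Suc e e' by (simp add: mult_ac)
qed simp

section \<open>Polynomials as a vector space\<close>

interpretation mpoly_space: vector_space "\<lambda>c (p :: 'a::field mpoly). single 0 c * p"
proof
  fix a b :: 'a and p q :: "'a mpoly"
  show "single 0 a * (single 0 b * p) = single 0 (a * b) * p"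
    by (simp add: mult_single flip: mult.assoc)
qed (simp_all add: distrib_left distrib_right single_add)

lemma independent_monomials: "\<not> mpoly_space.dependent ((\<lambda>w. single w (1::'a::field)) ` W)"
proof -
  have "(\<forall>v\<in>S. u v = 0)"
    if S: "S \<subseteq> (\<lambda>w. single w (1::'a)) ` W" "finite S" and u: "(\<Sum>v\<in>S. single 0 (u v) * v) = 0" for S u
  proof
    fix v assume "v \<in> S"
    then obtain w where v: "v = single w (1::'a)" using S by blast
    have "0 = (\<Sum>x\<in>S. lookup (single 0 (u x) * x) w)"
      using arg_cong[OF u, of "\<lambda>p. lookup p w"] by (simp add: lookup_sum)
    also have "\<dots> = (\<Sum>x\<in>S. if x = v then u v else 0)"
    proof (rule sum.cong[OF refl])
      fix x assume "x \<in> S"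
      then obtain w' where "x = single w' (1::'a)" using S by blast
      moreover have "single w' (1::'a) = single w 1 \<Longrightarrow> w' = w"
        by (metis keys_single singleton_inject zero_neq_one)
      ultimately show "lookup (single 0 (u x) * x) w = (if x = v then u v else 0)"
        by (auto simp: v mult_single lookup_single when_def)
    qed
    finally show "u v = 0" using S \<open>v \<in> S\<close> by simp
  qed
  then show ?thesis by (auto simp: mpoly_space.independent_explicit_finite_subsets)
qed

text \<open>Serves in place of a rank computation: the dimension of the space of shifted slices is
  never determined, it is enough to find many distinct monomials in the span of few
  generators.\<close>

lemma card_le_if_monomials_in_span:
  assumes "finite G" "(\<lambda>w. single w (1::'a::field)) ` W \<subseteq> mpoly_space.span G"
  shows "finite W \<and> card W \<le> card G"
proof -
  have inj: "inj_on (\<lambda>w. single w (1::'a)) W"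
    by (rule inj_onI) (metis keys_single singleton_inject zero_neq_one)
  from mpoly_space.independent_span_bound[OF assms(1) independent_monomials assms(2)]
  have "finite ((\<lambda>w. single w (1::'a)) ` W)" "card ((\<lambda>w. single w (1::'a)) ` W) \<le> card G" by auto
  with inj show ?thesis by (simp add: card_image finite_image_iff)
qed

lemma mult_in_span:
  fixes f g :: "'a::field mpoly"
  assumes f: "keys f \<subseteq> W" and G: "(\<lambda>w. g * single w 1) ` W \<subseteq> G"
  shows "g * f \<in> mpoly_space.span G"
proof -
  have "single 0 c * (g * single w 1) = g * single w c" for c w
    using mult_single[of 0 c w 1] by (simp add: mult.left_commute[of _ g] del: mult_cancel_left)
  then have "g * f = (\<Sum>w\<in>keys f. single 0 (lookup f w) * (g * single w 1))"
    by (subst poly_eq_sum_single[of f]) (simp only: sum_distrib_left)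
  also have "\<dots> \<in> mpoly_space.span G"
    using f G by (intro mpoly_space.span_sum mpoly_space.span_scale mpoly_space.span_base) auto
  finally show ?thesis .
qed

section \<open>The measure of a sum of short products\<close>

lemma keys_slice: "\<nu> \<in> keys (slice Y \<mu> f) \<longleftrightarrow> deg_in Y \<nu> = 0 \<and> \<mu> + \<nu> \<in> keys f"
  by (auto simp: in_keys_iff lookup_slice)

text \<open>Splitting each factor into its part free of \<open>Y\<close> and the rest, at most \<open>deg \<mu>\<close> of the
  factors can contribute their rest to the coefficient of \<open>\<mu>\<close>.\<close>

lemma shifted_slice_in_span:
  fixes q :: "'b \<Rightarrow> 'a::field mpoly"
  assumes J: "finite J" and q: "\<And>j. j \<in> J \<Longrightarrow> keys (q j) \<subseteq> mons N t"
    and \<mu>: "keys \<mu> \<subseteq> Y" "deg_in UNIV \<mu> = M" and \<sigma>: "\<sigma> \<in> mons N l"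
  shows "single \<sigma> 1 * slice Y \<mu> (\<Prod>j\<in>J. q j) \<in> mpoly_space.span
    ((\<lambda>(S, \<nu>). (\<Prod>j\<in>J - S. slice Y 0 (q j)) * single \<nu> 1) ` (Pow J \<times> mons N (l + t * M)))"
    (is "_ \<in> mpoly_space.span ?G")
proof -
  define q1 where "q1 j = q j - slice Y 0 (q j)" for j
  have q1: "w \<in> mons N t" "1 \<le> deg_in Y w" if "w \<in> keys (q1 j)" "j \<in> J" for w j
  proof -
    have "lookup (q1 j) w = (if deg_in Y w = 0 then 0 else lookup (q j) w)"
      by (simp add: q1_def lookup_minus lookup_slice)
    with that(1) have "w \<in> keys (q j)" "deg_in Y w \<noteq> 0" by (auto simp: in_keys_iff split: if_splits)
    with q[OF that(2)] show "w \<in> mons N t" "1 \<le> deg_in Y w" by auto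
  qed
  have q0: "deg_in Y w = 0" if "w \<in> keys (\<Prod>j\<in>A. slice Y 0 (q j))" "finite A" for A w
    using deg_in_prod_le[OF that(2,1), of Y "\<lambda>_. 0"] by (simp add: keys_slice)
  have summand: "single \<sigma> 1 * ((\<Prod>j\<in>J - S. slice Y 0 (q j)) * slice Y \<mu> (\<Prod>j\<in>S. q1 j)) \<in> mpoly_space.span ?G"
    if S: "S \<subseteq> J" for S
  proof -
    have fin: "finite S" using S J finite_subset by blast
    have "keys (single \<sigma> 1 * slice Y \<mu> (\<Prod>j\<in>S. q1 j)) \<subseteq> mons N (l + t * M)"
    proof
      fix w assume "w \<in> keys (single \<sigma> 1 * slice Y \<mu> (\<Prod>j\<in>S. q1 j))"
      then obtain \<alpha> \<nu> where "\<alpha> \<in> keys (single \<sigma> (1::'a))" "w = \<alpha> + \<nu>"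
        "\<nu> \<in> keys (slice Y \<mu> (\<Prod>j\<in>S. q1 j))" using keys_mult by blast
      then have \<nu>: "w = \<sigma> + \<nu>" "\<nu> \<in> keys (slice Y \<mu> (\<Prod>j\<in>S. q1 j))" by simp_all
      from \<nu>(2) have \<nu>': "deg_in Y \<nu> = 0" "\<mu> + \<nu> \<in> keys (\<Prod>j\<in>S. q1 j)" by (auto simp: keys_slice)
      \<comment> \<open>Each factor \<open>q1 j\<close> contributes degree at least 1 in
        \<open>Y\<close>, but \<mu> + \<nu> has only degree \<open>M\<close> there. So the slice
        vanishes when \<open>S\<close> has more than \<open>M\<close> elements, and the remaining
        degree is at most \<open>t * M\<close>.\<close>
      have "(\<Sum>j\<in>S. 1) \<le> deg_in Y (\<mu> + \<nu>)"
        by (rule deg_in_prod_ge[OF fin \<nu>'(2)]) (rule q1(2)[OF _ subsetD[OF S]])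
      then have "card S \<le> M"
        using \<nu>' \<mu> deg_in_subset[OF \<mu>(1)] by (simp add: deg_in_add)
      have "deg_in UNIV (\<mu> + \<nu>) \<le> (\<Sum>j\<in>S. t)"
        by (rule deg_in_prod_le[OF fin \<nu>'(2)]) (use q1(1)[OF _ subsetD[OF S]] in \<open>simp add: mons_def\<close>)
      moreover have "card S * t \<le> M * t" using \<open>card S \<le> M\<close> by (rule mult_le_mono1)
      ultimately have "deg_in UNIV \<nu> \<le> t * M"
        unfolding deg_in_add sum_constant of_nat_id by (metis add_leD2 le_trans mult.commute)
      moreover have "deg_in (- {..<N}) (\<mu> + \<nu>) \<le> (\<Sum>j\<in>S. 0)"
        by (rule deg_in_prod_le[OF fin \<nu>'(2)])
          (use q1(1)[OF _ subsetD[OF S]] in \<open>simp add: mons_def deg_in_eq_0_iff disjoint_eq_subset_Compl\<close>)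
      then have "keys \<nu> \<subseteq> {..<N}" by (auto simp: deg_in_add deg_in_eq_0_iff)
      ultimately have "\<nu> \<in> mons N (t * M)" by (simp add: mons_def)
      then show "w \<in> mons N (l + t * M)" using \<sigma> \<nu>(1) by (simp add: mons_add)
    qed
    \<comment> \<open>The product over \<open>J - S\<close> depends on \<open>S\<close> alone;
      everything that depends on \<mu> and \<sigma> is expanded into monomials. Hence the generators
      are the same for all \<mu> and \<sigma>.\<close>
    then have "(\<Prod>j\<in>J - S. slice Y 0 (q j)) * (single \<sigma> 1 * slice Y \<mu> (\<Prod>j\<in>S. q1 j)) \<in> mpoly_space.span ?G"
    proof (rule mult_in_span, intro image_subsetI)
      fix w assume "w \<in> mons N (l + t * M)"
      with S have "(S, w) \<in> Pow J \<times> mons N (l + t * M)" by blast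
      then show "(\<Prod>j\<in>J - S. slice Y 0 (q j)) * single w 1 \<in> ?G"
        by (rule rev_image_eqI) simp
    qed
    then show ?thesis by (simp add: mult.left_commute)
  qed
  have "(\<Prod>j\<in>J. q j) = (\<Prod>j\<in>J. q1 j + slice Y 0 (q j))" by (simp add: q1_def)
  also have "\<dots> = (\<Sum>S\<in>Pow J. (\<Prod>j\<in>J - S. slice Y 0 (q j)) * (\<Prod>j\<in>S. q1 j))"
    by (subst prod_add[OF J]) (rule sum.cong[OF refl mult.commute])
  finally have "slice Y \<mu> (\<Prod>j\<in>J. q j) =
      (\<Sum>S\<in>Pow J. slice Y \<mu> ((\<Prod>j\<in>J - S. slice Y 0 (q j)) * (\<Prod>j\<in>S. q1 j)))"
    by (simp only: slice_sum)
  also have "\<dots> = (\<Sum>S\<in>Pow J. (\<Prod>j\<in>J - S. slice Y 0 (q j)) * slice Y \<mu> (\<Prod>j\<in>S. q1 j))"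
    by (intro sum.cong refl slice_mult \<mu>(1) q0[OF _ finite_Diff[OF J]])
  finally have "single \<sigma> 1 * slice Y \<mu> (\<Prod>j\<in>J. q j) =
      (\<Sum>S\<in>Pow J. single \<sigma> 1 * ((\<Prod>j\<in>J - S. slice Y 0 (q j)) * slice Y \<mu> (\<Prod>j\<in>S. q1 j)))"
    by (simp only: sum_distrib_left)
  also have "\<dots> \<in> mpoly_space.span ?G"
    by (rule mpoly_space.span_sum, rule summand) (simp only: Pow_iff)
  finally show ?thesis .
qed


text \<open>A product of at most \<open>B\<close> factors has at most \<open>2 ^ B\<close> subsets
  \<open>S\<close>, each combined with the monomials of degree at most \<open>l + t * M\<close>.
  These generators work for all shifts and all extracted monomials at once, and a sum of products
  only takes the union of the generator sets.\<close>

lemma card_shifted_slices_le: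
  fixes L :: "'a::field mpoly list list"
  assumes L: "\<And>qs q. qs \<in> set L \<Longrightarrow> q \<in> set qs \<Longrightarrow> keys q \<subseteq> mons N t"
    and B: "\<And>qs. qs \<in> set L \<Longrightarrow> length qs \<le> B"
    and W: "\<And>w. w \<in> W \<Longrightarrow> \<exists>\<mu> \<sigma>. keys \<mu> \<subseteq> Y \<and> deg_in UNIV \<mu> = M \<and> \<sigma> \<in> mons N l \<and>
        single w 1 = single \<sigma> 1 * slice Y \<mu> (\<Sum>qs\<leftarrow>L. prod_list qs)"
  shows "card W \<le> length L * 2 ^ B * card (mons N (l + t * M))"
proof -
  define G where "G qs = (\<lambda>(S, \<nu>). (\<Prod>j\<in>{..<length qs} - S. slice Y 0 (qs ! j)) * single \<nu> (1::'a))
     ` (Pow {..<length qs} \<times> mons N (l + t * M))" for qs :: "'a mpoly list"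
  have finG: "finite (G qs)" for qs unfolding G_def by simp
  have cardG: "card (G qs) \<le> 2 ^ B * card (mons N (l + t * M))" if "qs \<in> set L" for qs
  proof -
    have "card (G qs) \<le> 2 ^ length qs * card (mons N (l + t * M))"
      unfolding G_def by (rule order.trans[OF card_image_le]) (auto simp: card_cartesian_product card_Pow)
    also have "\<dots> \<le> 2 ^ B * card (mons N (l + t * M))"
      using B[OF that] by (intro mult_right_mono power_increasing) auto
    finally show ?thesis .
  qed
  have "card (\<Union>qs\<in>set L. G qs) \<le> (\<Sum>qs\<in>set L. card (G qs))" by (rule card_UN_le) simp
  also have "\<dots> \<le> (\<Sum>qs\<in>set L. 2 ^ B * card (mons N (l + t * M)))" by (intro sum_mono cardG)
  also have "\<dots> \<le> length L * (2 ^ B * card (mons N (l + t * M)))"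
    using card_length[of L] by simp
  finally have card: "card (\<Union>qs\<in>set L. G qs) \<le> length L * 2 ^ B * card (mons N (l + t * M))"
    by (simp add: mult_ac)
  have "single w 1 \<in> mpoly_space.span (\<Union>qs\<in>set L. G qs)" if "w \<in> W" for w
  proof -
    from W[OF that] obtain \<mu> \<sigma> where \<mu>: "keys \<mu> \<subseteq> Y" "deg_in UNIV \<mu> = M" and \<sigma>: "\<sigma> \<in> mons N l"
      and w: "single w 1 = single \<sigma> 1 * slice Y \<mu> (\<Sum>qs\<leftarrow>L. prod_list qs)" by blast
    have "single \<sigma> 1 * slice Y \<mu> (prod_list qs) \<in> mpoly_space.span (\<Union>qs\<in>set L. G qs)"
      if qs: "qs \<in> set L" for qs
    proof -
      have "prod_list qs = (\<Prod>j\<in>{..<length qs}. qs ! j)"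
        by (simp add: prod.list_conv_set_nth atLeast0LessThan)
      moreover have "single \<sigma> 1 * slice Y \<mu> (\<Prod>j\<in>{..<length qs}. qs ! j) \<in> mpoly_space.span (G qs)"
        unfolding G_def by (rule shifted_slice_in_span) (use L qs \<mu> \<sigma> in auto)
      ultimately show ?thesis
        using mpoly_space.span_mono[of "G qs" "\<Union>qs\<in>set L. G qs"] qs by auto
    qed
    moreover have "single \<sigma> 1 * slice Y \<mu> (\<Sum>qs\<leftarrow>L. prod_list qs)
        = (\<Sum>qs\<leftarrow>L. single \<sigma> 1 * slice Y \<mu> (prod_list qs))"
      by (induction L) (auto simp: slice_add algebra_simps)
    moreover have "(\<Sum>qs\<leftarrow>L'. single \<sigma> 1 * slice Y \<mu> (prod_list qs)) \<in> mpoly_space.span (\<Union>qs\<in>set L. G qs)"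
      if "set L' \<subseteq> set L" for L'
      using that calculation(1) by (induction L') (auto intro!: mpoly_space.span_add mpoly_space.span_zero)
    ultimately show ?thesis using w by auto
  qed
  then have "(\<lambda>w. single w (1::'a)) ` W \<subseteq> mpoly_space.span (\<Union>qs\<in>set L. G qs)" by blast
  with card_le_if_monomials_in_span[OF _ this] finG have "card W \<le> card (\<Union>qs\<in>set L. G qs)" by simp
  with card show ?thesis by linarith
qed

section \<open>Lower bound for one product of blocks\<close>

text \<open>Abstracts from the numbering of the variables: \<open>x a k l\<close> is the variable at
  position \<open>l\<close> of alternative \<open>k\<close> in block \<open>a\<close>. The bound
  \<open>N\<close> may be larger than the number of these variables; shifts range over all
  \<open>N\<close>.\<close>

locale block_product =
  fixes x :: "nat \<Rightarrow> nat \<Rightarrow> nat \<Rightarrow> nat" and m K d N :: nat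
  assumes inj: "\<And>a k l a' k' l'. a < m \<Longrightarrow> k < K \<Longrightarrow> l < d \<Longrightarrow> a' < m \<Longrightarrow> k' < K \<Longrightarrow> l' < d \<Longrightarrow>
      x a k l = x a' k' l' \<longleftrightarrow> a = a' \<and> k = k' \<and> l = l'"
    and x_less: "\<And>a k l. a < m \<Longrightarrow> k < K \<Longrightarrow> l < d \<Longrightarrow> x a k l < N"
    and m_pos: "m > 0" and d_pos: "d > 0"
begin

definition Y :: "nat set" where "Y = {x a k 0 | a k. a < m \<and> k < K}"

definition choices :: "(nat \<Rightarrow> nat) set" where "choices = {..<m} \<rightarrow>\<^sub>E {..<K}"

text \<open>The monomial selected by the choice \<kappa> is
  \<open>hd_mon \<kappa> + tl_mon \<kappa>\<close>. Its head, one variable per block, already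
  determines \<kappa>, so extracting the head isolates the tail.\<close>

definition hd_mon :: "(nat \<Rightarrow> nat) \<Rightarrow> monomial" where
  "hd_mon \<kappa> = (\<Sum>a<m. single (x a (\<kappa> a) 0) 1)"

definition tl_mon :: "(nat \<Rightarrow> nat) \<Rightarrow> monomial" where
  "tl_mon \<kappa> = (\<Sum>a<m. \<Sum>l\<in>{1..<d}. single (x a (\<kappa> a) l) 1)"

lemma choices_less: "\<kappa> \<in> choices \<Longrightarrow> a < m \<Longrightarrow> \<kappa> a < K"
  by (auto simp: choices_def)

lemma finite_choices: "finite choices"
  unfolding choices_def by (rule finite_PiE) auto

lemma card_choices: "card choices = K ^ m"
  unfolding choices_def by (simp add: card_PiE)

lemma lookup_hd_mon:
  assumes "\<kappa> \<in> choices" "a < m" "k < K"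
  shows "lookup (hd_mon \<kappa>) (x a k 0) = (if \<kappa> a = k then 1 else 0)"
proof -
  have "lookup (hd_mon \<kappa>) (x a k 0) = (\<Sum>a'<m. if a' = a then (if \<kappa> a = k then 1 else 0) else 0)"
    unfolding hd_mon_def lookup_sum
    by (rule sum.cong) (use assms inj d_pos choices_less in \<open>auto simp: lookup_single when_def\<close>)
  then show ?thesis using assms by simp
qed

lemma lookup_tl_mon:
  assumes "\<kappa> \<in> choices" "a < m" "k < K" "l < d"
  shows "lookup (tl_mon \<kappa>) (x a k l) = (if \<kappa> a = k \<and> l > 0 then 1 else 0)"
proof -
  have "lookup (tl_mon \<kappa>) (x a k l) = (\<Sum>a'<m. \<Sum>l'\<in>{1..<d}. if l' = l then (if a' = a \<and> \<kappa> a = k then 1 else 0) else 0)"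
    unfolding tl_mon_def lookup_sum
    by (intro sum.cong refl) (use assms inj choices_less in \<open>auto simp: lookup_single when_def\<close>)
  also have "\<dots> = (\<Sum>a'<m. if a' = a then (if \<kappa> a = k \<and> l > 0 then 1 else 0) else 0)"
    using assms by (intro sum.cong refl) auto
  finally show ?thesis using assms by simp
qed

lemma keys_hd_mon: "\<kappa> \<in> choices \<Longrightarrow> keys (hd_mon \<kappa>) \<subseteq> Y"
  unfolding hd_mon_def Y_def by (rule order.trans[OF keys_sum]) (auto dest: choices_less)

lemma deg_hd_mon: "deg_in UNIV (hd_mon \<kappa>) = m"
  by (simp add: hd_mon_def deg_in_sum)

lemma deg_Y_tl_mon: "\<kappa> \<in> choices \<Longrightarrow> deg_in Y (tl_mon \<kappa>) = 0"
  using d_pos by (auto simp: deg_in_eq_0_lookup Y_def lookup_tl_mon)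

lemma hd_mon_inj:
  assumes "\<kappa> \<in> choices" "\<kappa>' \<in> choices" "\<And>v. v \<in> Y \<Longrightarrow> lookup (hd_mon \<kappa>) v = lookup (hd_mon \<kappa>') v"
  shows "\<kappa> = \<kappa>'"
proof -
  have "\<kappa> a = \<kappa>' a" if a: "a < m" for a
  proof -
    have k: "\<kappa> a < K" using assms(1) a by (rule choices_less)
    then have "x a (\<kappa> a) 0 \<in> Y" using a unfolding Y_def by blast
    from assms(3)[OF this] show ?thesis
      unfolding lookup_hd_mon[OF assms(1) a k] lookup_hd_mon[OF assms(2) a k] by (metis zero_neq_one)
  qed
  then show ?thesis by (intro PiE_ext[OF assms(1,2)[unfolded choices_def]]) simp
qed

text \<open>Other choices disappear because their heads differ inside \<open>Y\<close> and tails
  have no variable there. The summand \<open>f\<close> disappears because its monomials have degree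
  0 in \<open>Y\<close>, while the extracted head has degree \<open>m > 0\<close>.\<close>

lemma slice_sum_choices:
  fixes f :: "'a::comm_ring_1 mpoly"
  assumes \<kappa>: "\<kappa> \<in> choices" and f: "\<And>w. w \<in> keys f \<Longrightarrow> deg_in Y w = 0"
  shows "slice Y (hd_mon \<kappa>) ((\<Sum>\<kappa>'\<in>choices. single (hd_mon \<kappa>' + tl_mon \<kappa>') 1) + f) = single (tl_mon \<kappa>) 1"
proof -
  have "slice Y (hd_mon \<kappa>) (single (hd_mon \<kappa>' + tl_mon \<kappa>') (1::'a)) =
      (if \<kappa>' = \<kappa> then single (tl_mon \<kappa>) 1 else 0)" if \<kappa>': "\<kappa>' \<in> choices" for \<kappa>'
  proof (cases "\<kappa>' = \<kappa>")
    case True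
    then show ?thesis using slice_single_decomposed[OF deg_Y_tl_mon[OF \<kappa>]] by simp
  next
    case False
    have "slice Y (hd_mon \<kappa>) (single (hd_mon \<kappa>' + tl_mon \<kappa>') (1::'a)) = 0"
    proof (rule slice_single_0, rule notI)
      fix \<nu> assume \<nu>: "deg_in Y \<nu> = 0" "hd_mon \<kappa>' + tl_mon \<kappa>' = hd_mon \<kappa> + \<nu>"
      have "lookup (hd_mon \<kappa>') v = lookup (hd_mon \<kappa>) v" if "v \<in> Y" for v
        using arg_cong[OF \<nu>(2), of "\<lambda>p. lookup p v"] \<nu>(1) deg_Y_tl_mon[OF \<kappa>'] that
        by (simp add: lookup_add deg_in_eq_0_lookup)
      with False hd_mon_inj[OF \<kappa>' \<kappa>] show False by blast
    qed
    with False show ?thesis by simp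
  qed
  moreover have "slice Y (hd_mon \<kappa>) f = 0"
  proof (rule poly_mapping_eqI)
    fix \<nu>
    have "deg_in Y (hd_mon \<kappa> + \<nu>) \<noteq> 0"
      using deg_in_subset[OF keys_hd_mon[OF \<kappa>]] m_pos by (simp add: deg_in_add deg_hd_mon)
    then have "hd_mon \<kappa> + \<nu> \<notin> keys f" using f[of "hd_mon \<kappa> + \<nu>"] by argo
    then show "lookup (slice Y (hd_mon \<kappa>) f) \<nu> = lookup 0 \<nu>"
      by (simp add: lookup_slice in_keys_iff)
  qed
  ultimately show ?thesis
    using \<kappa> finite_choices by (simp add: slice_add slice_sum)
qed

definition good_shifts :: "nat \<Rightarrow> monomial set" where
  "good_shifts e = {\<sigma> \<in> mons N e. \<forall>a<m. \<forall>k<K. \<exists>l\<in>{1..<d}. lookup \<sigma> (x a k l) = 0}"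

text \<open>A good shift cannot complete any block, so the blocks chosen by \<open>\<kappa>\<close> can be read off.\<close>

lemma inj_on_shifted_tl_mon: "inj_on (\<lambda>(\<kappa>, \<sigma>). tl_mon \<kappa> + \<sigma>) (choices \<times> good_shifts e)"
proof (rule inj_onI, clarify)
  fix \<kappa> \<sigma> \<kappa>' \<sigma>'
  assume \<kappa>: "\<kappa> \<in> choices" "\<kappa>' \<in> choices" and \<sigma>: "\<sigma> \<in> good_shifts e" "\<sigma>' \<in> good_shifts e"
    and eq: "tl_mon \<kappa> + \<sigma> = tl_mon \<kappa>' + \<sigma>'"
  have "\<kappa> a = \<kappa>' a" if a: "a < m" for a
  proof (rule ccontr)
    assume ne: "\<kappa> a \<noteq> \<kappa>' a"
    have k: "\<kappa> a < K" using \<kappa>(1) a by (rule choices_less)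
    \<comment> \<open>A tail variable of alternative \<open>\<kappa> a\<close> that \<sigma>'
      misses. It occurs on the left of \<open>eq\<close>, but not on the right, where block
      \<open>a\<close> uses another alternative.\<close>
    from \<sigma>(2) a k obtain l where l: "l \<in> {1..<d}" "lookup \<sigma>' (x a (\<kappa> a) l) = 0"
      unfolding good_shifts_def by blast
    have "lookup (tl_mon \<kappa> + \<sigma>) (x a (\<kappa> a) l) \<ge> 1"
      using l a k lookup_tl_mon[OF \<kappa>(1) a k, of l] by (simp add: lookup_add)
    moreover have "lookup (tl_mon \<kappa>' + \<sigma>') (x a (\<kappa> a) l) = 0"
      using l a k ne lookup_tl_mon[OF \<kappa>(2) a k, of l] by (simp add: lookup_add)
    ultimately show False using eq by simp
  qed
  then have "\<kappa> = \<kappa>'" by (intro PiE_ext[OF \<kappa>[unfolded choices_def]]) simp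
  with eq show "\<kappa> = \<kappa>' \<and> \<sigma> = \<sigma>'" by simp
qed

text \<open>A shift containing all tail variables of an alternative is divisible by their product,
  and the quotient has degree smaller by \<open>d - 1\<close>.\<close>

lemma completing_shifts_subset:
  assumes "a < m" "k < K"
  shows "{\<sigma> \<in> mons N e. \<forall>l\<in>{1..<d}. lookup \<sigma> (x a k l) \<noteq> 0} \<subseteq>
    (\<lambda>\<nu>. (\<Sum>l\<in>{1..<d}. single (x a k l) 1) + \<nu>) ` mons N (e - (d - 1))"
proof
  fix \<sigma> assume \<sigma>: "\<sigma> \<in> {\<sigma> \<in> mons N e. \<forall>l\<in>{1..<d}. lookup \<sigma> (x a k l) \<noteq> 0}"
  define \<tau> :: monomial where "\<tau> = (\<Sum>l\<in>{1..<d}. single (x a k l) 1)"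
  have "lookup \<tau> v \<le> lookup \<sigma> v" for v
  proof (cases "\<exists>l\<in>{1..<d}. v = x a k l")
    case True
    then obtain l where l: "l \<in> {1..<d}" "v = x a k l" by blast
    have "lookup \<tau> v = (\<Sum>l'\<in>{1..<d}. if l' = l then 1 else 0)"
      unfolding \<tau>_def lookup_sum l(2)
      by (rule sum.cong) (use assms l inj in \<open>auto simp: lookup_single when_def\<close>)
    then have "lookup \<tau> v = 1" using l by simp
    moreover have "lookup \<sigma> v \<noteq> 0" using \<sigma> l by blast
    ultimately show ?thesis by simp
  next
    case False
    then have "lookup \<tau> v = 0" unfolding \<tau>_def lookup_sum
      by (intro sum.neutral) (auto simp: lookup_single when_def)
    then show ?thesis by simp
  qed
  then have eq: "\<sigma> = \<tau> + (\<sigma> - \<tau>)"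
    by (intro poly_mapping_eqI) (simp add: lookup_add lookup_minus)
  have "deg_in UNIV \<tau> = d - 1" by (simp add: \<tau>_def deg_in_sum)
  with arg_cong[OF eq, of "deg_in UNIV"] have "deg_in UNIV \<sigma> = d - 1 + deg_in UNIV (\<sigma> - \<tau>)"
    by (simp add: deg_in_add)
  moreover have "keys (\<sigma> - \<tau>) \<subseteq> keys \<sigma>" by (auto simp: in_keys_iff lookup_minus)
  ultimately have "\<sigma> - \<tau> \<in> mons N (e - (d - 1))" using \<sigma> by (auto simp: mons_def)
  with eq show "\<sigma> \<in> (\<lambda>\<nu>. (\<Sum>l\<in>{1..<d}. single (x a k l) 1) + \<nu>) ` mons N (e - (d - 1))"
    unfolding \<tau>_def by blast
qed

text \<open>Union bound over the \<open>m * K\<close> alternatives: requiring one of them to be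
  completed reduces the number of shifts by the factor \<open>(1 + N / e) ^ (d - 1)\<close>, and
  \<beta> makes this at least \<open>2 * m * K\<close>. So at least half of the shifts are
  good.\<close>

lemma card_good_shifts:
  assumes e: "d - 1 \<le> e" "0 < e" and \<beta>: "2 * real m * real K \<le> (1 + real N / real e) ^ (d - 1)"
  shows "real (card (mons N e)) \<le> 2 * real (card (good_shifts e))"
proof -
  define bad where "bad = (\<lambda>(a, k). {\<sigma> \<in> mons N e. \<forall>l\<in>{1..<d}. lookup \<sigma> (x a k l) \<noteq> 0})"
  let ?A = "real (card (mons N e))" and ?A' = "real (card (mons N (e - (d - 1))))"
  have bad: "card (bad p) \<le> card (mons N (e - (d - 1)))" if mem: "p \<in> {..<m} \<times> {..<K}" for p
  proof -
    from mem obtain a k where p: "p = (a, k)" "a < m" "k < K" by auto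
    from surj_card_le[OF _ completing_shifts_subset[OF p(2,3)]]
    show ?thesis unfolding bad_def p(1) by simp
  qed
  have sub: "mons N e - good_shifts e \<subseteq> (\<Union>p\<in>{..<m} \<times> {..<K}. bad p)"
    by (auto simp: good_shifts_def bad_def)
  have good_sub: "good_shifts e \<subseteq> mons N e" by (auto simp: good_shifts_def)
  have "finite (\<Union>p\<in>{..<m} \<times> {..<K}. bad p)" by (auto simp: bad_def)
  then have "card (mons N e - good_shifts e) \<le> card (\<Union>p\<in>{..<m} \<times> {..<K}. bad p)"
    by (rule card_mono[OF _ sub])
  also have "\<dots> \<le> (\<Sum>p\<in>{..<m} \<times> {..<K}. card (bad p))" by (rule card_UN_le) simp
  also have "\<dots> \<le> (\<Sum>p\<in>{..<m} \<times> {..<K}. card (mons N (e - (d - 1))))" by (rule sum_mono[OF bad])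
  finally have "card (mons N e - good_shifts e) \<le> m * K * card (mons N (e - (d - 1)))" by simp
  then have "real (card (mons N e - good_shifts e)) \<le> real m * real K * ?A'"
    by (metis of_nat_le_iff of_nat_mult)
  moreover have "real (card (mons N e - good_shifts e)) = ?A - real (card (good_shifts e))"
    using good_sub by (simp add: card_Diff_subset finite_subset of_nat_diff card_mono)
  moreover have "2 * real m * real K * ?A' \<le> ?A"
    using card_mons_growth_ge[OF e(2) order_refl e(1), of N] mult_right_mono[OF \<beta>, of ?A'] by simp
  ultimately show ?thesis by simp
qed

text \<open>Two estimates for the set \<open>W\<close> of shifted tails: it has \<open>K ^ m\<close>
  elements for each good shift, and good shifts are at least half of all shifts; on the other hand,
  it is bounded by the number of generators. The growth bound expresses the latter through the
  number of shifts too, which then cancels.\<close>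

lemma top_fan_in_bound:
  fixes L :: "'a::field mpoly list list"
  assumes L: "\<And>qs q. qs \<in> set L \<Longrightarrow> q \<in> set qs \<Longrightarrow> keys q \<subseteq> mons N t"
    and B: "\<And>qs. qs \<in> set L \<Longrightarrow> length qs \<le> B"
    and sum: "(\<Sum>qs\<leftarrow>L. prod_list qs) = (\<Sum>\<kappa>\<in>choices. single (hd_mon \<kappa> + tl_mon \<kappa>) 1) + f"
    and f: "\<And>w. w \<in> keys f \<Longrightarrow> deg_in Y w = 0"
    and e: "d - 1 \<le> e" "0 < e" and \<beta>: "2 * real m * real K \<le> (1 + real N / real e) ^ (d - 1)"
  shows "real K ^ m \<le> 2 * real (length L) * 2 ^ B * (1 + real N / real e) ^ (t * m)"
proof -
  let ?A = "real (card (mons N e))"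
  define W where "W = (\<lambda>(\<kappa>, \<sigma>). tl_mon \<kappa> + \<sigma>) ` (choices \<times> good_shifts e)"
  have "card W = card choices * card (good_shifts e)"
    unfolding W_def by (simp add: card_image[OF inj_on_shifted_tl_mon] card_cartesian_product)
  then have W: "real (card W) = real K ^ m * real (card (good_shifts e))"
    by (simp add: card_choices)
  have "card W \<le> length L * 2 ^ B * card (mons N (e + t * m))"
  proof (rule card_shifted_slices_le[OF L B])
    fix w assume "w \<in> W"
    then obtain \<kappa> \<sigma> where w: "w = tl_mon \<kappa> + \<sigma>" "\<kappa> \<in> choices" "\<sigma> \<in> good_shifts e"
      unfolding W_def by auto
    have "single w (1::'a) = single \<sigma> 1 * slice Y (hd_mon \<kappa>) (\<Sum>qs\<leftarrow>L. prod_list qs)"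
      unfolding sum by (subst slice_sum_choices[OF w(2)], erule f) (simp add: mult_single w(1) add.commute)
    moreover have "\<sigma> \<in> mons N e" using w(3) by (simp add: good_shifts_def)
    ultimately show "\<exists>\<mu> \<sigma>. keys \<mu> \<subseteq> Y \<and> deg_in UNIV \<mu> = m \<and> \<sigma> \<in> mons N e \<and>
        single w 1 = single \<sigma> 1 * slice Y \<mu> (\<Sum>qs\<leftarrow>L. prod_list qs)"
      using keys_hd_mon[OF w(2)] deg_hd_mon by blast
  qed
  then have "real (card W) \<le> real (length L) * 2 ^ B * real (card (mons N (e + t * m)))"
    by (simp flip: of_nat_le_iff[where 'a = real])
  also have "\<dots> \<le> real (length L) * 2 ^ B * ((1 + real N / real e) ^ (t * m) * ?A)"
    by (intro mult_left_mono card_mons_growth_le e) auto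
  finally have upper: "real (card W) \<le> real (length L) * 2 ^ B * (1 + real N / real e) ^ (t * m) * ?A"
    by (simp add: mult_ac)
  have "real K ^ m * ?A \<le> real K ^ m * (2 * real (card (good_shifts e)))"
    by (intro mult_left_mono card_good_shifts e \<beta>) auto
  also have "\<dots> = 2 * real (card W)" by (simp add: W)
  finally have "real K ^ m * ?A \<le> 2 * real (length L) * 2 ^ B * (1 + real N / real e) ^ (t * m) * ?A"
    using upper by linarith
  moreover have "?A > 0" by (simp add: card_mons)
  ultimately show ?thesis by simp
qed

end

section \<open>Depth 4 circuits as sums of short products\<close>

text \<open>Factors of degree at least \<open>t / 2\<close> are kept, one smaller factor is carried along.\<close>

lemma merge_factors:
  fixes ps :: "'a::comm_semiring_1 mpoly list"
  assumes "\<And>p. p \<in> set ps \<Longrightarrow> keys p \<subseteq> mons N t \<and> (\<forall>w\<in>keys p. deg_in UNIV w = \<delta> p)"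
    and "\<And>p. p \<in> set ps \<Longrightarrow> \<delta> p \<le> t"
  shows "\<exists>q e qs. prod_list ps = q * prod_list qs \<and> e \<le> t \<and> keys q \<subseteq> mons N e \<and>
    (\<forall>q\<in>set qs. keys q \<subseteq> mons N t) \<and> length qs * t + 2 * e \<le> 2 * (\<Sum>p\<leftarrow>ps. \<delta> p)"
  using assms
proof (induction ps)
  case Nil
  have "keys (1::'a mpoly) \<subseteq> mons N 0" by (simp add: mons_0_right)
  then show ?case by (intro exI[of _ 1] exI[of _ 0] exI[of _ "[]"]) simp
next
  case (Cons p ps)
  then obtain q e qs where IH: "prod_list ps = q * prod_list qs" "e \<le> t" "keys q \<subseteq> mons N e"
    "\<forall>q\<in>set qs. keys q \<subseteq> mons N t" "length qs * t + 2 * e \<le> 2 * (\<Sum>p\<leftarrow>ps. \<delta> p)" by auto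
  have p: "keys p \<subseteq> mons N (\<delta> p)" "keys p \<subseteq> mons N t" "\<delta> p \<le> t"
    using Cons.prems(1)[of p] Cons.prems(2)[of p] by (auto simp: mons_def)
  have q: "keys q \<subseteq> mons N t" using IH by (auto simp: mons_def)
  \<comment> \<open>If the new or the carried factor has degree at least t / 2, it joins the list
    and pays for its entry \<open>t\<close> with twice its degree. If neither does, both degrees add
    up to at most \<open>t\<close>, so that the two can be multiplied.\<close>
  consider "2 * \<delta> p \<ge> t" | "2 * e \<ge> t" | "\<delta> p + e \<le> t" by linarith
  then show ?case
  proof cases
    case 1
    then show ?thesis using IH p by (intro exI[of _ q] exI[of _ e] exI[of _ "p # qs"]) (auto simp: mult_ac)
  next
    case 2
    then show ?thesis using IH p q
      by (intro exI[of _ p] exI[of _ "\<delta> p"] exI[of _ "q # qs"]) (auto simp: mult_ac)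
  next
    case 3
    have "keys (p * q) \<subseteq> mons N (\<delta> p + e)"
      using keys_mult[of p q] p(1) IH(3) mons_add by blast
    with 3 show ?thesis using IH
      by (intro exI[of _ "p * q"] exI[of _ "\<delta> p + e"] exI[of _ qs]) (auto simp: mult_ac)
  qed
qed

lemma sum_list_keysD: "w \<in> keys (sum_list ps) \<Longrightarrow> \<exists>p\<in>set ps. w \<in> keys p"
proof (induction ps)
  case (Cons p ps)
  then show ?case using Poly_Mapping.keys_add[of p "sum_list ps"] by auto
qed simp

lemma deg_in_prod_list:
  assumes "w \<in> keys (prod_list ps)" "\<And>p v. p \<in> set ps \<Longrightarrow> v \<in> keys p \<Longrightarrow> deg_in Y v = \<delta> p"
  shows "deg_in Y w = (\<Sum>p\<leftarrow>ps. \<delta> p)"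
  using assms
proof (induction ps arbitrary: w)
  case (Cons p ps)
  from Cons.prems(1) have "w \<in> keys (p * prod_list ps)" by simp
  then obtain a b where "a \<in> keys p" "b \<in> keys (prod_list ps)" "w = a + b" using keys_mult by blast
  with Cons show ?case by (auto simp: deg_in_add)
qed (simp split: if_splits)

lemma keys_node_poly_vars:
  assumes "arith_circuit N C" "v < length C" "w \<in> keys (node_poly C v)"
  shows "keys w \<subseteq> {..<N}"
  using assms(2,3)
proof (induction v arbitrary: w rule: less_induct)
  case (less v)
  have child: "keys w \<subseteq> {..<N}" if "u < v" "w \<in> keys (node_poly C u)" for u w
    using less.IH[OF that(1)] that less.prems(1) by simp
  show ?case
  proof (cases "C ! v")
    case (Input i)
    then have "i < N" using assms(1) less.prems(1) by (auto simp: arith_circuit_def)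
    then show ?thesis using less.prems(2) Input
      by (subst (asm) node_poly.simps) (auto simp: poly_var_def split: if_splits)
  next
    case (Scalar a)
    then show ?thesis using less.prems(2)
      by (subst (asm) node_poly.simps) (auto simp: poly_const_def split: if_splits)
  next
    case (Sum_Gate us)
    then have "w \<in> keys (\<Sum>u\<leftarrow>us. if u < v then node_poly C u else 0)"
      using less.prems(2) by (subst (asm) node_poly.simps) simp
    from sum_list_keysD[OF this] show ?thesis using child by (auto split: if_splits)
  next
    case (Prod_Gate us)
    then have "w \<in> keys (\<Prod>u\<leftarrow>us. if u < v then node_poly C u else 0)"
      using less.prems(2) by (subst (asm) node_poly.simps) simp
    moreover have "deg_in (- {..<N}) v' = 0"
      if "p \<in> set (map (\<lambda>u. if u < v then node_poly C u else 0) us)" "v' \<in> keys p" for p v'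
      using that child by (fastforce simp: deg_in_eq_0_iff split: if_splits)
    ultimately have "deg_in (- {..<N}) w = (\<Sum>p\<leftarrow>map (\<lambda>u. if u < v then node_poly C u else 0) us. 0)"
      by (rule deg_in_prod_list)
    also have "\<dots> = 0" by (simp only: sum_list_0)
    finally show ?thesis by (auto simp: deg_in_eq_0_iff)
  qed
qed

text \<open>Summands whose degree is not \<open>D\<close> cancel and are dropped; only then does the degree
  bound the number of factors.\<close>

lemma circuit_decomposition:
  fixes C :: "'a::comm_ring_1 circuit"
  assumes C: "arith_circuit N C" "sigma_pi_sigma_pi C" "homogeneous_circuit C" "bottom_degree_le C t"
    "computes C R" and R: "\<And>w. w \<in> keys R \<Longrightarrow> deg_in UNIV w = D"
  obtains L where "length L \<le> top_fan_in C" "(\<Sum>qs\<leftarrow>L. prod_list qs) = R"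
    "\<And>qs. qs \<in> set L \<Longrightarrow> length qs * t \<le> 2 * D + t"
    "\<And>qs q. qs \<in> set L \<Longrightarrow> q \<in> set qs \<Longrightarrow> keys q \<subseteq> mons N t"
proof -
  from C(2) obtain us where us: "last C = Sum_Gate us"
    "\<And>u. u \<in> set us \<Longrightarrow> \<exists>vs. C ! u = Prod_Gate vs" unfolding sigma_pi_sigma_pi_def by blast
  have ne: "C \<noteq> []" using C(1) by (simp add: arith_circuit_def)
  have last: "C ! (length C - 1) = Sum_Gate us" using us ne by (simp add: last_conv_nth)
  have len: "length C - 1 < length C" using ne by simp
  have us_less: "u < length C - 1" if "u \<in> set us" for u
    using C(1) len last that unfolding arith_circuit_def by (metis children.simps(3))
  have "R = (\<Sum>u\<leftarrow>us. if u < length C - 1 then node_poly C u else 0)"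
    using C(5) last unfolding computes_def by (subst (asm) node_poly.simps) simp
  also have "\<dots> = (\<Sum>u\<leftarrow>us. node_poly C u)"
    using us_less by (intro arg_cong[of _ _ sum_list] map_cong) auto
  finally have R_eq: "R = (\<Sum>u\<leftarrow>us. node_poly C u)" .
  define P where "P u \<longleftrightarrow> (\<exists>w\<in>keys (node_poly C u). deg_in UNIV w = D)" for u
  have decomp: "\<exists>qs. prod_list qs = node_poly C u \<and> length qs * t \<le> 2 * D + t \<and> (\<forall>q\<in>set qs. keys q \<subseteq> mons N t)"
    and hom: "\<forall>w\<in>keys (node_poly C u). deg_in UNIV w = D"
    if u: "u \<in> set us" "P u" for u
  proof -
    from us(2)[OF u(1)] obtain vs where vs: "C ! u = Prod_Gate vs" by blast
    have u_less: "u < length C" using us_less[OF u(1)] by simp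
    have vs_less: "v < u" if "v \<in> set vs" for v
      using C(1) u_less vs that unfolding arith_circuit_def by (metis children.simps(4))
    have "node_poly C u = (\<Prod>v\<leftarrow>vs. if v < u then node_poly C v else 0)"
      using vs by (subst node_poly.simps) simp
    also have "\<dots> = (\<Prod>v\<leftarrow>vs. node_poly C v)"
      using vs_less by (intro arg_cong[of _ _ prod_list] map_cong) auto
    finally have prod: "node_poly C u = prod_list (map (node_poly C) vs)" .
    have deg: "keys p \<subseteq> mons N t \<and> (\<forall>w\<in>keys p. deg_in UNIV w = total_degree p)" "total_degree p \<le> t"
      if p: "p \<in> set (map (node_poly C) vs)" for p
    proof -
      from p obtain v where v: "v \<in> set vs" "p = node_poly C v" by auto
      have v_less: "v < length C" using vs_less[OF v(1)] u_less by simp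
      show le: "total_degree p \<le> t"
        using C(4) u(1) us(1) vs v unfolding bottom_degree_le_def by auto
      from C(3) v_less v obtain e where e: "\<forall>w\<in>keys p. monomial_degree w = e"
        unfolding homogeneous_circuit_def homogeneous_def by blast
      have td: "total_degree p = e" if "keys p \<noteq> {}"
      proof -
        from e have "monomial_degree ` keys p = (\<lambda>_. e) ` keys p" by (intro image_cong) auto
        with that have "monomial_degree ` keys p = {e}" by (simp only: image_constant_conv if_False)
        then show ?thesis by (simp add: total_degree_def)
      qed
      show "keys p \<subseteq> mons N t \<and> (\<forall>w\<in>keys p. deg_in UNIV w = total_degree p)"
      proof (intro conjI ballI subsetI)
        fix w assume w: "w \<in> keys p"
        show "deg_in UNIV w = total_degree p"
          using td e w unfolding monomial_degree_eq_deg_in by blast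
        with le show "w \<in> mons N t"
          using keys_node_poly_vars[OF C(1) v_less] v(2) w by (simp add: mons_def)
      qed
    qed
    let ?E = "\<Sum>p\<leftarrow>map (node_poly C) vs. total_degree p"
    \<comment> \<open>As all factors are homogeneous, every monomial of the product has degree
      \<open>?E\<close>. The monomial supplied by \<open>P u\<close> shows that the product is
      nonzero and that \<open>?E\<close> is \<open>D\<close>.\<close>
    have E: "deg_in UNIV w = ?E" if "w \<in> keys (node_poly C u)" for w
      by (rule deg_in_prod_list) (use that prod deg in auto)
    with u(2) have "?E = D" by (auto simp: P_def)
    with E show "\<forall>w\<in>keys (node_poly C u). deg_in UNIV w = D" by simp
    from merge_factors[of "map (node_poly C) vs" N t total_degree, OF deg] \<open>?E = D\<close>
    obtain q e qs where q: "prod_list (map (node_poly C) vs) = q * prod_list qs" "e \<le> t" "keys q \<subseteq> mons N e"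
      "\<forall>q\<in>set qs. keys q \<subseteq> mons N t" "length qs * t + 2 * e \<le> 2 * D" by auto
    \<comment> \<open>The carried factor is one more entry of the list; this is the additional
      \<open>t\<close>.\<close>
    then show "\<exists>qs. prod_list qs = node_poly C u \<and> length qs * t \<le> 2 * D + t \<and> (\<forall>q\<in>set qs. keys q \<subseteq> mons N t)"
      using prod by (intro exI[of _ "q # qs"]) (auto simp: mons_def)
  qed
  have R_eq': "R = (\<Sum>u\<leftarrow>filter P us. node_poly C u)"
  proof (rule poly_mapping_eqI)
    fix w
    have split: "R = (\<Sum>u\<leftarrow>filter P us. node_poly C u) + (\<Sum>u\<leftarrow>filter (\<lambda>u. \<not> P u) us. node_poly C u)"
      unfolding R_eq by (induction us) (auto simp: add_ac)
    show "lookup R w = lookup (\<Sum>u\<leftarrow>filter P us. node_poly C u) w"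
    proof (cases "deg_in UNIV w = D")
      case True
      then have "w \<notin> keys (\<Sum>u\<leftarrow>filter (\<lambda>u. \<not> P u) us. node_poly C u)"
        using sum_list_keysD by (fastforce simp: P_def)
      with split show ?thesis by (simp add: lookup_add in_keys_iff)
    next
      case False
      then have "w \<notin> keys (\<Sum>u\<leftarrow>filter P us. node_poly C u)"
        using sum_list_keysD hom by fastforce
      moreover have "w \<notin> keys R" using R False by blast
      ultimately show ?thesis by (simp add: in_keys_iff)
    qed
  qed
  from decomp obtain g where g: "\<And>u. u \<in> set us \<Longrightarrow> P u \<Longrightarrow> prod_list (g u) = node_poly C u \<and>
      length (g u) * t \<le> 2 * D + t \<and> (\<forall>q\<in>set (g u). keys q \<subseteq> mons N t)" by metis
  show ?thesis
  proof (rule that[of "map g (filter P us)"])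
    show "length (map g (filter P us)) \<le> top_fan_in C"
      using us(1) by (simp add: top_fan_in_def length_filter_le)
    have "(\<Sum>qs\<leftarrow>map g (filter P us). prod_list qs) = (\<Sum>u\<leftarrow>filter P us. node_poly C u)"
      unfolding map_map comp_def using g by (intro arg_cong[of _ _ sum_list] map_cong) auto
    then show "(\<Sum>qs\<leftarrow>map g (filter P us). prod_list qs) = R" using R_eq' by simp
  qed (use g in auto)
qed

section \<open>The hard polynomial\<close>

text \<open>Position \<open>l\<close> of alternative \<open>k\<close> for block \<open>a\<close> of scale \<open>i\<close>.\<close>

definition var_index :: "nat \<Rightarrow> nat \<Rightarrow> nat \<Rightarrow> nat \<Rightarrow> nat \<Rightarrow> nat" where
  "var_index h i a k l = i * 8 ^ h + (a * 2 ^ h + k) * 4 ^ i + l"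

definition block :: "nat \<Rightarrow> nat \<Rightarrow> nat \<Rightarrow> nat \<Rightarrow> monomial" where
  "block h i a k = (\<Sum>l<4 ^ i. single (var_index h i a k l) 1)"

definition block_poly :: "nat \<Rightarrow> nat \<Rightarrow> 'a::comm_ring_1 mpoly" where
  "block_poly h i = (\<Prod>a<4 ^ (h - i). \<Sum>k<2 ^ h. single (block h i a k) 1)"

definition hard_poly :: "nat \<Rightarrow> 'a::comm_ring_1 mpoly" where
  "hard_poly h = (\<Sum>i\<le>h. block_poly h i)"

lemma keys_sumD: "w \<in> keys (sum f A) \<Longrightarrow> \<exists>x\<in>A. w \<in> keys (f x)"
  using subsetD[OF keys_sum] by fast

lemma mixed_radix_eq:
  fixes d :: nat
  assumes "l < d" "l' < d"
  shows "p * d + l = p' * d + l' \<longleftrightarrow> p = p' \<and> l = l'"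
proof
  assume eq: "p * d + l = p' * d + l'"
  have "p = (p * d + l) div d" "p' = (p' * d + l') div d" using assms by auto
  with eq have "p = p'" by simp
  with eq show "p = p' \<and> l = l'" by simp
qed simp

lemma mixed_radix_less:
  fixes d :: nat
  assumes "p < n" "l < d"
  shows "p * d + l < n * d"
proof -
  have "p * d + l < Suc p * d" using assms(2) by simp
  also have "\<dots> \<le> n * d" using assms(1) by (intro mult_right_mono) auto
  finally show ?thesis .
qed

text \<open>Every scale has the same number \<open>8 ^ h\<close> of variables, so scale
  \<open>i\<close> can occupy the range that starts at \<open>i * 8 ^ h\<close>.\<close>

lemma scales_product: "i \<le> h \<Longrightarrow> 4 ^ (h - i) * 2 ^ h * 4 ^ i = (8 :: nat) ^ h"
proof -
  assume "i \<le> h"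
  then have "(4::nat) ^ (h - i) * 4 ^ i = 4 ^ h" by (simp flip: power_add)
  moreover have "(4::nat) ^ h * 2 ^ h = 8 ^ h" by (simp flip: power_mult_distrib)
  ultimately show ?thesis by (metis mult.assoc mult.commute)
qed

lemma var_index_offset_less:
  fixes a k l :: nat
  assumes "i \<le> h" "a < 4 ^ (h - i)" "k < 2 ^ h" "l < 4 ^ i"
  shows "(a * 2 ^ h + k) * 4 ^ i + l < 8 ^ h"
  using mixed_radix_less[OF mixed_radix_less[OF assms(2,3)] assms(4)] scales_product[OF assms(1)] by simp

text \<open>The index is a mixed radix numeral with digits \<open>i\<close>, \<open>a\<close>,
  \<open>k\<close>, \<open>l\<close>. The leading radix \<open>8 ^ h\<close> is common to all
  scales, so \<open>i\<close> can be read off first, and it determines the other radices.\<close>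

lemma var_index_eq_iff:
  assumes "i \<le> h" "a < 4 ^ (h - i)" "k < 2 ^ h" "l < 4 ^ i"
    and "i' \<le> h" "a' < 4 ^ (h - i')" "k' < 2 ^ h" "l' < 4 ^ i'"
  shows "var_index h i a k l = var_index h i' a' k' l' \<longleftrightarrow> i = i' \<and> a = a' \<and> k = k' \<and> l = l'"
proof -
  have "var_index h i a k l = var_index h i' a' k' l' \<longleftrightarrow>
      i = i' \<and> (a * 2 ^ h + k) * 4 ^ i + l = (a' * 2 ^ h + k') * 4 ^ i' + l'"
    unfolding var_index_def add.assoc
    using mixed_radix_eq[OF var_index_offset_less[OF assms(1-4)] var_index_offset_less[OF assms(5-8)]] by simp
  then show ?thesis
    using mixed_radix_eq[of l "4 ^ i" l'] mixed_radix_eq[of k "2 ^ h" k'] assms by auto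
qed

lemma var_index_less:
  assumes "i \<le> h" "a < 4 ^ (h - i)" "k < 2 ^ h" "l < 4 ^ i"
  shows "var_index h i a k l < Suc h * 8 ^ h"
  unfolding var_index_def add.assoc
  using mixed_radix_less[OF le_imp_less_Suc[OF assms(1)] var_index_offset_less[OF assms]] .

text \<open>The number \<open>16 ^ h\<close> is the square of the degree \<open>4 ^ h\<close>, as
  required for \<Theta>(n^2) variables, and it leaves room for all \<open>h + 1\<close>
  scales.\<close>

lemma Suc_times_8_power_le: "Suc h * 8 ^ h \<le> (16 :: nat) ^ h"
proof -
  have "Suc h \<le> 2 ^ h" using less_exp[of h] by (simp only: Suc_le_eq)
  then have "Suc h * 8 ^ h \<le> 2 ^ h * (8 :: nat) ^ h" by (intro mult_right_mono) auto
  also have "\<dots> = 16 ^ h" by (simp flip: power_mult_distrib)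
  finally show ?thesis .
qed

lemma block_product_var_index:
  assumes "i \<le> h"
  shows "block_product (var_index h i) (4 ^ (h - i)) (2 ^ h) (4 ^ i) (16 ^ h)"
proof
  fix a k l :: nat assume "a < 4 ^ (h - i)" "k < 2 ^ h" "l < 4 ^ i"
  from var_index_less[OF assms this] Suc_times_8_power_le[of h] show "var_index h i a k l < 16 ^ h" by linarith
qed (use assms var_index_eq_iff in auto)

abbreviation block_choices where
  "block_choices h i \<equiv> block_product.choices (4 ^ (h - i)) (2 ^ h)"

definition chosen :: "nat \<Rightarrow> nat \<Rightarrow> (nat \<Rightarrow> nat) \<Rightarrow> monomial" where
  "chosen h i \<kappa> = (\<Sum>a<4 ^ (h - i). block h i a (\<kappa> a))"

lemma chosen_eq:
  assumes "i \<le> h"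
  shows "chosen h i \<kappa> = block_product.hd_mon (var_index h i) (4 ^ (h - i)) \<kappa> +
    block_product.tl_mon (var_index h i) (4 ^ (h - i)) (4 ^ i) \<kappa>"
proof -
  interpret block_product "var_index h i" "4 ^ (h - i)" "2 ^ h" "4 ^ i" "16 ^ h"
    by (rule block_product_var_index[OF assms])
  have "{..<4 ^ i} = insert 0 {1..<4 ^ i :: nat}" by auto
  then have "block h i a k = single (var_index h i a k 0) 1 + (\<Sum>l\<in>{1..<4 ^ i}. single (var_index h i a k l) 1)" for a k
    by (simp add: block_def)
  then show ?thesis by (simp add: chosen_def hd_mon_def tl_mon_def sum.distrib)
qed

lemma block_poly_eq_sum:
  assumes "i \<le> h"
  shows "block_poly h i = (\<Sum>\<kappa>\<in>block_choices h i. single (chosen h i \<kappa>) 1)"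
proof -
  interpret block_product "var_index h i" "4 ^ (h - i)" "2 ^ h" "4 ^ i" "16 ^ h"
    by (rule block_product_var_index[OF assms])
  show ?thesis unfolding block_poly_def choices_def
    by (subst prod_sum_PiE) (auto simp: prod_single chosen_def)
qed

lemma keys_block_poly:
  assumes "i \<le> h" "w \<in> keys (block_poly h i :: 'a::comm_ring_1 mpoly)"
  shows "\<exists>\<kappa>\<in>block_choices h i. w = chosen h i \<kappa>"
  using assms(2) keys_sum[of "\<lambda>\<kappa>. single (chosen h i \<kappa>) (1::'a)" "block_choices h i"]
  unfolding block_poly_eq_sum[OF assms(1)] by (auto split: if_splits)

lemma block_choices_less: "i \<le> h \<Longrightarrow> \<kappa> \<in> block_choices h i \<Longrightarrow> a < 4 ^ (h - i) \<Longrightarrow> \<kappa> a < 2 ^ h"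
  using block_product.choices_less[OF block_product_var_index] by blast

lemma deg_chosen: "i \<le> h \<Longrightarrow> deg_in UNIV (chosen h i \<kappa>) = 4 ^ h"
  by (simp add: chosen_def block_def deg_in_sum flip: power_add)

lemma keys_chosen:
  assumes "i \<le> h" "\<kappa> \<in> block_choices h i" "v \<in> keys (chosen h i \<kappa>)"
  shows "\<exists>a<4 ^ (h - i). \<exists>l<4 ^ i. v = var_index h i a (\<kappa> a) l"
proof -
  from assms(3) obtain a where a: "a < 4 ^ (h - i)" "v \<in> keys (block h i a (\<kappa> a))"
    unfolding chosen_def by (auto dest!: keys_sumD)
  then obtain l where "l < 4 ^ i" "v \<in> keys (single (var_index h i a (\<kappa> a) l) (1::nat))"
    unfolding block_def by (auto dest!: keys_sumD)
  with a show ?thesis by auto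
qed

lemma chosen_inj:
  assumes "i \<le> h" "\<kappa> \<in> block_choices h i" "\<kappa>' \<in> block_choices h i" "chosen h i \<kappa> = chosen h i \<kappa>'"
  shows "\<kappa> = \<kappa>'"
proof -
  interpret block_product "var_index h i" "4 ^ (h - i)" "2 ^ h" "4 ^ i" "16 ^ h"
    by (rule block_product_var_index[OF assms(1)])
  show ?thesis
  proof (rule hd_mon_inj[OF assms(2,3)])
    fix v assume "v \<in> Y"
    then show "lookup (hd_mon \<kappa>) v = lookup (hd_mon \<kappa>') v"
      using arg_cong[OF assms(4), of "\<lambda>p. lookup p v"] deg_Y_tl_mon[OF assms(2)] deg_Y_tl_mon[OF assms(3)]
      by (simp add: chosen_eq[OF assms(1)] lookup_add deg_in_eq_0_lookup)
  qed
qed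

lemma lookup_block_poly:
  assumes "i \<le> h"
  shows "lookup (block_poly h i) w = (if \<exists>\<kappa>\<in>block_choices h i. w = chosen h i \<kappa> then 1 else 0)"
proof (cases "\<exists>\<kappa>\<in>block_choices h i. w = chosen h i \<kappa>")
  case True
  then obtain \<kappa> where \<kappa>: "\<kappa> \<in> block_choices h i" "w = chosen h i \<kappa>" by blast
  have "finite (block_choices h i)" using block_product.finite_choices[OF block_product_var_index[OF assms]] .
  moreover have "lookup (block_poly h i) w = (\<Sum>\<kappa>'\<in>block_choices h i. if \<kappa>' = \<kappa> then 1 else 0)"
    unfolding block_poly_eq_sum[OF assms] lookup_sum
    by (rule sum.cong) (use \<kappa> chosen_inj[OF assms] in \<open>auto simp: lookup_single when_def\<close>)
  ultimately show ?thesis using True \<kappa> by simp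
next
  case False
  then have "w \<notin> keys (block_poly h i)" using keys_block_poly[OF assms] by blast
  with False show ?thesis by (simp add: in_keys_iff)
qed

lemma deg_hard_poly:
  assumes "w \<in> keys (hard_poly h :: 'a::comm_ring_1 mpoly)"
  shows "deg_in UNIV w = 4 ^ h"
proof -
  from assms obtain i where "i \<le> h" "w \<in> keys (block_poly h i :: 'a mpoly)"
    unfolding hard_poly_def by (auto dest!: keys_sumD)
  with keys_block_poly deg_chosen show ?thesis by blast
qed

lemma poly_vars_hard_poly: "poly_vars (hard_poly h :: 'a::comm_ring_1 mpoly) \<subseteq> {..<16 ^ h}"
proof
  fix v assume "v \<in> poly_vars (hard_poly h :: 'a mpoly)"
  then obtain i w where i: "i \<le> h" "w \<in> keys (block_poly h i :: 'a mpoly)" "v \<in> keys w"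
    unfolding poly_vars_def hard_poly_def by (auto dest!: keys_sumD)
  from keys_block_poly[OF i(1,2)] obtain \<kappa> where \<kappa>: "\<kappa> \<in> block_choices h i" "w = chosen h i \<kappa>" by blast
  from keys_chosen[OF i(1) \<kappa>(1)] i(3) \<kappa>(2) obtain a l where
    "a < 4 ^ (h - i)" "l < 4 ^ i" "v = var_index h i a (\<kappa> a) l" by blast
  with block_product.x_less[OF block_product_var_index[OF i(1)]] block_choices_less[OF i(1) \<kappa>(1)]
  show "v \<in> {..<16 ^ h}" by simp
qed

text \<open>Any single scale can be singled out to match the bound for one product of blocks; the
  other scales have no variable in its set \<open>Y\<close> and play the part of \<open>f\<close>
  there.\<close>

lemma hard_poly_split:
  assumes "i \<le> h"
  defines "f \<equiv> \<Sum>i'\<in>{..h} - {i}. block_poly h i' :: 'a::comm_ring_1 mpoly"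
  shows "hard_poly h = (\<Sum>\<kappa>\<in>block_choices h i. single (block_product.hd_mon (var_index h i) (4 ^ (h - i)) \<kappa> +
      block_product.tl_mon (var_index h i) (4 ^ (h - i)) (4 ^ i) \<kappa>) 1) + f"
    and "w \<in> keys f \<Longrightarrow> deg_in (block_product.Y (var_index h i) (4 ^ (h - i)) (2 ^ h)) w = 0"
proof -
  interpret block_product "var_index h i" "4 ^ (h - i)" "2 ^ h" "4 ^ i" "16 ^ h"
    by (rule block_product_var_index[OF assms(1)])
  have "hard_poly h = block_poly h i + f"
    unfolding hard_poly_def f_def using assms(1) by (intro sum.remove) auto
  then show "hard_poly h = (\<Sum>\<kappa>\<in>choices. single (hd_mon \<kappa> + tl_mon \<kappa>) 1) + f"
    unfolding block_poly_eq_sum[OF assms(1)] chosen_eq[OF assms(1)] .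
  assume "w \<in> keys f"
  then obtain i' where i': "i' \<le> h" "i' \<noteq> i" "w \<in> keys (block_poly h i' :: 'a mpoly)"
    unfolding f_def by (auto dest!: keys_sumD)
  from keys_block_poly[OF i'(1,3)] obtain \<kappa> where \<kappa>: "\<kappa> \<in> block_choices h i'" "w = chosen h i' \<kappa>" by blast
  have "v \<notin> Y" if v: "v \<in> keys w" for v
  proof
    assume "v \<in> Y"
    then obtain a k where a: "a < 4 ^ (h - i)" "k < 2 ^ h" "v = var_index h i a k 0" by (auto simp: Y_def)
    from keys_chosen[OF i'(1) \<kappa>(1)] v \<kappa>(2) obtain a' l' where
      a': "a' < 4 ^ (h - i')" "l' < 4 ^ i'" "v = var_index h i' a' (\<kappa> a') l'" by blast
    have "var_index h i a k 0 = var_index h i' a' (\<kappa> a') l'" using a(3) a'(3) by simp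
    with var_index_eq_iff[OF assms(1) a(1,2) d_pos i'(1) a'(1) block_choices_less[OF i'(1) \<kappa>(1) a'(1)] a'(2)] i'(2)
    show False by blast
  qed
  then show "deg_in Y w = 0" by (auto simp: deg_in_eq_0_iff)
qed

text \<open>All monomials have degree \<open>4 ^ h\<close>, so it remains to see that the polynomial
  is nonzero: a slice in scale 0 is a single monomial with coefficient 1, over every coefficient
  ring.\<close>

lemma total_degree_hard_poly: "total_degree (hard_poly h :: 'a::comm_ring_1 mpoly) = 4 ^ h"
proof -
  interpret block_product "var_index h 0" "4 ^ (h - 0)" "2 ^ h" "4 ^ 0" "16 ^ h"
    by (rule block_product_var_index) simp
  have "card choices > 0" unfolding card_choices by simp
  then obtain \<kappa> where \<kappa>: "\<kappa> \<in> choices" by (metis card_gt_0_iff ex_in_conv)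
  have "slice Y (hd_mon \<kappa>) (hard_poly h :: 'a mpoly) = single (tl_mon \<kappa>) 1"
    unfolding hard_poly_split(1)[of 0 h, OF le0] by (rule slice_sum_choices[OF \<kappa>]) (rule hard_poly_split(2)[OF le0])
  then have "tl_mon \<kappa> \<in> keys (slice Y (hd_mon \<kappa>) (hard_poly h :: 'a mpoly))" by simp
  then have "keys (hard_poly h :: 'a mpoly) \<noteq> {}" unfolding keys_slice by blast
  moreover have "monomial_degree ` keys (hard_poly h :: 'a mpoly) = (\<lambda>_. 4 ^ h) ` keys (hard_poly h :: 'a mpoly)"
    using deg_hard_poly by (intro image_cong) (auto simp: monomial_degree_eq_deg_in)
  ultimately have "monomial_degree ` keys (hard_poly h :: 'a mpoly) = {4 ^ h}"
    by (simp only: image_constant_conv if_False)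
  then show ?thesis by (simp add: total_degree_def)
qed

section \<open>Choice of the scale and the lower bound\<close>

lemma ex_scale:
  fixes s :: nat
  assumes "1 < s" "s \<le> 4 ^ h"
  obtains i where "i \<le> h" "s \<le> 4 ^ i" "4 ^ i < 4 * s"
proof -
  define i where "i = (LEAST i. s \<le> (4::nat) ^ i)"
  have s: "s \<le> 4 ^ i" unfolding i_def by (rule LeastI[of _ h]) (rule assms(2))
  have "i \<le> h" unfolding i_def by (rule Least_le) (rule assms(2))
  moreover obtain j where j: "i = Suc j" using s assms(1) by (cases i) auto
  have "\<not> s \<le> 4 ^ j" using not_less_Least[of j "\<lambda>i. s \<le> 4 ^ i"] j unfolding i_def by simp
  ultimately show thesis using that[of i] s j by simp
qed

text \<open>The shift degree \<open>e\<close> is about \<open>4 t N / h\<close>, so that \<open>N / e\<close> lies between \<open>h / (8 t)\<close> and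
  \<open>h / (4 t)\<close>.\<close>

lemma hard_poly_lower_bound:
  fixes C :: "'a::field circuit"
  assumes C: "arith_circuit (16 ^ h) C" "sigma_pi_sigma_pi C" "homogeneous_circuit C"
      "bottom_degree_le C t" "computes C (hard_poly h)"
    and h: "1064 \<le> h" "h \<le> t" and t: "33 * t \<le> 4 ^ h"
  shows "exp (4 ^ h / real t * ln (16 ^ h) / 2112) \<le> real (top_fan_in C)"
proof -
  have t_pos: "t > 0" using h by simp
  \<comment> \<open>With \<open>d \<ge> 33 * t\<close> one has \<open>d - 1 \<ge> 32 * t\<close>,
    the exponent needed in \<open>growth\<close>. The upper bound \<open>d < 132 * t\<close> keeps
    the number of blocks at least \<open>4 ^ h / (132 * t)\<close>.\<close>
  obtain i where i: "i \<le> h" "33 * t \<le> 4 ^ i" "4 ^ i < 4 * (33 * t)"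
    using ex_scale[of "33 * t" h] t t_pos by auto
  define d m K N :: nat where defs: "d = 4 ^ i" "m = 4 ^ (h - i)" "K = 2 ^ h" "N = 16 ^ h"
  interpret block_product "var_index h i" m K d N
    unfolding defs by (rule block_product_var_index[OF i(1)])
  have md: "m * d = 4 ^ h" using i(1) by (simp add: defs flip: power_add)
  obtain L where L: "length L \<le> top_fan_in C" "(\<Sum>qs\<leftarrow>L. prod_list qs) = (hard_poly h :: 'a mpoly)"
    "\<And>qs. qs \<in> set L \<Longrightarrow> length qs * t \<le> 2 * 4 ^ h + t"
    "\<And>qs q. qs \<in> set L \<Longrightarrow> q \<in> set qs \<Longrightarrow> keys q \<subseteq> mons (16 ^ h) t"
    using circuit_decomposition[OF C deg_hard_poly] by metis
  \<comment> \<open>From \<open>d \<le> 132 * t\<close> it follows that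
    \<open>2 * 4 ^ h = 2 * m * d \<le> 264 * m * t\<close>; the 1 accounts for the additional
    \<open>t\<close> in the bound on the length.\<close>
  define B where "B = 264 * m + 1"
  have B: "length qs \<le> B" if "qs \<in> set L" for qs
  proof -
    have "2 * (m * d) \<le> 2 * (m * (132 * t))"
      using i(3) by (intro mult_left_mono) (auto simp: defs)
    then have "2 * 4 ^ h + t \<le> B * t" unfolding md by (simp add: B_def algebra_simps)
    with L(3)[OF that] have "length qs * t \<le> B * t" by linarith
    then show ?thesis using t_pos by simp
  qed

  \<comment> \<open>The 1 compensates for the rounding down, so that \<open>N / e\<close> really is
    at most \<open>h / (4 * t)\<close>.\<close>
  define e where "e = 4 * t * N div h + 1"
  define x where "x = real N / real e"
  have N_pos: "N > 0" by (simp add: defs)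
  have e_ge: "real (4 * t * N) / real h \<le> real e"
  proof -
    have "real (4 * t * N) / real h < real_of_int \<lfloor>real (4 * t * N) / real h\<rfloor> + 1" by linarith
    also have "\<lfloor>real (4 * t * N) / real h\<rfloor> = int (4 * t * N div h)" by (rule floor_divide_of_nat_eq)
    finally show ?thesis by (simp add: e_def)
  qed
  have e_le: "real e \<le> real (8 * t * N) / real h"
  proof -
    have "real (4 * t * N div h) \<le> real (4 * t * N) / real h" by (rule of_nat_div_le_of_nat)
    moreover have "h * 1 \<le> 4 * t * N" using h N_pos by (intro mult_mono) auto
    then have "real h \<le> real (4 * t * N)" unfolding of_nat_le_iff by simp
    then have "1 \<le> real (4 * t * N) / real h" using h by (simp add: le_divide_eq del: of_nat_mult)
    moreover have "real (8 * t * N) / real h = 2 * (real (4 * t * N) / real h)" by simp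
    moreover have "p + 1 \<le> r" if "p \<le> q" "1 \<le> q" "r = 2 * q" for p q r :: real
      using that by simp
    ultimately show ?thesis unfolding e_def of_nat_add of_nat_1 by blast
  qed
  have e_pos: "0 < e" by (simp add: e_def)
  have x_le: "x \<le> real h / (4 * real t)"
    using e_ge e_pos h t_pos N_pos by (simp add: x_def field_simps)
  have x_ge: "real h / (8 * real t) \<le> x"
    using e_le e_pos h t_pos N_pos by (simp add: x_def field_simps)
  have x_nonneg: "0 \<le> x" by (simp add: x_def)
  \<comment> \<open>Here \<open>h \<le> t\<close>, that is, t of at least logarithmic size, is
    essential: \<open>x \<le> 1 / 4\<close> gives ln (1 + x) \<ge> x - x^2 \<ge> 3 x / 4, so the
    growth is exponential in \<open>x\<close>.\<close>
  have x_small: "x \<le> 1 / 4"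
    using x_le h t_pos by (rule_tac order.trans[OF x_le]) (simp add: field_simps)

  have d_le_e: "d - 1 \<le> e"
  proof -
    have "d \<le> 4 ^ h" unfolding defs using i(1) by (intro power_increasing) auto
    also have "\<dots> \<le> N" unfolding defs by (intro power_mono) auto
    also have "real N * 1 \<le> real N * (real (4 * t) / real h)"
      using h by (intro mult_left_mono) auto
    then have "real N \<le> real e" using e_ge by (simp add: mult_ac)
    then have "N \<le> e" by simp
    finally show ?thesis by simp
  qed
  have ln2: "ln 2 \<le> (3 / 4 :: real)"
  proof -
    have "2 \<le> exp (3 / 4 :: real)"
      using exp_lower_Taylor_quadratic[of "3 / 4 :: real"] by (simp add: power2_eq_square)
    then have "ln 2 \<le> ln (exp (3 / 4 :: real))" by (subst ln_le_cancel_iff) auto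
    then show ?thesis by simp
  qed
  have growth: "2 * real m * real K \<le> (1 + real N / real e) ^ (d - 1)"
  proof -
    have "2 * m * K \<le> 16 ^ h"
    proof -
      have "2 * m * K \<le> 2 ^ h * (4 ^ h * 2 ^ h)"
        unfolding mult.assoc using h by (intro mult_mono power_increasing) (auto simp: defs intro: self_le_power power_increasing)
      also have "\<dots> = 16 ^ h" by (simp flip: power_mult_distrib)
      finally show ?thesis .
    qed
    then have "2 * real m * real K \<le> 16 ^ h"
      by (metis of_nat_le_iff of_nat_mult of_nat_numeral of_nat_power)
    also have "(16::real) ^ h = exp (real h * (4 * ln 2))"
    proof -
      have "exp (4 * ln (2::real)) = 16" using exp_of_nat_mult[of 4 "ln (2::real)"] by simp
      then show ?thesis by (simp add: exp_of_nat_mult)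
    qed
    also have "\<dots> \<le> exp (real (d - 1) * ln (1 + x))"
    proof -
      \<comment> \<open>The constants meet here: ln 2 \<le> 3 / 4 bounds the exponent of 16 ^ h by 3
        h, and 32 t times 3 / 4 times the lower bound h / (8 t) of \<open>x\<close> is exactly 3
        h.\<close>
      have "real h * (4 * ln 2) \<le> real h * 3" using ln2 by (intro mult_left_mono) auto
      also have "\<dots> = real (32 * t) * (3 / 4 * (real h / (8 * real t)))" using t_pos by simp
      also have "\<dots> \<le> real (32 * t) * (3 / 4 * x)" using x_ge by (intro mult_left_mono) auto
      also have "\<dots> \<le> real (32 * t) * (x - x\<^sup>2)"
        using mult_right_mono[OF x_small x_nonneg] by (intro mult_left_mono) (auto simp: power2_eq_square)
      also have "\<dots> \<le> real (32 * t) * ln (1 + x)"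
        using x_small x_nonneg by (intro mult_left_mono ln_one_plus_pos_lower_bound) auto
      also have "\<dots> \<le> real (d - 1) * ln (1 + x)"
      proof (rule mult_right_mono)
        have "32 * t \<le> d - 1" using i(2) t_pos unfolding defs by linarith
        then show "real (32 * t) \<le> real (d - 1)" unfolding of_nat_le_iff .
      qed (use x_nonneg in simp)
      finally show ?thesis by simp
    qed
    also have "\<dots> = (1 + x) ^ (d - 1)"
      using x_nonneg by (simp add: exp_of_nat_mult)
    finally show ?thesis by (simp add: x_def)
  qed
  have main: "real K ^ m \<le> 2 * real (length L) * 2 ^ B * (1 + real N / real e) ^ (t * m)"
  proof (rule top_fan_in_bound[where L = L])
    show "keys q \<subseteq> mons N t" if "qs \<in> set L" "q \<in> set qs" for qs q
      using L(4)[OF that] by (simp add: defs)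
    show "(\<Sum>qs\<leftarrow>L. prod_list qs) = (\<Sum>\<kappa>\<in>choices. single (hd_mon \<kappa> + tl_mon \<kappa>) 1) +
        (\<Sum>i'\<in>{..h} - {i}. block_poly h i')"
      unfolding L(2) unfolding defs by (rule hard_poly_split(1)[OF i(1)])
    show "deg_in Y w = 0" if "w \<in> keys (\<Sum>i'\<in>{..h} - {i}. block_poly h i' :: 'a mpoly)" for w
      using hard_poly_split(2)[OF i(1) that] unfolding defs .
  qed (fact B d_le_e e_pos growth)+

  \<comment> \<open>The shift by \<open>t * m\<close> degrees costs at most exp (h m / 4), and 1 / 4
    \<le> (ln 2) / 2 turns this into at most the square root of
    \<open>K ^ m = 2 ^ (h * m)\<close>.\<close>
  have upper: "(1 + x) ^ (t * m) \<le> exp (real (h * m) * (1 / 4))"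
  proof -
    have "(1 + x) ^ (t * m) \<le> exp x ^ (t * m)" using x_nonneg by (intro power_mono) auto
    also have "\<dots> = exp (real (t * m) * x)" by (rule exp_of_nat_mult[symmetric])
    also have "real (t * m) * x \<le> real (t * m) * (real h / (4 * real t))"
      by (intro mult_left_mono x_le) auto
    also have "\<dots> = real (h * m) * (1 / 4)" using t_pos by simp
    finally show ?thesis by simp
  qed
  have ln2': "ln 2 \<ge> (1 / 2 :: real)"
    using exp_half_le2 by (subst ln_ge_iff) auto
  have K_pos: "real K ^ m > 0" by (simp add: defs)
  have pos: "0 < real (length L)"
    using main K_pos by (cases "length L = 0") auto
  have "real (h * m) * ln 2 = ln (real K ^ m)"
    by (simp add: defs ln_realpow)
  also have "\<dots> \<le> ln (2 * real (length L) * 2 ^ B * (1 + x) ^ (t * m))"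
  proof (subst ln_le_cancel_iff[OF K_pos])
    have "0 < (1 + x) ^ (t * m)" using x_nonneg by (intro zero_less_power) linarith
    with pos show "0 < 2 * real (length L) * 2 ^ B * (1 + x) ^ (t * m)" by (intro mult_pos_pos) auto
  qed (use main in \<open>simp add: x_def\<close>)
  also have "\<dots> = ln 2 + ln (real (length L)) + real B * ln 2 + ln ((1 + x) ^ (t * m))"
    using pos x_nonneg by (simp add: ln_mult ln_realpow)
  also have "ln ((1 + x) ^ (t * m)) \<le> real (h * m) * (1 / 4)"
    using upper x_nonneg by (metis ln_exp ln_le_cancel_iff exp_gt_zero zero_less_power add_pos_nonneg zero_less_one)
  also have "real (h * m) * (1 / 4) \<le> real (h * m) * (1 / 2 * ln 2)"
    using ln2' by (intro mult_left_mono) auto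
  finally have ln_L: "real (h * m) * (1 / 2 * ln 2) - (real B + 1) * ln 2 \<le> ln (real (length L))"
    by (simp add: algebra_simps)
  \<comment> \<open>The factor \<open>2 * 2 ^ B\<close> may use up half of the remaining exponent, a
    quarter of \<open>h * m\<close>; this is the origin of 1064 = 4 * 266.\<close>
  have "real B + 1 \<le> real (266 * m)" using m_pos by (simp add: B_def)
  also have "\<dots> \<le> real (h * m) * (1 / 4)"
  proof -
    have "real (1064 * m) \<le> real (h * m)"
      unfolding of_nat_le_iff using h by (intro mult_right_mono) auto
    then show ?thesis by simp
  qed
  finally have "(real B + 1) * ln 2 \<le> real (h * m) * (1 / 4) * ln 2"
    by (intro mult_right_mono) auto
  with ln_L have ln_L: "real (h * m) * ln 2 / 4 \<le> ln (real (length L))"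
    by (simp only: mult.assoc)
  \<comment> \<open>The constant is 132 * 4 * 4: \<open>4 ^ h / t\<close> is at most
    \<open>132 * m\<close>, ln (16 ^ h) is 4 h ln 2, and a quarter of the exponent is left.\<close>
  have "4 ^ h / real t * ln (16 ^ h) / 2112 \<le> real (h * m) * ln 2 / 4"
  proof -
    have ln16: "ln (16 ^ h) = real h * (4 * ln 2)"
    proof -
      have "ln (16 :: real) = ln (2 ^ 4)" by simp
      also have "\<dots> = 4 * ln 2" by (subst ln_realpow) auto
      finally show ?thesis by (simp add: ln_realpow)
    qed
    have "(4::real) ^ h = real (m * d)" by (simp add: md)
    also have "\<dots> \<le> real (m * (132 * t))"
      unfolding of_nat_le_iff using i(3) by (intro mult_left_mono) (simp_all add: defs(1))
    also have "\<dots> = real m * (132 * real t)" by simp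
    finally have "4 ^ h / real t \<le> 132 * real m" using t_pos by (simp add: field_simps)
    then have "4 ^ h / real t * ln (16 ^ h) \<le> 132 * real m * ln (16 ^ h)"
      by (intro mult_right_mono) (auto simp: ln16)
    moreover have "132 * real m * ln (16 ^ h) = 2112 * (real (h * m) * ln 2 / 4)"
      by (simp add: ln16)
    ultimately show ?thesis by simp
  qed
  with ln_L have "exp (4 ^ h / real t * ln (16 ^ h) / 2112) \<le> exp (ln (real (length L)))" by simp
  also have "\<dots> = real (length L)" using pos by simp
  also have "\<dots> \<le> real (top_fan_in C)" using L(1) by simp
  finally show ?thesis .
qed

section \<open>Formulas as circuits\<close>

text \<open>Syntax trees give every occurrence of a variable its own leaf, so the circuits built
  from them share no nodes.\<close>

datatype expr = Var nat | Plus "expr list" | Times "expr list"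

fun expr_size :: "expr \<Rightarrow> nat" where
  "expr_size (Var i) = 1"
| "expr_size (Plus ts) = Suc (\<Sum>t\<leftarrow>ts. expr_size t)"
| "expr_size (Times ts) = Suc (\<Sum>t\<leftarrow>ts. expr_size t)"

fun expr_poly :: "expr \<Rightarrow> 'a::comm_ring_1 mpoly" where
  "expr_poly (Var i) = poly_var i"
| "expr_poly (Plus ts) = (\<Sum>t\<leftarrow>ts. expr_poly t)"
| "expr_poly (Times ts) = (\<Prod>t\<leftarrow>ts. expr_poly t)"

fun subexprs :: "expr \<Rightarrow> expr set" where
  "subexprs (Var i) = {Var i}"
| "subexprs (Plus ts) = insert (Plus ts) (\<Union>t\<in>set ts. subexprs t)"
| "subexprs (Times ts) = insert (Times ts) (\<Union>t\<in>set ts. subexprs t)"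

text \<open>Gates are numbered in post-order, starting from \<open>p\<close>.\<close>

fun roots :: "nat \<Rightarrow> expr list \<Rightarrow> nat list" where
  "roots p [] = []"
| "roots p (t # ts) = (p + expr_size t - 1) # roots (p + expr_size t) ts"

fun gates :: "nat \<Rightarrow> expr \<Rightarrow> 'a circuit"
  and forest :: "nat \<Rightarrow> expr list \<Rightarrow> 'a circuit" where
  "gates p (Var i) = [Input i]"
| "gates p (Plus ts) = forest p ts @ [Sum_Gate (roots p ts)]"
| "gates p (Times ts) = forest p ts @ [Prod_Gate (roots p ts)]"
| "forest p [] = []"
| "forest p (t # ts) = gates p t @ forest (p + expr_size t) ts"

lemma expr_size_pos [simp]: "0 < expr_size t"
  by (cases t) auto

lemma length_gates [simp]:
  "length (gates p t :: 'a circuit) = expr_size t"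
  "length (forest p ts :: 'a circuit) = (\<Sum>t\<leftarrow>ts. expr_size t)"
  by (induction p t and p ts rule: gates_forest.induct) auto

lemma distinct_disjointI:
  assumes "distinct xs" "distinct ys" "set xs \<subseteq> {a..<b}" "set ys \<subseteq> {b..<c::nat}"
  shows "distinct (xs @ ys)"
  using assms by (fastforce simp: subset_eq)

text \<open>Every node except the root is listed as a child exactly once. This one fact yields both
  the number of edges and the tree structure. For a forest the roots are the nodes still without a
  parent, hence they are appended.\<close>

lemma children_gates:
  "distinct (concat (map children (gates p t :: 'a circuit))) \<and>
    set (concat (map children (gates p t :: 'a circuit))) = {p..<p + expr_size t - 1}"
  "distinct (concat (map children (forest p ts :: 'a circuit)) @ roots p ts) \<and>
    set (concat (map children (forest p ts :: 'a circuit)) @ roots p ts) = {p..<p + (\<Sum>t\<leftarrow>ts. expr_size t)}"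
proof (induction p t and p ts rule: gates_forest.induct)
  case (5 p t ts)
  let ?q = "p + expr_size t"
  let ?C = "concat (map children (gates p t :: 'a circuit))"
  let ?D = "concat (map children (forest ?q ts :: 'a circuit)) @ roots ?q ts"
  let ?r = "p + expr_size t - 1"
  have r: "{p..<?q} = insert ?r {p..<?r}" 
    using expr_size_pos[of t] by (cases "expr_size t") (simp_all add: atLeastLessThanSuc)
  have "distinct ((?C @ [?r]) @ ?D)"
    by (rule distinct_disjointI[where a = p and b = ?q and c = "?q + (\<Sum>t\<leftarrow>ts. expr_size t)"])
      (use 5 r in auto)
  moreover have "set ((?C @ [?r]) @ ?D) = {p..<?q} \<union> {?q..<?q + (\<Sum>t\<leftarrow>ts. expr_size t)}"
    unfolding r using 5 by simp
  moreover have "{p..<?q} \<union> {?q..<?q + (\<Sum>t\<leftarrow>ts. expr_size t)} = {p..<p + (\<Sum>t\<leftarrow>t # ts. expr_size t)}"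
    by auto
  ultimately show ?case by auto
qed simp_all

lemma roots_less: "u \<in> set (roots p ts) \<Longrightarrow> p \<le> u \<and> u < p + (\<Sum>t\<leftarrow>ts. expr_size t)"
  using children_gates(2)[of p ts] by (metis Un_iff atLeastLessThan_iff set_append)

lemma roots_eq_Nil_iff [simp]: "roots p ts = [] \<longleftrightarrow> ts = []"
  by (cases ts) auto

definition well_formed :: "nat \<Rightarrow> expr \<Rightarrow> bool" where
  "well_formed N t \<longleftrightarrow> Plus [] \<notin> subexprs t \<and> Times [] \<notin> subexprs t \<and> (\<forall>i. Var i \<in> subexprs t \<longrightarrow> i < N)"

lemma gate_ok:
  assumes "j < length G" "G = gates p t \<and> well_formed N t \<or> G = forest p ts \<and> (\<forall>t\<in>set ts. well_formed N t)"
  shows "(\<forall>i. G ! j = Input i \<longrightarrow> i < N) \<and> (\<not> leaf_gate (G ! j) \<longrightarrow> children (G ! j) \<noteq> []) \<and>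
    (\<forall>u\<in>set (children (G ! j)). u < p + j)"
proof -
  let ?ok = "\<lambda>p (G :: 'a circuit). \<forall>j<length G. (\<forall>i. G ! j = Input i \<longrightarrow> i < N) \<and>
    (\<not> leaf_gate (G ! j) \<longrightarrow> children (G ! j) \<noteq> []) \<and> (\<forall>u\<in>set (children (G ! j)). u < p + j)"
  have append: "?ok p (G @ H)" if "?ok p G" "?ok (p + length G) H" for p and G H :: "'a circuit"
  proof (intro allI impI)
    fix j assume j: "j < length (G @ H)"
    show "(\<forall>i. (G @ H) ! j = Input i \<longrightarrow> i < N) \<and> (\<not> leaf_gate ((G @ H) ! j) \<longrightarrow> children ((G @ H) ! j) \<noteq> []) \<and>
      (\<forall>u\<in>set (children ((G @ H) ! j)). u < p + j)"
      using that(1)[rule_format, of j] that(2)[rule_format, of "j - length G"] j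
      by (cases "j < length G") (auto simp: nth_append)
  qed
  have "well_formed N t \<longrightarrow> ?ok p (gates p t)" "(\<forall>t\<in>set ts. well_formed N t) \<longrightarrow> ?ok p (forest p ts)" for p t ts
  proof (induction p t and p ts rule: gates_forest.induct)
    case (2 p ts)
    have "?ok p (gates p (Plus ts))" if "well_formed N (Plus ts)"
      unfolding gates.simps
      by (rule append) (use 2 that in \<open>auto simp: well_formed_def dest: roots_less\<close>)
    then show ?case by blast
  next
    case (3 p ts)
    have "?ok p (gates p (Times ts))" if "well_formed N (Times ts)"
      unfolding gates.simps
      by (rule append) (use 3 that in \<open>auto simp: well_formed_def dest: roots_less\<close>)
    then show ?case by blast
  next
    case (5 p t ts)
    have "?ok p (forest p (t # ts))" if "\<forall>t\<in>set (t # ts). well_formed N t"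
      unfolding forest.simps by (rule append) (use 5 that in auto)
    then show ?case by blast
  qed (auto simp: well_formed_def)
  with assms show ?thesis by blast
qed

lemma arith_circuit_gates: "well_formed N t \<Longrightarrow> arith_circuit N (gates 0 t :: 'a circuit)"
  using gate_ok[of _ "gates 0 t :: 'a circuit" 0 t N "[]"] expr_size_pos[of t]
  unfolding arith_circuit_def by (metis add_0 length_gates(1) length_greater_0_conv)

text \<open>Gates refer to absolute node numbers, so the polynomial of a subtree only makes sense
  inside the whole circuit. Inductions over trees therefore speak of an arbitrary circuit that
  contains the gates of the subtree from position \<open>p\<close> on.\<close>

definition segment :: "'a circuit \<Rightarrow> nat \<Rightarrow> 'a circuit \<Rightarrow> bool" where
  "segment C p G \<longleftrightarrow> (\<forall>j<length G. C ! (p + j) = G ! j)"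

lemma segment_append: "segment C p (G @ H) \<longleftrightarrow> segment C p G \<and> segment C (p + length G) H"
proof
  assume seg: "segment C p (G @ H)"
  show "segment C p G \<and> segment C (p + length G) H"
    unfolding segment_def
  proof (intro conjI allI impI)
    fix j assume "j < length G"
    with seg[unfolded segment_def, rule_format, of j] show "C ! (p + j) = G ! j" by (simp add: nth_append)
  next
    fix j assume "j < length H"
    with seg[unfolded segment_def, rule_format, of "length G + j"] show "C ! (p + length G + j) = H ! j"
      by (simp add: nth_append add.assoc)
  qed
next
  assume seg: "segment C p G \<and> segment C (p + length G) H"
  show "segment C p (G @ H)"
    unfolding segment_def
  proof (intro allI impI)
    fix j assume j: "j < length (G @ H)"
    show "C ! (p + j) = (G @ H) ! j"
    proof (cases "j < length G")
      case False
      with j have "j - length G < length H" by simp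
      with seg have "C ! (p + length G + (j - length G)) = H ! (j - length G)" unfolding segment_def by blast
      with False show ?thesis by (simp add: nth_append)
    qed (use seg in \<open>simp add: segment_def nth_append\<close>)
  qed
qed

lemma segment_single: "segment C p [g] \<longleftrightarrow> C ! p = g"
  by (simp add: segment_def)

lemma segment_gates:
  "segment C p (gates p (Plus ts)) \<longleftrightarrow>
    segment C p (forest p ts) \<and> C ! (p + (\<Sum>t\<leftarrow>ts. expr_size t)) = Sum_Gate (roots p ts)"
  "segment C p (gates p (Times ts)) \<longleftrightarrow>
    segment C p (forest p ts) \<and> C ! (p + (\<Sum>t\<leftarrow>ts. expr_size t)) = Prod_Gate (roots p ts)"
  by (simp_all add: segment_append segment_single)

lemma node_poly_root:
  fixes C :: "'a::comm_ring_1 circuit"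
  shows "segment C p (gates p t) \<Longrightarrow> node_poly C (p + expr_size t - 1) = expr_poly t"
    and "segment C p (forest p ts) \<Longrightarrow> map (node_poly C) (roots p ts) = map expr_poly ts"
proof (induction p t and p ts rule: gates_forest.induct)
  case (1 p i)
  then show ?case by (subst node_poly.simps) (simp add: segment_def)
next
  case (2 p ts)
  let ?v = "p + (\<Sum>t\<leftarrow>ts. expr_size t)"
  have "node_poly C ?v = (\<Sum>u\<leftarrow>roots p ts. if u < ?v then node_poly C u else 0)"
    using 2(2) by (subst node_poly.simps) (simp add: segment_gates del: gates.simps)
  also have "\<dots> = (\<Sum>u\<leftarrow>roots p ts. node_poly C u)"
    by (intro arg_cong[of _ _ sum_list] map_cong) (auto dest: roots_less)
  finally show ?case using 2 by (simp add: segment_gates del: gates.simps)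
next
  case (3 p ts)
  let ?v = "p + (\<Sum>t\<leftarrow>ts. expr_size t)"
  have "node_poly C ?v = (\<Prod>u\<leftarrow>roots p ts. if u < ?v then node_poly C u else 0)"
    using 3(2) by (subst node_poly.simps) (simp add: segment_gates del: gates.simps)
  also have "\<dots> = (\<Prod>u\<leftarrow>roots p ts. node_poly C u)"
    by (intro arg_cong[of _ _ prod_list] map_cong) (auto dest: roots_less)
  finally show ?case using 3 by (simp add: segment_gates del: gates.simps)
qed (auto simp: segment_append)

text \<open>Reduces homogeneity at all nodes of the circuit to that of the subexpressions.\<close>

lemma node_poly_subexpr:
  fixes C :: "'a::comm_ring_1 circuit"
  shows "segment C p (gates p t) \<Longrightarrow> p \<le> v \<Longrightarrow> v < p + expr_size t \<Longrightarrow>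
      \<exists>s\<in>subexprs t. node_poly C v = expr_poly s"
    and "segment C p (forest p ts) \<Longrightarrow> p \<le> v \<Longrightarrow> v < p + (\<Sum>t\<leftarrow>ts. expr_size t) \<Longrightarrow>
      \<exists>s\<in>(\<Union>t\<in>set ts. subexprs t). node_poly C v = expr_poly s"
proof (induction p t and p ts rule: gates_forest.induct)
  case (1 p i)
  then show ?case using node_poly_root(1)[of C p "Var i"] by (auto simp: less_Suc_eq_le)
next
  case (2 p ts)
  have root: "node_poly C (p + expr_size (Plus ts) - 1) = expr_poly (Plus ts)"
    using 2(2) by (rule node_poly_root)
  show ?case
  proof (cases "v = p + (\<Sum>t\<leftarrow>ts. expr_size t)")
    case True
    with root show ?thesis by (intro bexI[of _ "Plus ts"]) auto
  next
    case False
    with 2 have "\<exists>s\<in>(\<Union>t\<in>set ts. subexprs t). node_poly C v = expr_poly s"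
      by (simp only: segment_gates expr_size.simps)
    then show ?thesis by auto
  qed
next
  case (3 p ts)
  have root: "node_poly C (p + expr_size (Times ts) - 1) = expr_poly (Times ts)"
    using 3(2) by (rule node_poly_root)
  show ?case
  proof (cases "v = p + (\<Sum>t\<leftarrow>ts. expr_size t)")
    case True
    with root show ?thesis by (intro bexI[of _ "Times ts"]) auto
  next
    case False
    with 3 have "\<exists>s\<in>(\<Union>t\<in>set ts. subexprs t). node_poly C v = expr_poly s"
      by (simp only: segment_gates expr_size.simps)
    then show ?thesis by auto
  qed
next
  case (4 p)
  then show ?case by simp
next
  case (5 p t ts)
  have seg: "segment C p (gates p t)" "segment C (p + expr_size t) (forest (p + expr_size t) ts)"
    using 5(3) by (auto simp: segment_append)
  show ?case
  proof (cases "v < p + expr_size t")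
    case True
    with 5(1)[OF seg(1) 5(4)] show ?thesis by auto
  next
    case False
    with 5(2)[OF seg(2)] 5(5) show ?thesis by (auto simp: not_less add.assoc)
  qed
qed

lemma segment_self: "segment (gates 0 t) 0 (gates 0 t)"
  by (simp add: segment_def)

lemma computes_gates: "computes (gates 0 t) (expr_poly t)"
  using node_poly_root(1)[OF segment_self[of t]] by (simp add: computes_def)

lemma homogeneous_circuit_gates:
  assumes "\<And>s. s \<in> subexprs t \<Longrightarrow> homogeneous (expr_poly s :: 'a mpoly)"
  shows "homogeneous_circuit (gates 0 t :: 'a::comm_ring_1 circuit)"
  unfolding homogeneous_circuit_def
proof (intro allI impI)
  fix v assume "v < length (gates 0 t :: 'a circuit)"
  with node_poly_subexpr(1)[OF segment_self[of t], of v] obtain s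
    where "s \<in> subexprs t" "node_poly (gates 0 t) v = (expr_poly s :: 'a mpoly)" by auto
  with assms show "homogeneous (node_poly (gates 0 t :: 'a circuit) v)" by simp
qed

text \<open>A tree has one edge less than it has nodes.\<close>

lemma circuit_size_gates: "circuit_size (gates 0 t :: 'a circuit) = 2 * expr_size t - 1"
proof -
  have "(\<Sum>g\<leftarrow>(gates 0 t :: 'a circuit). length (children g)) = length (concat (map children (gates 0 t :: 'a circuit)))"
    by (simp add: length_concat comp_def)
  also have "\<dots> = card {0..<0 + expr_size t - 1}"
    using children_gates(1)[of 0 t, where 'a = 'a] by (metis distinct_card)
  finally show ?thesis by (simp add: circuit_size_def)
qed

lemma roots_segment:
  "segment C p (forest p ts) \<Longrightarrow> u \<in> set (roots p ts) \<Longrightarrow>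
    \<exists>t\<in>set ts. \<exists>q. segment C q (gates q t) \<and> u = q + expr_size t - 1"
proof (induction ts arbitrary: p)
  case (Cons t ts)
  show ?case
  proof (cases "u = p + expr_size t - 1")
    case True
    with Cons.prems show ?thesis by (auto simp: segment_append)
  next
    case False
    with Cons.prems have "segment C (p + expr_size t) (forest (p + expr_size t) ts)"
      "u \<in> set (roots (p + expr_size t) ts)" by (auto simp: segment_append)
    from Cons.IH[OF this] show ?thesis by auto
  qed
qed simp

lemma root_gate_Plus:
  assumes "segment C p (gates p (Plus ts))"
  shows "C ! (p + expr_size (Plus ts) - 1) = Sum_Gate (roots p ts)" "segment C p (forest p ts)"
  using assms unfolding segment_gates by auto

lemma root_gate_Times:
  assumes "segment C p (gates p (Times ts))"
  shows "C ! (p + expr_size (Times ts) - 1) = Prod_Gate (roots p ts)" "segment C p (forest p ts)"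
  using assms unfolding segment_gates by auto

lemma sigma_pi_sigma_pi_gates:
  assumes t: "t = Plus ts" and "\<And>t1. t1 \<in> set ts \<Longrightarrow> \<exists>ts1. t1 = Times ts1 \<and> (\<forall>t2\<in>set ts1. \<exists>ts2. t2 = Plus ts2 \<and>
      (\<forall>t3\<in>set ts2. \<exists>xs. t3 = Times (map Var xs)))"
  shows "sigma_pi_sigma_pi (gates 0 t :: 'a circuit)"
proof -
  let ?C = "gates 0 t :: 'a circuit"
  have seg: "segment ?C 0 (forest 0 ts)" using segment_self[of t] unfolding t by (rule root_gate_Plus)
  have "\<exists>vs. ?C ! u = Prod_Gate vs \<and> (\<forall>v\<in>set vs. \<exists>ws. ?C ! v = Sum_Gate ws \<and>
      (\<forall>w\<in>set ws. \<exists>xs. ?C ! w = Prod_Gate xs \<and> (\<forall>x\<in>set xs. leaf_gate (?C ! x))))"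
    if u: "u \<in> set (roots 0 ts)" for u
  proof -
    from roots_segment[OF seg u] obtain t1 p1
      where t1: "t1 \<in> set ts" "segment ?C p1 (gates p1 t1)" "u = p1 + expr_size t1 - 1" by blast
    from assms(2)[OF t1(1)] obtain ts1 where ts1: "t1 = Times ts1"
      "\<forall>t2\<in>set ts1. \<exists>ts2. t2 = Plus ts2 \<and> (\<forall>t3\<in>set ts2. \<exists>xs. t3 = Times (map Var xs))" by blast
    note g1 = root_gate_Times[OF t1(2)[unfolded ts1(1)], folded ts1(1), folded t1(3)]
    have "\<exists>ws. ?C ! v = Sum_Gate ws \<and>
      (\<forall>w\<in>set ws. \<exists>xs. ?C ! w = Prod_Gate xs \<and> (\<forall>x\<in>set xs. leaf_gate (?C ! x)))"
      if v: "v \<in> set (roots p1 ts1)" for v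
    proof -
      from roots_segment[OF g1(2) v] obtain t2 p2
        where t2: "t2 \<in> set ts1" "segment ?C p2 (gates p2 t2)" "v = p2 + expr_size t2 - 1" by blast
      from ts1(2) t2(1) obtain ts2 where ts2: "t2 = Plus ts2"
        "\<forall>t3\<in>set ts2. \<exists>xs. t3 = Times (map Var xs)" by blast
      note g2 = root_gate_Plus[OF t2(2)[unfolded ts2(1)], folded ts2(1), folded t2(3)]
      have "\<exists>xs. ?C ! w = Prod_Gate xs \<and> (\<forall>x\<in>set xs. leaf_gate (?C ! x))"
        if w: "w \<in> set (roots p2 ts2)" for w
      proof -
        from roots_segment[OF g2(2) w] obtain t3 p3
          where t3: "t3 \<in> set ts2" "segment ?C p3 (gates p3 t3)" "w = p3 + expr_size t3 - 1" by blast
        from ts2(2) t3(1) obtain xs where xs: "t3 = Times (map Var xs)" by blast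
        note g3 = root_gate_Times[OF t3(2)[unfolded xs], folded xs, folded t3(3)]
        have "leaf_gate (?C ! x)" if x: "x \<in> set (roots p3 (map Var xs))" for x
        proof -
          from roots_segment[OF g3(2) x] obtain t4 p4
            where "t4 \<in> set (map Var xs)" "segment ?C p4 (gates p4 t4)" "x = p4 + expr_size t4 - 1" by blast
          then show ?thesis by (auto simp: segment_def)
        qed
        with g3(1) show ?thesis by blast
      qed
      with g2(1) show ?thesis by blast
    qed
    with g1(1) show ?thesis by blast
  qed
  moreover have "last ?C = Sum_Gate (roots 0 ts)" unfolding t by simp
  ultimately show ?thesis unfolding sigma_pi_sigma_pi_def by blast
qed

section \<open>The underlying graph is a tree\<close>

lemma distinct_concat_nth_disjoint:
  assumes "distinct (concat xs)" "i < length xs" "j < length xs" "v \<in> set (xs ! i)" "v \<in> set (xs ! j)"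
  shows "i = j"
  using assms
proof (induction xs arbitrary: i j)
  case (Cons x xs)
  have "v \<in> set (concat xs)" if "k < length xs" "v \<in> set (xs ! k)" for k
    using that by (auto intro!: bexI[of _ "xs ! k"])
  moreover have "set x \<inter> set (concat xs) = {}" "distinct (concat xs)"
    using Cons.prems(1) by auto
  ultimately have "v \<notin> set x" if "k < length xs" "v \<in> set (xs ! k)" for k
    using that by blast
  then show ?case
    using Cons.IH[OF \<open>distinct (concat xs)\<close>] Cons.prems(2-) by (cases i; cases j) simp_all
qed simp

text \<open>In a cycle, the least node would have two distinct parents.\<close>

lemma is_formulaI:
  assumes C: "\<And>v u. v < length C \<Longrightarrow> u \<in> set (children (C ! v)) \<Longrightarrow> u < v"
    and dist: "distinct (concat (map children C))"
    and set: "set (concat (map children C)) = {0..<length C - 1}"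
  shows "is_formula C"
proof -
  have parent_unique: "v = v'"
    if "v < length C" "v' < length C" "u \<in> set (children (C ! v))" "u \<in> set (children (C ! v'))" for u v v'
    using distinct_concat_nth_disjoint[OF dist, of v v' u] that by simp
  have parent: "\<exists>v<length C. u \<in> set (children (C ! v))" if "u < length C - 1" for u
  proof -
    have "u \<in> set (concat (map children C))" using that set by simp
    then obtain g where "g \<in> set C" "u \<in> set (children g)" by auto
    then show ?thesis by (metis in_set_conv_nth)
  qed
  have adj_sym: "adjacent C u v \<Longrightarrow> adjacent C v u" for u v
    by (auto simp: adjacent_def)
  \<comment> \<open>Parents have larger numbers than their children, so climbing from parent to
    parent ends at the output. Hence any two nodes are connected through it.\<close>
  have up: "(adjacent C)\<^sup>*\<^sup>* u (length C - 1)" if "u < length C" for u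
    using that
  proof (induction "length C - u" arbitrary: u rule: less_induct)
    case less
    show ?case
    proof (cases "u = length C - 1")
      case False
      with less.prems have "u < length C - 1" by simp
      from parent[OF this] obtain v where v: "v < length C" "u \<in> set (children (C ! v))" by blast
      have "u < v" using C v by blast
      with less.hyps[of v] v(1) have "(adjacent C)\<^sup>*\<^sup>* v (length C - 1)" by (simp add: diff_less_mono2)
      moreover have "adjacent C u v" using v by (auto simp: adjacent_def)
      ultimately show ?thesis by (rule converse_rtranclp_into_rtranclp[rotated])
    qed simp
  qed
  have "symp (adjacent C)" using adj_sym by (auto intro: sympI)
  then have "symp (adjacent C)\<^sup>*\<^sup>*" by (rule symp_rtranclp)
  then have connected: "(adjacent C)\<^sup>*\<^sup>* u v" if "u < length C" "v < length C" for u v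
    using up[OF that(1)] up[OF that(2)] by (meson rtranclp_trans sympD)
  have False
    if vs: "3 \<le> length vs" "distinct vs" "\<forall>i<length vs. adjacent C (vs ! i) (vs ! (Suc i mod length vs))" for vs
  proof -
    let ?n = "length vs"
    define u where "u = Min (set vs)"
    have ne: "set vs \<noteq> {}" using vs(1) by auto
    have "u \<in> set vs" unfolding u_def using ne by (intro Min_in) auto
    then obtain i where i: "i < ?n" "vs ! i = u" by (auto simp: in_set_conv_nth)
    define j where "j = Suc i mod ?n"
    define k where "k = (if i = 0 then ?n - 1 else i - 1)"
    have j: "j < ?n" unfolding j_def by (rule mod_less_divisor) (use vs(1) in linarith)
    have k: "k < ?n" "Suc k mod ?n = i" using i vs(1) unfolding k_def by auto
    \<comment> \<open>The two neighbours of the least node on the cycle are distinct because the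
      cycle has length at least 3.\<close>
    have jk: "j \<noteq> k" "j \<noteq> i" "k \<noteq> i"
      using i vs(1) unfolding j_def k_def by (auto simp: mod_Suc)
    have "adjacent C u (vs ! j)" using vs(3) i unfolding j_def by blast
    moreover have "adjacent C (vs ! k) u" using vs(3) k i(2) by metis
    ultimately have adj: "adjacent C u (vs ! j)" "adjacent C u (vs ! k)" using adj_sym by auto
    have is_parent: "w < length C \<and> u \<in> set (children (C ! w))" if "adjacent C u w" "w \<in> set vs" for w
    proof -
      have "u \<le> w" unfolding u_def using that(2) by simp
      with that(1) C show ?thesis unfolding adjacent_def by (meson leD)
    qed
    from is_parent[OF adj(1)] is_parent[OF adj(2)] j k(1) have "vs ! j = vs ! k"
      using parent_unique by (metis nth_mem)
    with vs(2) j k(1) jk(1) show False by (simp add: nth_eq_iff_index_eq)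
  qed
  moreover have "distinct (children (C ! v))" if "v < length C" for v
    using dist that by (auto simp: distinct_concat_iff)
  ultimately show ?thesis using connected unfolding is_formula_def by blast
qed

lemma is_formula_gates:
  assumes "well_formed N t"
  shows "is_formula (gates 0 t :: 'a circuit)"
proof (rule is_formulaI)
  show "u < v" if "v < length (gates 0 t :: 'a circuit)" "u \<in> set (children (gates 0 t ! v :: 'a gate))" for u v
    using arith_circuit_gates[OF assms, where 'a = 'a] that unfolding arith_circuit_def by blast
qed (use children_gates(1)[of 0 t, where 'a = 'a] in auto)

section \<open>The formula for the hard polynomial\<close>

definition block_expr :: "nat \<Rightarrow> nat \<Rightarrow> nat \<Rightarrow> nat \<Rightarrow> expr" where
  "block_expr h i a k = Times (map Var (map (var_index h i a k) [0..<4 ^ i]))"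

definition row_expr :: "nat \<Rightarrow> nat \<Rightarrow> nat \<Rightarrow> expr" where
  "row_expr h i a = Plus (map (block_expr h i a) [0..<2 ^ h])"

definition scale_expr :: "nat \<Rightarrow> nat \<Rightarrow> expr" where
  "scale_expr h i = Times (map (row_expr h i) [0..<4 ^ (h - i)])"

definition hard_expr :: "nat \<Rightarrow> expr" where
  "hard_expr h = Plus (map (scale_expr h) [0..<Suc h])"

lemma sum_list_upt: "(\<Sum>i\<leftarrow>[0..<n]. f i) = (\<Sum>i<n. f i)"
  by (simp add: interv_sum_list_conv_sum_set_nat atLeast0LessThan)

lemma prod_list_upt: "(\<Prod>i\<leftarrow>[0..<n]. f i) = (\<Prod>i<n. f i :: 'a::comm_monoid_mult)"
  using prod.distinct_set_conv_list[of "[0..<n]" f] by (simp add: atLeast0LessThan)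

lemma block_expr_poly: "expr_poly (block_expr h i a k) = single (block h i a k) (1::'a::comm_ring_1)"
  by (simp add: block_expr_def comp_def prod_list_upt poly_var_def prod_single block_def)

lemma row_expr_poly: "expr_poly (row_expr h i a) = (\<Sum>k<2 ^ h. single (block h i a k) (1::'a::comm_ring_1))"
  by (simp add: row_expr_def comp_def sum_list_upt block_expr_poly)

lemma scale_expr_poly: "expr_poly (scale_expr h i) = (block_poly h i :: 'a::comm_ring_1 mpoly)"
  by (simp add: scale_expr_def comp_def prod_list_upt row_expr_poly block_poly_def)

lemma hard_expr_poly: "expr_poly (hard_expr h) = (hard_poly h :: 'a::comm_ring_1 mpoly)"
proof -
  have "expr_poly (hard_expr h) = (\<Sum>i\<leftarrow>[0..<Suc h]. block_poly h i :: 'a mpoly)"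
    by (simp add: hard_expr_def comp_def scale_expr_poly del: upt_Suc)
  then show ?thesis by (simp add: sum_list_upt hard_poly_def lessThan_Suc_atMost del: upt_Suc)
qed

lemma subexprs_hard_expr:
  assumes "s \<in> subexprs (hard_expr h)"
  obtains "s = hard_expr h" | i where "i \<le> h" "s = scale_expr h i"
    | i a where "i \<le> h" "a < 4 ^ (h - i)" "s = row_expr h i a"
    | i a k where "i \<le> h" "a < 4 ^ (h - i)" "k < 2 ^ h" "s = block_expr h i a k"
    | i a k l where "i \<le> h" "a < 4 ^ (h - i)" "k < 2 ^ h" "l < 4 ^ i" "s = Var (var_index h i a k l)"
proof -
  have b: "subexprs (block_expr h i a k) = insert (block_expr h i a k) (\<Union>l<4 ^ i. {Var (var_index h i a k l)})" for i a k
    by (auto simp: block_expr_def)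
  have r: "subexprs (row_expr h i a) = insert (row_expr h i a) (\<Union>k<2 ^ h. subexprs (block_expr h i a k))" for i a
    by (auto simp: row_expr_def)
  have s: "subexprs (scale_expr h i) = insert (scale_expr h i) (\<Union>a<4 ^ (h - i). subexprs (row_expr h i a))" for i
    by (auto simp: scale_expr_def)
  have "subexprs (hard_expr h) = insert (hard_expr h) (\<Union>i\<le>h. subexprs (scale_expr h i))"
    by (auto simp: hard_expr_def less_Suc_eq_le simp del: upt_Suc)
  with assms show thesis using that unfolding s r b by blast
qed

lemma well_formed_hard_expr: "well_formed (16 ^ h) (hard_expr h)"
  unfolding well_formed_def
proof (intro conjI allI impI)
  have "Plus [] \<noteq> s \<and> Times [] \<noteq> s" if "s \<in> subexprs (hard_expr h)" for s
    using that by (rule subexprs_hard_expr)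
      (auto simp: hard_expr_def scale_expr_def row_expr_def block_expr_def simp del: upt_Suc)
  then show "Plus [] \<notin> subexprs (hard_expr h)" "Times [] \<notin> subexprs (hard_expr h)" by blast+
  fix v assume "Var v \<in> subexprs (hard_expr h)"
  then show "v < 16 ^ h"
    by (rule subexprs_hard_expr)
      (auto simp: hard_expr_def scale_expr_def row_expr_def block_expr_def intro: block_product.x_less[OF block_product_var_index])
qed

lemma homogeneous_single: "homogeneous (single w c)"
  by (auto simp: homogeneous_def)

lemma homogeneous_subexprs_hard_expr:
  assumes "s \<in> subexprs (hard_expr h)"
  shows "homogeneous (expr_poly s :: 'a::comm_ring_1 mpoly)"
  using assms
proof (rule subexprs_hard_expr)
  assume "s = hard_expr h"
  then show ?thesis using deg_hard_poly unfolding hard_expr_poly homogeneous_def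
    by (auto simp: hard_expr_poly monomial_degree_eq_deg_in)
next
  fix i assume i: "i \<le> h" "s = scale_expr h i"
  then have "monomial_degree w = 4 ^ h" if "w \<in> keys (expr_poly s :: 'a mpoly)" for w
    using keys_block_poly[OF i(1)] deg_chosen[OF i(1)] that
    by (auto simp: scale_expr_poly monomial_degree_eq_deg_in)
  then show ?thesis unfolding homogeneous_def by blast
next
  fix i a assume i: "s = row_expr h i a"
  have "monomial_degree w = 4 ^ i" if w: "w \<in> keys (expr_poly s :: 'a mpoly)" for w
  proof -
    from keys_sumD[OF w[unfolded i row_expr_poly]] obtain k where "w = block h i a k" by auto
    then show ?thesis by (simp add: monomial_degree_eq_deg_in block_def deg_in_sum)
  qed
  then show ?thesis unfolding homogeneous_def by blast
qed (simp_all add: block_expr_poly homogeneous_single poly_var_def)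

lemma expr_size_hard_expr_le: "expr_size (hard_expr h) \<le> 5 * 16 ^ h"
proof -
  have b: "expr_size (block_expr h i a k) = Suc (4 ^ i)" for i a k
    by (simp add: block_expr_def comp_def sum_list_triv)
  have r: "expr_size (row_expr h i a) = Suc (2 ^ h * Suc (4 ^ i))" for i a
    by (simp add: row_expr_def comp_def b sum_list_triv)
  have s: "expr_size (scale_expr h i) = Suc (4 ^ (h - i) * Suc (2 ^ h * Suc (4 ^ i)))" for i
    by (simp add: scale_expr_def comp_def r sum_list_triv)
  \<comment> \<open>The tree of a scale has four levels, of sizes 1, m, m K and m K d, none of them
    larger than the number \<open>8 ^ h\<close> of leaves.\<close>
  have "expr_size (scale_expr h i) \<le> 4 * 8 ^ h" if "i \<le> h" for i
  proof -
    define m K d :: nat where "m = 4 ^ (h - i)" "K = 2 ^ h" "d = 4 ^ i"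
    have pos: "1 \<le> m" "1 \<le> K" "1 \<le> d" by (simp_all add: m_K_d_def)
    have "Suc (K * Suc d) \<le> 3 * (K * d)"
      using mult_le_mono2[OF pos(3), of K] pos(2) unfolding mult_1_right mult_Suc_right by linarith
    then have "m * Suc (K * Suc d) \<le> m * (3 * (K * d))" by (rule mult_left_mono) simp
    moreover have "1 \<le> m * (K * d)" using pos by simp
    ultimately have "Suc (m * Suc (K * Suc d)) \<le> 4 * (m * K * d)" by (simp add: mult_ac)
    then show ?thesis unfolding s using scales_product[OF that] by (simp add: m_K_d_def)
  qed
  then have "(\<Sum>i<Suc h. expr_size (scale_expr h i)) \<le> (\<Sum>i<Suc h. 4 * 8 ^ h)"
    by (intro sum_mono) simp
  also have "\<dots> = 4 * (Suc h * 8 ^ h)" by simp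
  also have "\<dots> \<le> 4 * 16 ^ h" by (intro mult_left_mono Suc_times_8_power_le) simp
  finally have "(\<Sum>i<Suc h. expr_size (scale_expr h i)) \<le> 4 * 16 ^ h" .
  moreover have "expr_size (hard_expr h) = Suc (\<Sum>i<Suc h. expr_size (scale_expr h i))"
    by (simp add: hard_expr_def comp_def sum_list_upt del: upt_Suc sum.lessThan_Suc)
  moreover have "(1::nat) \<le> 16 ^ h" by simp
  ultimately show ?thesis by linarith
qed

lemma hard_poly_formula:
  obtains C :: "'a::comm_ring_1 circuit" where "arith_circuit (16 ^ h) C" "sigma_pi_sigma_pi C"
    "homogeneous_circuit C" "is_formula C" "computes C (hard_poly h)" "top_fan_in C = Suc h"
    "circuit_size C \<le> 10 * 16 ^ h"
proof (rule that[of "gates 0 (hard_expr h)"])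
  let ?C = "gates 0 (hard_expr h) :: 'a circuit"
  show "arith_circuit (16 ^ h) ?C" using well_formed_hard_expr by (rule arith_circuit_gates)
  show "is_formula ?C" using well_formed_hard_expr by (rule is_formula_gates)
  show "homogeneous_circuit ?C" using homogeneous_subexprs_hard_expr by (rule homogeneous_circuit_gates)
  show "computes ?C (hard_poly h)" using computes_gates[of "hard_expr h"] by (simp add: hard_expr_poly)
  show "circuit_size ?C \<le> 10 * 16 ^ h"
    using expr_size_hard_expr_le[of h] by (simp add: circuit_size_gates)
  show "sigma_pi_sigma_pi ?C"
    by (rule sigma_pi_sigma_pi_gates[OF hard_expr_def])
      (auto simp: scale_expr_def row_expr_def block_expr_def simp del: upt_Suc map_map)
  have "length (roots p ts) = length ts" for p ts by (induction ts arbitrary: p) auto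
  then show "top_fan_in ?C = Suc h" by (simp add: top_fan_in_def hard_expr_def del: upt_Suc)
qed

section \<open>Computing the coefficients\<close>

text \<open>Total correctness for programs that leave the memory as it is; the postcondition also
  sees the number of steps, so that time and result are verified together.\<close>

definition wp :: "(nat \<Rightarrow> nat) \<Rightarrow> ram \<Rightarrow> (nat \<Rightarrow> (nat \<Rightarrow> nat) \<Rightarrow> bool) \<Rightarrow> (nat \<Rightarrow> nat) \<Rightarrow> bool" where
  "wp M P B R \<longleftrightarrow> (\<exists>T R'. ram_exec P (R, M) T (R', M) \<and> B T R')"

lemma wp_Set_Const: "B 1 (R(d := k)) \<Longrightarrow> wp M (Set_Const d k) B R"
  unfolding wp_def by (blast intro: ram_exec.Set_Const)

lemma wp_Set_Plus: "B 1 (R(d := R a + R b)) \<Longrightarrow> wp M (Set_Plus d a b) B R"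
  unfolding wp_def by (blast intro: ram_exec.Set_Plus)

lemma wp_Set_Minus: "B 1 (R(d := R a - R b)) \<Longrightarrow> wp M (Set_Minus d a b) B R"
  unfolding wp_def by (blast intro: ram_exec.Set_Minus)

lemma wp_Load: "B 1 (R(d := M (R a))) \<Longrightarrow> wp M (Load d a) B R"
  unfolding wp_def by (blast intro: ram_exec.Load)

lemma wp_Seq: "wp M P (\<lambda>T. wp M Q (\<lambda>T'. B (T + T'))) R \<Longrightarrow> wp M (Seq P Q) B R"
  unfolding wp_def by (blast intro: ram_exec.Seq)

lemma wp_If:
  assumes "R a > 0 \<Longrightarrow> wp M P (\<lambda>T. B (Suc T)) R" "R a = 0 \<Longrightarrow> wp M Q (\<lambda>T. B (Suc T)) R"
  shows "wp M (If_Pos a P Q) B R"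
proof (cases "R a > 0")
  case True
  with assms(1) show ?thesis unfolding wp_def by (blast intro: ram_exec.If_True)
next
  case False
  with assms(2) show ?thesis unfolding wp_def by (blast intro: ram_exec.If_False)
qed

lemmas wp_rules = wp_Set_Const wp_Set_Plus wp_Set_Minus wp_Load wp_Seq wp_If

lemma wp_mono: "wp M P B R \<Longrightarrow> (\<And>T R'. B T R' \<Longrightarrow> B' T R') \<Longrightarrow> wp M P B' R"
  unfolding wp_def by blast

text \<open>The invariant is indexed by the number of completed rounds, and the number
  \<open>k\<close> of rounds is known in advance. Each round costs its body and one test, and one
  final test ends the loop.\<close>

lemma wp_While:
  assumes "I 0 R"
    and step: "\<And>j R. j < k \<Longrightarrow> I j R \<Longrightarrow> R c > 0 \<and> wp M P (\<lambda>T R'. T \<le> b \<and> I (Suc j) R') R"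
    and stop: "\<And>R. I k R \<Longrightarrow> R c = 0"
  shows "wp M (While_Pos c P) (\<lambda>T R'. T \<le> k * Suc b + 1 \<and> I k R') R"
proof -
  have "wp M (While_Pos c P) (\<lambda>T R'. T \<le> j * Suc b + 1 \<and> I k R') R" if "j \<le> k" "I (k - j) R" for j R
    using that
  proof (induction j arbitrary: R)
    case 0
    then have "R c = 0" using stop by simp
    with 0 ram_exec.While_False[of R c P M] show ?case unfolding wp_def by fastforce
  next
    case (Suc j)
    have eq: "Suc (k - Suc j) = k - j" using Suc.prems by simp
    have "k - Suc j < k" using Suc.prems by simp
    from step[OF this Suc.prems(2)] obtain T1 R1 where c: "R c > 0" and
      R1: "ram_exec P (R, M) T1 (R1, M)" "T1 \<le> b" "I (k - j) R1" unfolding wp_def eq by blast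
    from Suc.IH[OF _ R1(3)] Suc.prems obtain T2 R2 where
      R2: "ram_exec (While_Pos c P) (R1, M) T2 (R2, M)" "T2 \<le> j * Suc b + 1" "I k R2"
      unfolding wp_def by auto
    have "ram_exec (While_Pos c P) (R, M) (Suc (T1 + T2)) (R2, M)"
      using c R1(1) R2(1) by (rule ram_exec.While_True)
    moreover have "Suc (T1 + T2) \<le> Suc j * Suc b + 1" using R1(2) R2(2) by simp
    ultimately show ?case using R2(3) unfolding wp_def by blast
  qed
  from this[of k] assms(1) show ?thesis by simp
qed

text \<open>The absolute difference in the form in which truncated subtraction computes it. A sum of
  such terms vanishes iff all the tested equations hold.\<close>

definition dist_nat :: "nat \<Rightarrow> nat \<Rightarrow> nat" where
  "dist_nat a b = (a - b) + (b - a)"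

lemma dist_nat_eq_0_iff [simp]: "dist_nat a b = 0 \<longleftrightarrow> a = b"
  by (auto simp: dist_nat_def)

text \<open>The program walks once through the variables and accumulates, for each scale, an error that
  vanishes iff every alternative of every block has constant exponents and the exponents of the
  first positions in each block add up to 1. Together with the total degree this characterises
  the monomials of the scale.

  Registers: 0 input and output, 1 constant 0, 2 \<open>4 ^ h\<close>, 3 \<open>2 ^ h\<close>, 4 \<open>h + 1\<close>, 6 constant 1,
  7 total degree, 8 current variable, 9 and 10 and 15 and 16 loop counters, 11 error, 12 sum over
  the alternatives of a block, 14 first exponent of an alternative, 17 \<open>4 ^ i\<close>, 18 number of
  scales without error, 20 loop condition, 5 and 13 and 19 scratch.\<close>

definition row_loop :: ram where
  "row_loop = While_Pos 15 (Seq (Load 5 8) (Seq (Set_Minus 13 5 14) (Seq (Set_Plus 11 11 13)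
    (Seq (Set_Minus 13 14 5) (Seq (Set_Plus 11 11 13) (Seq (Set_Plus 8 8 6) (Set_Minus 15 15 6)))))))"

lemma wp_row_loop:
  assumes "R 6 = 1"
  shows "wp M row_loop (\<lambda>T R'. T \<le> R 15 * 8 + 1 \<and> R' 8 = R 8 + R 15 \<and>
    R' 11 = R 11 + (\<Sum>l<R 15. dist_nat (M (R 8 + l)) (R 14)) \<and>
    (\<forall>q. q \<notin> {5, 8, 11, 13, 15} \<longrightarrow> R' q = R q)) R"
proof -
  define I where "I j R' \<longleftrightarrow> R' 15 = R 15 - j \<and> R' 8 = R 8 + j \<and>
    R' 11 = R 11 + (\<Sum>l<j. dist_nat (M (R 8 + l)) (R 14)) \<and>
    (\<forall>q. q \<notin> {5, 8, 11, 13, 15} \<longrightarrow> R' q = R q)" for j R'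
  have "wp M row_loop (\<lambda>T R'. T \<le> R 15 * Suc 7 + 1 \<and> I (R 15) R') R"
    unfolding row_loop_def
  proof (rule wp_While)
    show "I 0 R" by (simp add: I_def)
    fix j R' assume j: "j < R 15" and I: "I j R'"
    show "R' 15 > 0 \<and> wp M (Seq (Load 5 8) (Seq (Set_Minus 13 5 14) (Seq (Set_Plus 11 11 13)
      (Seq (Set_Minus 13 14 5) (Seq (Set_Plus 11 11 13) (Seq (Set_Plus 8 8 6) (Set_Minus 15 15 6)))))))
      (\<lambda>T R'. T \<le> 7 \<and> I (Suc j) R') R'"
      by (rule conjI, use I j in \<open>simp add: I_def\<close>, (rule wp_rules)+)
        (use I j assms in \<open>simp add: I_def dist_nat_def\<close>)
  qed (simp add: I_def)
  then show ?thesis by (rule wp_mono) (simp add: I_def)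
qed

definition rows_loop :: ram where
  "rows_loop = While_Pos 16 (Seq (Load 14 8) (Seq (Set_Plus 12 12 14) (Seq (Set_Plus 15 17 1)
    (Seq row_loop (Set_Minus 16 16 6)))))"

definition row_err :: "(nat \<Rightarrow> nat) \<Rightarrow> nat \<Rightarrow> nat \<Rightarrow> nat" where
  "row_err M d v = (\<Sum>l<d. dist_nat (M (v + l)) (M v))"

lemma wp_rows_loop:
  assumes "R 6 = 1" "R 1 = 0"
  shows "wp M rows_loop (\<lambda>T R'. T \<le> R 16 * (R 17 * 8 + 6) + 1 \<and> R' 8 = R 8 + R 16 * R 17 \<and>
    R' 12 = R 12 + (\<Sum>k<R 16. M (R 8 + k * R 17)) \<and>
    R' 11 = R 11 + (\<Sum>k<R 16. row_err M (R 17) (R 8 + k * R 17)) \<and>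
    (\<forall>q. q \<notin> {5, 8, 11, 12, 13, 14, 15, 16} \<longrightarrow> R' q = R q)) R"
proof -
  define I where "I j R' \<longleftrightarrow> R' 16 = R 16 - j \<and> R' 8 = R 8 + j * R 17 \<and>
    R' 12 = R 12 + (\<Sum>k<j. M (R 8 + k * R 17)) \<and>
    R' 11 = R 11 + (\<Sum>k<j. row_err M (R 17) (R 8 + k * R 17)) \<and>
    (\<forall>q. q \<notin> {5, 8, 11, 12, 13, 14, 15, 16} \<longrightarrow> R' q = R q)" for j R'
  have "wp M rows_loop (\<lambda>T R'. T \<le> R 16 * Suc (R 17 * 8 + 5) + 1 \<and> I (R 16) R') R"
    unfolding rows_loop_def
  proof (rule wp_While)
    show "I 0 R" by (simp add: I_def)
    fix j R' assume j: "j < R 16" and I: "I j R'"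
    show "R' 16 > 0 \<and> wp M (Seq (Load 14 8) (Seq (Set_Plus 12 12 14) (Seq (Set_Plus 15 17 1)
        (Seq row_loop (Set_Minus 16 16 6))))) (\<lambda>T R'. T \<le> R 17 * 8 + 5 \<and> I (Suc j) R') R'"
      apply (rule conjI)
      subgoal using I j by (simp add: I_def)
      apply (rule wp_rules)+
      apply (rule wp_mono[OF wp_row_loop])
      subgoal using I assms by (simp add: I_def)
      apply (rule wp_rules)+
      subgoal using I j assms by (simp add: I_def row_err_def)
      done
  qed (simp add: I_def)
  then show ?thesis by (rule wp_mono) (simp add: I_def ac_simps)
qed

definition blocks_loop :: ram where
  "blocks_loop = While_Pos 10 (Seq (Set_Const 12 0) (Seq (Set_Plus 16 3 1) (Seq rows_loop
    (Seq (Set_Minus 13 12 6) (Seq (Set_Plus 11 11 13) (Seq (Set_Minus 13 6 12) (Seq (Set_Plus 11 11 13)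
    (Set_Minus 10 10 17))))))))"

definition block_err :: "(nat \<Rightarrow> nat) \<Rightarrow> nat \<Rightarrow> nat \<Rightarrow> nat \<Rightarrow> nat" where
  "block_err M r d v = (\<Sum>k<r. row_err M d (v + k * d)) + dist_nat (\<Sum>k<r. M (v + k * d)) 1"

text \<open>The loop has \<open>4 ^ (h - i)\<close> rounds, but the machine cannot divide. So
  register 10 starts at \<open>4 ^ h\<close>, which is at hand, and is lowered by
  \<open>4 ^ i\<close> in each round.\<close>

lemma wp_blocks_loop:
  assumes "R 6 = 1" "R 1 = 0" "R 10 = m * R 17" "R 17 > 0"
  shows "wp M blocks_loop (\<lambda>T R'. T \<le> m * (R 3 * (R 17 * 8 + 6) + 9) + 1 \<and>
    R' 8 = R 8 + m * (R 3 * R 17) \<and>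
    R' 11 = R 11 + (\<Sum>a<m. block_err M (R 3) (R 17) (R 8 + a * (R 3 * R 17))) \<and>
    (\<forall>q. q \<notin> {5, 8, 10, 11, 12, 13, 14, 15, 16} \<longrightarrow> R' q = R q)) R"
proof -
  define I where "I j R' \<longleftrightarrow> R' 10 = (m - j) * R 17 \<and> R' 8 = R 8 + j * (R 3 * R 17) \<and>
    R' 11 = R 11 + (\<Sum>a<j. block_err M (R 3) (R 17) (R 8 + a * (R 3 * R 17))) \<and>
    (\<forall>q. q \<notin> {5, 8, 10, 11, 12, 13, 14, 15, 16} \<longrightarrow> R' q = R q)" for j R'
  have "wp M blocks_loop (\<lambda>T R'. T \<le> m * Suc (R 3 * (R 17 * 8 + 6) + 8) + 1 \<and> I m R') R"
    unfolding blocks_loop_def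
  proof (rule wp_While)
    show "I 0 R" using assms by (simp add: I_def)
    fix j R' assume j: "j < m" and I: "I j R'"
    show "R' 10 > 0 \<and> wp M (Seq (Set_Const 12 0) (Seq (Set_Plus 16 3 1) (Seq rows_loop
        (Seq (Set_Minus 13 12 6) (Seq (Set_Plus 11 11 13) (Seq (Set_Minus 13 6 12) (Seq (Set_Plus 11 11 13)
        (Set_Minus 10 10 17)))))))) (\<lambda>T R'. T \<le> R 3 * (R 17 * 8 + 6) + 8 \<and> I (Suc j) R') R'"
      apply (rule conjI)
      subgoal using I j assms by (simp add: I_def)
      apply (rule wp_rules)+
      apply (rule wp_mono[OF wp_rows_loop])
      subgoal using I assms by (simp add: I_def)
      subgoal using I assms by (simp add: I_def)
      apply (rule wp_rules)+
      subgoal using I j assms by (simp add: I_def block_err_def dist_nat_def diff_mult_distrib)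
      done
  qed (simp add: I_def)
  then show ?thesis by (rule wp_mono) (simp add: I_def ac_simps)
qed

definition scales_loop :: ram where
  "scales_loop = While_Pos 9 (Seq (Set_Const 11 0) (Seq (Set_Plus 10 2 1) (Seq blocks_loop
    (Seq (If_Pos 11 (Set_Const 11 0) (Set_Plus 18 18 6)) (Seq (Set_Plus 17 17 17) (Seq (Set_Plus 17 17 17)
    (Set_Minus 9 9 6)))))))"

definition scale_err :: "(nat \<Rightarrow> nat) \<Rightarrow> nat \<Rightarrow> nat \<Rightarrow> nat" where
  "scale_err M h i = (\<Sum>a<4 ^ (h - i). block_err M (2 ^ h) (4 ^ i) (i * 8 ^ h + a * (2 ^ h * 4 ^ i)))"

text \<open>Each scale advances the current variable by exactly \<open>8 ^ h\<close>, which is where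
  the next scale begins, so register 8 need not be reset. The number \<open>z\<close> bounds all
  loop counts at once and makes the time a polynomial in \<open>z\<close> and
  \<open>h\<close>.\<close>

lemma wp_scales_loop:
  assumes "R 6 = 1" "R 1 = 0" "R 2 = 4 ^ h" "R 3 = 2 ^ h" "R 8 = 0" "R 9 = Suc h" "R 17 = 1" "R 18 = 0"
    and z: "4 ^ h \<le> z"
  shows "wp M scales_loop (\<lambda>T R'. T \<le> Suc h * (z * (z * (z * 8 + 6) + 9) + 10) + 1 \<and>
    R' 18 = (\<Sum>i\<le>h. if scale_err M h i = 0 then 1 else 0) \<and>
    (\<forall>q. q \<notin> {5, 8, 9, 10, 11, 12, 13, 14, 15, 16, 17, 18} \<longrightarrow> R' q = R q)) R"
proof -
  define I where "I j R' \<longleftrightarrow> R' 9 = Suc h - j \<and> R' 8 = j * 8 ^ h \<and> R' 17 = 4 ^ j \<and>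
    R' 18 = (\<Sum>i<j. if scale_err M h i = 0 then 1 else 0) \<and>
    (\<forall>q. q \<notin> {5, 8, 9, 10, 11, 12, 13, 14, 15, 16, 17, 18} \<longrightarrow> R' q = R q)" for j R'
  have "wp M scales_loop (\<lambda>T R'. T \<le> Suc h * Suc (z * (z * (z * 8 + 6) + 9) + 9) + 1 \<and> I (Suc h) R') R"
    unfolding scales_loop_def
  proof (rule wp_While)
    show "I 0 R" using assms by (simp add: I_def)
    fix j R' assume j: "j < Suc h" and I: "I j R'"
    have pow: "(4::nat) ^ (h - j) * 4 ^ j = 4 ^ h" using j by (simp flip: power_add)
    have prod: "(4::nat) ^ (h - j) * (2 ^ h * 4 ^ j) = 8 ^ h"
      using scales_product[of j h] j by (simp add: mult.assoc)
    have "(2::nat) ^ h \<le> 4 ^ h" by (rule power_mono) auto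
    moreover have "(4::nat) ^ j \<le> 4 ^ h" "(4::nat) ^ (h - j) \<le> 4 ^ h" using j by (auto intro!: power_increasing)
    ultimately have "2 ^ h \<le> z" "4 ^ j \<le> z" "4 ^ (h - j) \<le> z" using z by linarith+
    then have time: "4 ^ (h - j) * (2 ^ h * (4 ^ j * 8 + 6) + 9) \<le> z * (z * (z * 8 + 6) + 9)"
      by (intro mult_mono add_mono) auto
    show "R' 9 > 0 \<and> wp M (Seq (Set_Const 11 0) (Seq (Set_Plus 10 2 1) (Seq blocks_loop
        (Seq (If_Pos 11 (Set_Const 11 0) (Set_Plus 18 18 6)) (Seq (Set_Plus 17 17 17) (Seq (Set_Plus 17 17 17)
        (Set_Minus 9 9 6))))))) (\<lambda>T R'. T \<le> z * (z * (z * 8 + 6) + 9) + 9 \<and> I (Suc j) R') R'"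
      apply (rule conjI)
      subgoal using I j by (simp add: I_def)
      apply (rule wp_rules)+
      apply (rule wp_mono[OF wp_blocks_loop[where m = "4 ^ (h - j)"]])
      subgoal using I assms by (simp add: I_def)
      subgoal using I assms by (simp add: I_def)
      subgoal using I assms pow by (simp add: I_def)
      subgoal using I assms by (simp add: I_def)
      apply (rule wp_Seq, rule wp_If)
      apply (rule wp_rules)+
      subgoal using I j assms time prod by (simp add: I_def scale_err_def del: sum_eq_0_iff)
      apply (rule wp_rules)+
      subgoal using I j assms time prod by (simp add: I_def scale_err_def del: sum_eq_0_iff)
      done
  qed (simp add: I_def)
  then show ?thesis by (rule wp_mono) (simp add: I_def lessThan_Suc_atMost ac_simps)
qed

text \<open>For \<open>n \<ge> 1\<close> the integer part of the logarithm to base 4, and 0 for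
  \<open>n = 0\<close>. It extends the family from degrees \<open>4 ^ h\<close> to all
  \<open>n\<close>, with a degree between n / 4 and n when \<open>n \<ge> 1\<close>.\<close>

definition log4 :: "nat \<Rightarrow> nat" where
  "log4 n = (LEAST h. n < 4 ^ Suc h)"

lemma less_4_power_log4: "n < 4 ^ Suc (log4 n)"
proof -
  have "(2::nat) ^ n \<le> 4 ^ n" by (rule power_mono) auto
  then have "n < 4 ^ Suc n" using less_exp[of n] unfolding power_Suc by linarith
  then show ?thesis unfolding log4_def by (rule LeastI)
qed

lemma power_le_if_less_log4: "j < log4 n \<Longrightarrow> 4 ^ Suc j \<le> n"
  unfolding log4_def using not_less_Least[of j "\<lambda>h. n < 4 ^ Suc h"] by simp

lemma power_log4_le: "4 ^ log4 n \<le> max 1 n"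
  using power_le_if_less_log4[of "log4 n - 1" n] by (cases "log4 n") auto

text \<open>If register 2 holds \<open>4 ^ j\<close>, register 20 becomes
  \<open>n + 1 - 4 ^ Suc j\<close>; with truncated subtraction this is positive iff
  \<open>4 ^ Suc j \<le> n\<close>.\<close>

definition next_power :: ram where
  "next_power = Seq (Set_Plus 19 2 2) (Seq (Set_Plus 19 19 19) (Seq (Set_Plus 20 0 6) (Set_Minus 20 20 19)))"

definition power_loop :: ram where
  "power_loop = While_Pos 20 (Seq (Set_Plus 2 19 1) (Seq (Set_Plus 3 3 3) (Seq (Set_Plus 4 4 6) next_power)))"

lemma wp_power_loop:
  assumes "R 6 = 1" "R 1 = 0" "R 2 = 1" "R 3 = 1" "R 4 = 1" "R 19 = 4" "R 20 = R 0 + 1 - 4"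
  shows "wp M power_loop (\<lambda>T R'. T \<le> log4 (R 0) * 8 + 1 \<and> R' 2 = 4 ^ log4 (R 0) \<and> R' 3 = 2 ^ log4 (R 0) \<and>
    R' 4 = Suc (log4 (R 0)) \<and> (\<forall>q. q \<notin> {2, 3, 4, 19, 20} \<longrightarrow> R' q = R q)) R"
proof -
  define I where "I j R' \<longleftrightarrow> R' 2 = 4 ^ j \<and> R' 3 = 2 ^ j \<and> R' 4 = Suc j \<and> R' 19 = 4 ^ Suc j \<and>
    R' 20 = R 0 + 1 - 4 ^ Suc j \<and> (\<forall>q. q \<notin> {2, 3, 4, 19, 20} \<longrightarrow> R' q = R q)" for j R'
  have "wp M power_loop (\<lambda>T R'. T \<le> log4 (R 0) * Suc 7 + 1 \<and> I (log4 (R 0)) R') R"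
    unfolding power_loop_def
  proof (rule wp_While)
    show "I 0 R" using assms by (simp add: I_def)
    show "R' 20 = 0" if "I (log4 (R 0)) R'" for R'
      using that less_4_power_log4[of "R 0"] by (simp add: I_def)
    fix j R' assume j: "j < log4 (R 0)" and I: "I j R'"
    show "R' 20 > 0 \<and> wp M (Seq (Set_Plus 2 19 1) (Seq (Set_Plus 3 3 3) (Seq (Set_Plus 4 4 6) next_power)))
      (\<lambda>T R'. T \<le> 7 \<and> I (Suc j) R') R'"
      unfolding next_power_def
      apply (rule conjI)
      subgoal using I power_le_if_less_log4[OF j] by (simp add: I_def)
      apply (rule wp_rules)+
      subgoal using I assms by (simp add: I_def)
      done
  qed
  then show ?thesis by (rule wp_mono) (simp add: I_def)
qed

definition sum_loop :: ram where
  "sum_loop = While_Pos 10 (Seq (Load 5 8) (Seq (Set_Plus 7 7 5) (Seq (Set_Plus 8 8 6) (Set_Minus 10 10 6))))"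

lemma wp_sum_loop:
  assumes "R 6 = 1"
  shows "wp M sum_loop (\<lambda>T R'. T \<le> R 10 * 5 + 1 \<and> R' 8 = R 8 + R 10 \<and>
    R' 7 = R 7 + (\<Sum>j<R 10. M (R 8 + j)) \<and> (\<forall>q. q \<notin> {5, 7, 8, 10} \<longrightarrow> R' q = R q)) R"
proof -
  define I where "I j R' \<longleftrightarrow> R' 10 = R 10 - j \<and> R' 8 = R 8 + j \<and> R' 7 = R 7 + (\<Sum>j<j. M (R 8 + j)) \<and>
    (\<forall>q. q \<notin> {5, 7, 8, 10} \<longrightarrow> R' q = R q)" for j R'
  have "wp M sum_loop (\<lambda>T R'. T \<le> R 10 * Suc 4 + 1 \<and> I (R 10) R') R"
    unfolding sum_loop_def
  proof (rule wp_While)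
    show "I 0 R" by (simp add: I_def)
    fix j R' assume j: "j < R 10" and I: "I j R'"
    show "R' 10 > 0 \<and> wp M (Seq (Load 5 8) (Seq (Set_Plus 7 7 5) (Seq (Set_Plus 8 8 6) (Set_Minus 10 10 6))))
      (\<lambda>T R'. T \<le> 4 \<and> I (Suc j) R') R'"
      apply (rule conjI)
      subgoal using I j by (simp add: I_def)
      apply (rule wp_rules)+
      subgoal using I j assms by (simp add: I_def)
      done
  qed (simp add: I_def)
  then show ?thesis by (rule wp_mono) (simp add: I_def)
qed

text \<open>Two nested loops of \<open>4 ^ h\<close> rounds visit all \<open>16 ^ h\<close>
  variables without computing a product.\<close>

definition total_loop :: ram where
  "total_loop = While_Pos 9 (Seq (Set_Plus 10 2 1) (Seq sum_loop (Set_Minus 9 9 6)))"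

lemma sum_lessThan_add: "(\<Sum>v<a + b. f v) = (\<Sum>v<a. f v) + (\<Sum>j<b. f (a + j) :: nat)" for a b :: nat
  by (induction b) auto

lemma wp_total_loop:
  assumes "R 6 = 1" "R 1 = 0" "R 7 = 0" "R 8 = 0"
  shows "wp M total_loop (\<lambda>T R'. T \<le> R 9 * (R 2 * 5 + 4) + 1 \<and>
    R' 7 = (\<Sum>v<R 9 * R 2. M v) \<and> (\<forall>q. q \<notin> {5, 7, 8, 9, 10} \<longrightarrow> R' q = R q)) R"
proof -
  define I where "I j R' \<longleftrightarrow> R' 9 = R 9 - j \<and> R' 8 = j * R 2 \<and> R' 7 = (\<Sum>v<j * R 2. M v) \<and>
    (\<forall>q. q \<notin> {5, 7, 8, 9, 10} \<longrightarrow> R' q = R q)" for j R'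
  have "wp M total_loop (\<lambda>T R'. T \<le> R 9 * Suc (R 2 * 5 + 3) + 1 \<and> I (R 9) R') R"
    unfolding total_loop_def
  proof (rule wp_While)
    show "I 0 R" using assms by (simp add: I_def)
    fix j R' assume j: "j < R 9" and I: "I j R'"
    have "(\<Sum>v<Suc j * R 2. M v) = (\<Sum>v<j * R 2. M v) + (\<Sum>i<R 2. M (j * R 2 + i))"
      using sum_lessThan_add[of M "j * R 2" "R 2"] by (simp add: add.commute)
    then show "R' 9 > 0 \<and> wp M (Seq (Set_Plus 10 2 1) (Seq sum_loop (Set_Minus 9 9 6)))
      (\<lambda>T R'. T \<le> R 2 * 5 + 3 \<and> I (Suc j) R') R'"
      apply (intro conjI)
      subgoal using I j by (simp add: I_def)
      apply (rule wp_rules)+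
      apply (rule wp_mono[OF wp_sum_loop])
      subgoal using I assms by (simp add: I_def)
      apply (rule wp_rules)+
      subgoal using I j assms by (simp add: I_def)
      done
  qed (simp add: I_def)
  then show ?thesis by (rule wp_mono) (simp add: I_def ac_simps)
qed

definition init_part :: ram where
  "init_part = Seq (Set_Const 6 1) (Seq (Set_Const 2 1) (Seq (Set_Const 3 1) (Seq (Set_Const 4 1) next_power)))"

lemma wp_init_part:
  "wp M init_part (\<lambda>T R. T = 8 \<and> R 0 = n \<and> R 1 = 0 \<and> R 2 = 1 \<and> R 3 = 1 \<and> R 4 = 1 \<and> R 6 = 1 \<and>
    R 7 = 0 \<and> R 8 = 0 \<and> R 18 = 0 \<and> R 19 = 4 \<and> R 20 = n + 1 - 4) ((\<lambda>_. 0)(0 := n))"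
  unfolding init_part_def next_power_def by (rule wp_rules)+ simp

definition total_part :: ram where
  "total_part = Seq (Set_Plus 9 2 1) total_loop"

lemma wp_total_part:
  assumes "R 6 = 1" "R 1 = 0" "R 7 = 0" "R 8 = 0"
  shows "wp M total_part (\<lambda>T R'. T \<le> R 2 * (R 2 * 5 + 4) + 2 \<and>
    R' 7 = (\<Sum>v<R 2 * R 2. M v) \<and> (\<forall>q. q \<notin> {5, 7, 8, 9, 10} \<longrightarrow> R' q = R q)) R"
  unfolding total_part_def
  apply (rule wp_rules)+
  apply (rule wp_mono[OF wp_total_loop])
  using assms by simp_all

definition scales_part :: ram where
  "scales_part = Seq (Set_Const 8 0) (Seq (Set_Plus 9 4 1) (Seq (Set_Const 17 1) scales_loop))"

lemma wp_scales_part: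
  assumes "R 6 = 1" "R 1 = 0" "R 2 = 4 ^ h" "R 3 = 2 ^ h" "R 4 = Suc h" "R 18 = 0"
    and z: "4 ^ h \<le> z"
  shows "wp M scales_part (\<lambda>T R'. T \<le> Suc h * (z * (z * (z * 8 + 6) + 9) + 10) + 4 \<and>
    R' 18 = (\<Sum>i\<le>h. if scale_err M h i = 0 then 1 else 0) \<and>
    (\<forall>q. q \<notin> {5, 8, 9, 10, 11, 12, 13, 14, 15, 16, 17, 18} \<longrightarrow> R' q = R q)) R"
  unfolding scales_part_def
  apply (rule wp_rules)+
  apply (rule wp_mono[OF wp_scales_loop[where h = h and z = z]])
  using assms by simp_all

definition output_part :: ram where
  "output_part = Seq (Set_Minus 11 7 2) (Seq (Set_Minus 13 2 7) (Seq (Set_Plus 11 11 13)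
    (If_Pos 11 (Set_Const 0 0) (Set_Plus 0 18 1))))"

lemma wp_output_part:
  assumes "R 1 = 0"
  shows "wp M output_part (\<lambda>T R'. T = 5 \<and> R' 0 = (if R 7 = R 2 then R 18 else 0) \<and> R' 1 = 0) R"
  unfolding output_part_def
  apply (rule wp_Seq, rule wp_Set_Minus, rule wp_Seq, rule wp_Set_Minus, rule wp_Seq, rule wp_Set_Plus, rule wp_If)
  subgoal using assms by (intro wp_Set_Const) auto
  subgoal using assms by (intro wp_Set_Plus) auto
  done

definition coeff_program :: ram where
  "coeff_program = Seq init_part (Seq power_loop (Seq total_part (Seq scales_part output_part)))"

text \<open>Each scale contributes 0 or 1 to a coefficient, so the coefficient of the sum is the
  number of scales that contain the monomial.\<close>

definition coeff_count :: "(nat \<Rightarrow> nat) \<Rightarrow> nat \<Rightarrow> nat" where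
  "coeff_count M h = (if (\<Sum>v<16 ^ h. M v) = 4 ^ h then card {i. i \<le> h \<and> scale_err M h i = 0} else 0)"

lemma wp_coeff_program:
  assumes z: "4 ^ log4 n \<le> z"
  shows "wp M coeff_program (\<lambda>T R'. T \<le> log4 n * 8 + (z * (z * 5 + 4)) +
      Suc (log4 n) * (z * (z * (z * 8 + 6) + 9) + 10) + 30 \<and>
    R' 0 = coeff_count M (log4 n) \<and> R' 1 = 0) ((\<lambda>_. 0)(0 := n))"
proof -
  have sq: "4 ^ log4 n * 4 ^ log4 n = (16::nat) ^ log4 n" by (simp flip: power_mult_distrib)
  have count: "(\<Sum>i\<le>log4 n. if scale_err M (log4 n) i = 0 then 1 else 0) = card {i. i \<le> log4 n \<and> scale_err M (log4 n) i = 0}"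
    by (simp flip: sum.inter_filter add: Collect_conj_eq atMost_def)
  have time: "4 ^ log4 n * (4 ^ log4 n * 5 + 4) \<le> z * (z * 5 + 4)"
    using z by (intro mult_mono add_mono) auto
  show ?thesis
    unfolding coeff_program_def
  proof (rule wp_Seq, rule wp_mono[OF wp_init_part])
    fix T0 :: nat and R0 :: "nat \<Rightarrow> nat"
    assume R0: "T0 = 8 \<and> R0 0 = n \<and> R0 1 = 0 \<and> R0 2 = 1 \<and> R0 3 = 1 \<and> R0 4 = 1 \<and> R0 6 = 1 \<and>
      R0 7 = 0 \<and> R0 8 = 0 \<and> R0 18 = 0 \<and> R0 19 = 4 \<and> R0 20 = n + 1 - 4"
    let ?B = "\<lambda>(T :: nat) (R' :: nat \<Rightarrow> nat). T \<le> log4 n * 8 + (z * (z * 5 + 4)) + Suc (log4 n) * (z * (z * (z * 8 + 6) + 9) + 10) + 30 \<and>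
      R' 0 = coeff_count M (log4 n) \<and> R' 1 = 0"
    show "wp M (Seq power_loop (Seq total_part (Seq scales_part output_part))) (\<lambda>T. ?B (T0 + T)) R0"
    proof (rule wp_Seq, rule wp_mono[OF wp_power_loop])
      fix T1 :: nat and R1 :: "nat \<Rightarrow> nat"
      assume R1: "T1 \<le> log4 (R0 0) * 8 + 1 \<and> R1 2 = 4 ^ log4 (R0 0) \<and> R1 3 = 2 ^ log4 (R0 0) \<and>
        R1 4 = Suc (log4 (R0 0)) \<and> (\<forall>q. q \<notin> {2, 3, 4, 19, 20} \<longrightarrow> R1 q = R0 q)"
      then have R1: "T1 \<le> log4 n * 8 + 1" "R1 2 = 4 ^ log4 n" "R1 3 = 2 ^ log4 n" "R1 4 = Suc (log4 n)"
        "R1 6 = 1" "R1 1 = 0" "R1 7 = 0" "R1 8 = 0" "R1 18 = 0" using R0 by auto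
      show "wp M (Seq total_part (Seq scales_part output_part)) (\<lambda>T. ?B (T0 + (T1 + T))) R1"
      proof (rule wp_Seq, rule wp_mono[OF wp_total_part])
        fix T2 :: nat and R2 :: "nat \<Rightarrow> nat"
        assume R2: "T2 \<le> R1 2 * (R1 2 * 5 + 4) + 2 \<and> R2 7 = (\<Sum>v<R1 2 * R1 2. M v) \<and>
          (\<forall>q. q \<notin> {5, 7, 8, 9, 10} \<longrightarrow> R2 q = R1 q)"
        then have R2: "T2 \<le> z * (z * 5 + 4) + 2" "R2 7 = (\<Sum>v<16 ^ log4 n. M v)" "R2 2 = 4 ^ log4 n"
          "R2 3 = 2 ^ log4 n" "R2 4 = Suc (log4 n)" "R2 6 = 1" "R2 1 = 0" "R2 18 = 0"
          using R1 time sq by auto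
        show "wp M (Seq scales_part output_part) (\<lambda>T. ?B (T0 + (T1 + (T2 + T)))) R2"
        proof (rule wp_Seq, rule wp_mono[OF wp_scales_part[OF _ _ _ _ _ _ z]])
          fix T3 :: nat and R3 :: "nat \<Rightarrow> nat"
          assume R3: "T3 \<le> Suc (log4 n) * (z * (z * (z * 8 + 6) + 9) + 10) + 4 \<and>
            R3 18 = (\<Sum>i\<le>log4 n. if scale_err M (log4 n) i = 0 then 1 else 0) \<and>
            (\<forall>q. q \<notin> {5, 8, 9, 10, 11, 12, 13, 14, 15, 16, 17, 18} \<longrightarrow> R3 q = R2 q)"
          then have R3': "R3 1 = 0" "R3 2 = 4 ^ log4 n" "R3 7 = (\<Sum>v<16 ^ log4 n. M v)" using R2 by auto
          have time': "T0 + (T1 + (T2 + (T3 + 5))) \<le>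
            log4 n * 8 + (z * (z * 5 + 4)) + Suc (log4 n) * (z * (z * (z * 8 + 6) + 9) + 10) + 30"
            using R0 R1(1) R2(1) R3 by linarith
          show "wp M output_part (\<lambda>T. ?B (T0 + (T1 + (T2 + (T3 + T))))) R3"
          proof (rule wp_mono[OF wp_output_part])
            fix T4 :: nat and R4 :: "nat \<Rightarrow> nat"
            assume "T4 = 5 \<and> R4 0 = (if R3 7 = R3 2 then R3 18 else 0) \<and> R4 1 = 0"
            then show "?B (T0 + (T1 + (T2 + (T3 + T4)))) R4"
              using time' R3 R3' unfolding coeff_count_def count by simp
          qed (fact R3')
        qed (fact R2)+
      qed (fact R1)+
    qed (use R0 in simp_all)
  qed
qed

section \<open>Polynomial running time\<close>

lemma polynomial_growth:
  fixes a b z :: nat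
  assumes "2 \<le> z" "b \<le> z" "a \<le> z ^ i"
  shows "b * (a + 10) + 10 \<le> z ^ (i + 7)"
proof -
  have "10 \<le> (2::nat) ^ 4" by simp
  also have "\<dots> \<le> z ^ 4" using assms(1) by (rule power_mono) simp
  finally have ten: "10 \<le> z ^ 4" .
  have z1: "1 \<le> z" using assms(1) by simp
  have "z ^ i \<le> z ^ (i + 4)" "z ^ 4 \<le> z ^ (i + 4)" using z1 by (auto intro!: power_increasing)
  then have "a + 10 \<le> 2 * z ^ (i + 4)" using assms(3) ten by linarith
  also have "\<dots> \<le> z ^ (i + 5)" using assms(1) mult_right_mono[OF assms(1), of "z ^ (i + 4)"] by (simp add: eval_nat_numeral)
  finally have "b * (a + 10) \<le> z * z ^ (i + 5)" using mult_mono[OF assms(2)] by blast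
  then have 1: "b * (a + 10) \<le> z ^ (i + 6)" by (simp add: eval_nat_numeral)
  have "z ^ 4 \<le> z ^ (i + 6)" using z1 by (rule power_increasing[rotated]) simp
  then have "b * (a + 10) + 10 \<le> 2 * z ^ (i + 6)" using 1 ten by linarith
  also have "\<dots> \<le> z * z ^ (i + 6)" using assms(1) by (rule mult_right_mono) simp
  also have "\<dots> = z ^ (i + 7)" by (simp add: eval_nat_numeral)
  finally show ?thesis .
qed

text \<open>For \<open>z \<ge> 2\<close> a constant up to 10 is at most \<open>z ^ 4\<close>, so
  each Horner step raises the exponent by a generous 7; four steps lead to 28. The final sum of four
  such terms costs the factor 4 \<le> z^2.\<close>

lemma time_bound:
  fixes h z :: nat
  assumes z: "2 \<le> z" and h: "Suc h \<le> z"
  shows "h * 8 + (z * (z * 5 + 4)) + Suc h * (z * (z * (z * 8 + 6) + 9) + 10) + 30 \<le> z ^ 30"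
proof -
  have 1: "z * 8 + 6 \<le> z ^ 7" using polynomial_growth[OF z order_refl, of 1 0] by simp
  have 2: "z * (z * 8 + 6) + 9 \<le> z ^ 14"
    using polynomial_growth[OF z order_refl 1] by (simp add: distrib_left)
  have 3: "z * (z * (z * 8 + 6) + 9) + 10 \<le> z ^ 21"
    using polynomial_growth[OF z order_refl 2] by (simp add: distrib_left)
  have 4: "Suc h * (z * (z * (z * 8 + 6) + 9) + 10) + 10 \<le> z ^ 28"
    using polynomial_growth[OF z h 3] by (simp add: distrib_left)
  have 5: "z * (z * 5 + 4) \<le> z ^ 28"
  proof -
    have "z * (z * 5 + 4) \<le> z * (z * 8 + 6) + 9" by (simp add: distrib_left)
    also have "\<dots> \<le> z ^ 28" using 2 z power_increasing[of 14 28 z] by linarith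
    finally show ?thesis .
  qed
  have "h * 8 \<le> z * 8 + 6" using h by simp
  also have "\<dots> \<le> z ^ 28" using 1 z power_increasing[of 7 28 z] by linarith
  finally have 6: "h * 8 \<le> z ^ 28" .
  have "20 \<le> (2::nat) ^ 28" by simp
  also have "\<dots> \<le> z ^ 28" using z by (rule power_mono) simp
  finally have "h * 8 + (z * (z * 5 + 4)) + Suc h * (z * (z * (z * 8 + 6) + 9) + 10) + 30 \<le> 4 * z ^ 28"
    using 4 5 6 by linarith
  also have "\<dots> \<le> z ^ 2 * z ^ 28"
    using power_mono[OF z, of 2] by (intro mult_right_mono) auto
  also have "\<dots> = z ^ 30" by (simp flip: power_add)
  finally show ?thesis .
qed

section \<open>Correctness of the test for the monomials of a scale\<close>

lemma scale_err_eq: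
  assumes "i \<le> h"
  shows "scale_err M h i = 0 \<longleftrightarrow> (\<forall>a<4 ^ (h - i). (\<forall>k<2 ^ h. \<forall>l<4 ^ i. M (var_index h i a k l) = M (var_index h i a k 0)) \<and>
    (\<Sum>k<2 ^ h. M (var_index h i a k 0)) = 1)"
proof -
  have eq: "i * 8 ^ h + a * (2 ^ h * 4 ^ i) + k * 4 ^ i = var_index h i a k 0" for a k
    by (simp add: var_index_def algebra_simps)
  have add: "var_index h i a k 0 + l = var_index h i a k l" for a k l
    by (simp add: var_index_def)
  have row: "row_err M (4 ^ i) (var_index h i a k 0) = 0 \<longleftrightarrow> (\<forall>l<4 ^ i. M (var_index h i a k l) = M (var_index h i a k 0))" for a k
    by (simp add: row_err_def add lessThan_def)
  have "block_err M (2 ^ h) (4 ^ i) (i * 8 ^ h + a * (2 ^ h * 4 ^ i)) = 0 \<longleftrightarrow>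
      (\<forall>k<2 ^ h. \<forall>l<4 ^ i. M (var_index h i a k l) = M (var_index h i a k 0)) \<and> (\<Sum>k<2 ^ h. M (var_index h i a k 0)) = 1" for a
    unfolding block_err_def eq by (simp add: row Ball_def)
  then show ?thesis
    unfolding scale_err_def by (simp add: Ball_def)
qed

lemma lookup_chosen:
  assumes "i \<le> h" "\<kappa> \<in> block_choices h i" "a < 4 ^ (h - i)" "k < 2 ^ h" "l < 4 ^ i"
  shows "lookup (chosen h i \<kappa>) (var_index h i a k l) = (if \<kappa> a = k then 1 else 0)"
proof -
  have "lookup (chosen h i \<kappa>) (var_index h i a k l) =
      (\<Sum>a'<4 ^ (h - i). \<Sum>l'<4 ^ i. if l' = l then (if a' = a \<and> \<kappa> a = k then 1 else 0) else 0)"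
    unfolding chosen_def block_def lookup_sum
    by (intro sum.cong refl)
      (use assms var_index_eq_iff[OF assms(1) _ block_choices_less[OF assms(1,2)] _ assms(1,3-5)] in \<open>auto simp: lookup_single when_def\<close>)
  also have "\<dots> = (\<Sum>a'<4 ^ (h - i). if a' = a then (if \<kappa> a = k then 1 else 0) else 0)"
    using assms(5) by (intro sum.cong refl) auto
  finally show ?thesis using assms(3) by simp
qed

text \<open>If the error is 0, each block has an alternative whose first exponent is 1, and
  constancy extends this to all of its positions. So \<open>w\<close> is divisible by the monomial
  of that choice, and equality of the degrees leaves no room for a further variable, inside or
  outside the scale.\<close>

lemma scale_err_eq_0_iff:
  assumes i: "i \<le> h" and vars: "keys w \<subseteq> {..<16 ^ h}"
  shows "(\<Sum>v<16 ^ h. lookup w v) = 4 ^ h \<and> scale_err (lookup w) h i = 0 \<longleftrightarrow> (\<exists>\<kappa>\<in>block_choices h i. w = chosen h i \<kappa>)"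
proof -
  have total: "(\<Sum>v<16 ^ h. lookup w v) = deg_in UNIV w"
    using deg_in_superset[OF _ vars, of UNIV] by simp
  show ?thesis unfolding total
  proof (rule iffI)
    assume asm: "deg_in UNIV w = 4 ^ h \<and> scale_err (lookup w) h i = 0"
    note err = asm[THEN conjunct2, unfolded scale_err_eq[OF i], rule_format]
    have "\<exists>k<2 ^ h. lookup w (var_index h i a k 0) = 1" if "a < 4 ^ (h - i)" for a
    proof -
      have "(\<Sum>k<2 ^ h. lookup w (var_index h i a k 0)) = 1" using err[OF that] by blast
      then show ?thesis by (subst (asm) sum_eq_1_iff) auto
    qed
    then obtain g where g: "\<And>a. a < 4 ^ (h - i) \<Longrightarrow> g a < 2 ^ h \<and> lookup w (var_index h i a (g a) 0) = 1" by metis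
    define \<kappa> where "\<kappa> = restrict g {..<4 ^ (h - i)}"
    have \<kappa>: "\<kappa> \<in> block_choices h i"
      unfolding block_product.choices_def[OF block_product_var_index[OF i]] \<kappa>_def using g by auto
    have le: "lookup (chosen h i \<kappa>) v \<le> lookup w v" for v
    proof (cases "v \<in> keys (chosen h i \<kappa>)")
      case True
      from keys_chosen[OF i \<kappa> True] obtain a l where
        a: "a < 4 ^ (h - i)" "l < 4 ^ i" "v = var_index h i a (\<kappa> a) l" by blast
      have k: "\<kappa> a < 2 ^ h" using block_choices_less[OF i \<kappa> a(1)] .
      have "lookup w v = 1" using err[OF a(1)] k a g[OF a(1)] by (simp add: \<kappa>_def)
      moreover have "lookup (chosen h i \<kappa>) v = 1" using lookup_chosen[OF i \<kappa> a(1) k a(2)] a(3) by simp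
      ultimately show ?thesis by simp
    qed (simp add: in_keys_iff)
    have eq: "w = chosen h i \<kappa> + (w - chosen h i \<kappa>)"
      by (rule poly_mapping_eqI) (use le in \<open>simp add: lookup_add lookup_minus\<close>)
    from arg_cong[OF eq, of "deg_in UNIV"] asm have "deg_in UNIV (w - chosen h i \<kappa>) = 0"
      by (simp add: deg_in_add deg_chosen[OF i])
    then have "w - chosen h i \<kappa> = 0" by (simp add: deg_in_eq_0_iff)
    with eq \<kappa> show "\<exists>\<kappa>\<in>block_choices h i. w = chosen h i \<kappa>" by auto
  next
    assume "\<exists>\<kappa>\<in>block_choices h i. w = chosen h i \<kappa>"
    then obtain \<kappa> where \<kappa>: "\<kappa> \<in> block_choices h i" "w = chosen h i \<kappa>" by blast
    have "scale_err (lookup w) h i = 0"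
      unfolding scale_err_eq[OF i] \<kappa>(2)
      using block_choices_less[OF i \<kappa>(1)] by (simp add: lookup_chosen[OF i \<kappa>(1)])
    then show "deg_in UNIV w = 4 ^ h \<and> scale_err (lookup w) h i = 0"
      using deg_chosen[OF i] \<kappa>(2) by simp
  qed
qed

lemma lookup_hard_poly:
  assumes "keys w \<subseteq> {..<16 ^ h}"
  shows "lookup (hard_poly h) w = (of_nat (coeff_count (lookup w) h) :: 'a::comm_ring_1)"
proof -
  have "lookup (hard_poly h) w = (\<Sum>i\<le>h. if (\<Sum>v<16 ^ h. lookup w v) = 4 ^ h \<and> scale_err (lookup w) h i = 0 then 1 else 0 :: 'a)"
    unfolding hard_poly_def lookup_sum
    by (rule sum.cong) (simp_all only: lookup_block_poly scale_err_eq_0_iff[OF _ assms] atMost_iff)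
  also have "\<dots> = of_nat (card {i \<in> {..h}. (\<Sum>v<16 ^ h. lookup w v) = 4 ^ h \<and> scale_err (lookup w) h i = 0})"
    by (simp flip: sum.inter_filter)
  also have "\<dots> = of_nat (coeff_count (lookup w) h)"
    by (simp add: coeff_count_def)
  finally show ?thesis .
qed

lemma explicit_family_hard_poly:
  "explicit_family (\<lambda>n. 16 ^ log4 n) (\<lambda>n. hard_poly (log4 n) :: 'a::comm_ring_1 mpoly)"
  unfolding explicit_family_def
proof (rule exI[of _ coeff_program], rule exI[of _ 30], intro allI impI)
  fix n :: nat and w :: monomial assume w: "keys w \<subseteq> {..<16 ^ log4 n}"
  \<comment> \<open>The bound \<open>n + 2\<close> also covers \<open>n = 0\<close>, where the power
    is 1, and satisfies \<open>2 \<le> z\<close> as needed for the time bound.\<close>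
  have z: "4 ^ log4 n \<le> n + 2" using power_log4_le[of n] by simp
  moreover have "log4 n < 4 ^ log4 n" by (rule less_exp[THEN order.strict_trans2]) (auto intro: power_mono)
  ultimately have h: "Suc (log4 n) \<le> n + 2" by simp
  from wp_coeff_program[OF z, of "lookup w"] obtain T R where
    R: "ram_exec coeff_program ((\<lambda>_. 0)(0 := n), lookup w) T (R, lookup w)"
      "T \<le> log4 n * 8 + ((n + 2) * ((n + 2) * 5 + 4)) +
        Suc (log4 n) * ((n + 2) * ((n + 2) * ((n + 2) * 8 + 6) + 9) + 10) + 30"
      "R 0 = coeff_count (lookup w) (log4 n)" "R 1 = 0" unfolding wp_def by blast
  have "T \<le> (n + 2) ^ 30" using R(2) time_bound[OF _ h] by simp
  also have "\<dots> \<le> (n + monomial_degree w + 2) ^ 30" by (rule power_mono) auto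
  finally have "T \<le> (n + monomial_degree w + 2) ^ 30" .
  moreover have "lookup (hard_poly (log4 n)) w = (of_int (int (R 0) - int (R 1)) :: 'a)"
    using lookup_hard_poly[OF w, where 'a = 'a] R(3,4) by simp
  ultimately show "\<exists>T R M. ram_exec coeff_program ((\<lambda>_. 0)(0 := n), lookup w) T (R, M) \<and>
      T \<le> (n + monomial_degree w + 2) ^ 30 \<and>
      lookup (hard_poly (log4 n)) w = (of_int (int (R 0) - int (R 1)) :: 'a)"
    using R(1) by blast
qed

section \<open>The theorem\<close>

lemma power_log4_bounds:
  assumes "1 \<le> n"
  shows "real n < 4 * 4 ^ log4 n" "4 ^ log4 n \<le> real n"
proof -
  have "real n < real (4 ^ Suc (log4 n))" unfolding of_nat_less_iff by (rule less_4_power_log4)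
  then show "real n < 4 * 4 ^ log4 n" by simp
  have "4 ^ log4 n \<le> n" using power_log4_le[of n] assms by simp
  then have "real (4 ^ log4 n) \<le> real n" unfolding of_nat_le_iff .
  then show "4 ^ log4 n \<le> real n" by simp
qed

text \<open>With h = \<open>log4 n\<close>, the top fan-in is h + 1, and 2 ^ (h + 1) \<le> 4 ^ h
  \<le> n if h > 0; for h = 0 this is where \<open>n \<ge> 2\<close> enters. The size is at most 10
  * 16 ^ h \<le> 2 ^ 4 * n^2 \<le> n^6.\<close>

lemma log4_formula:
  assumes n: "2 \<le> n"
  obtains C :: "'a::comm_ring_1 circuit" where "arith_circuit (16 ^ log4 n) C" "sigma_pi_sigma_pi C"
    "homogeneous_circuit C" "is_formula C" "computes C (hard_poly (log4 n))"
    "real (top_fan_in C) \<le> log 2 (real n)" "circuit_size C \<le> n ^ 6"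
proof -
  obtain C :: "'a circuit" where C: "arith_circuit (16 ^ log4 n) C" "sigma_pi_sigma_pi C"
    "homogeneous_circuit C" "is_formula C" "computes C (hard_poly (log4 n))" "top_fan_in C = Suc (log4 n)"
    "circuit_size C \<le> 10 * 16 ^ log4 n"
    by (rule hard_poly_formula)
  have le: "(4::nat) ^ log4 n \<le> n" using power_log4_le[of n] n by simp
  have "2 ^ Suc (log4 n) \<le> n"
  proof (cases "log4 n")
    case (Suc j)
    have "(2::nat) ^ Suc (log4 n) \<le> 4 * 4 ^ j" unfolding Suc using power_mono[of "2::nat" 4 j] by simp
    with le Suc show ?thesis by simp
  qed (use n in simp)
  then have "real (2 ^ Suc (log4 n)) \<le> real n" unfolding of_nat_le_iff .
  then have "2 powr real (Suc (log4 n)) \<le> real n" by (simp add: powr_realpow del: of_nat_Suc)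
  then have fan_in: "real (top_fan_in C) \<le> log 2 (real n)"
    using n unfolding C(6) by (subst le_log_iff) auto
  have "(16::nat) ^ log4 n = 4 ^ log4 n * 4 ^ log4 n" by (simp flip: power_mult_distrib)
  also have "\<dots> \<le> n * n" using le by (intro mult_mono) auto
  finally have "10 * 16 ^ log4 n \<le> 2 ^ 4 * (n * n)" by simp
  also have "\<dots> \<le> n ^ 4 * (n * n)" using n by (intro mult_right_mono power_mono) auto
  also have "\<dots> = n ^ 6" by (simp add: eval_nat_numeral)
  finally have "circuit_size C \<le> n ^ 6" using C(7) by linarith
  with C fan_in that show thesis by blast
qed

text \<open>Passing from \<open>4 ^ h\<close> to \<open>n < 4 * 4 ^ h\<close> costs a factor 4 in
  each constant: 132 = 4 * 33 and 8448 = 4 * 2112. The threshold \<open>4 ^ 1064\<close> ensures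
  \<open>h \<ge> 1064\<close>.\<close>

lemma log4_lower_bound:
  fixes C :: "'a::field circuit"
  assumes C: "arith_circuit (16 ^ log4 n) C" "sigma_pi_sigma_pi C" "homogeneous_circuit C"
      "bottom_degree_le C t" "computes C (hard_poly (log4 n))"
    and n: "4 ^ 1064 \<le> n" and t: "2 * ln (real n) \<le> real t" "real t \<le> 1 / 132 * real n"
  shows "exp (1 / 8448 * (real n / real t * ln (real (16 ^ log4 n)))) \<le> real (top_fan_in C)"
proof -
  have n1: "1 \<le> n" using n by (rule order.trans[rotated]) simp
  have h: "1064 \<le> log4 n"
  proof (rule ccontr)
    assume "\<not> 1064 \<le> log4 n"
    then have "4 ^ Suc (log4 n) \<le> (4::nat) ^ 1064" by (intro power_increasing) auto
    with n less_4_power_log4[of n] show False by linarith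
  qed
  have "real (log4 n) * ln 4 = ln (4 ^ log4 n)" by (simp add: ln_realpow)
  also have "\<dots> \<le> ln (real n)" using power_log4_bounds(2)[OF n1] n1 by (subst ln_le_cancel_iff) auto
  finally have ln_n: "real (log4 n) * ln 4 \<le> ln (real n)" .
  \<comment> \<open>The rough estimate ln 4 \<ge> 1 / 2 is enough: with h = \<open>log4 n\<close>, h
    / 2 \<le> h ln 4 \<le> ln n \<le> t / 2, hence h \<le> t.\<close>
  have "exp (1 / 2) \<le> (4 :: real)" using exp_half_le2 by simp
  then have "1 / 2 \<le> ln (4 :: real)" by (subst ln_ge_iff) auto
  then have "real (log4 n) * (1 / 2) \<le> real (log4 n) * ln 4" by (intro mult_left_mono) auto
  with ln_n t(1) have ht: "log4 n \<le> t" by linarith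
  have t_pos: "0 < real t" using ht h by simp
  have "33 * real t \<le> 4 ^ log4 n" using t(2) power_log4_bounds(1)[OF n1] by simp
  then have "real (33 * t) \<le> real (4 ^ log4 n)" by simp
  then have t33: "33 * t \<le> 4 ^ log4 n" unfolding of_nat_le_iff .
  have "1 / 8448 * (real n / real t * ln (real (16 ^ log4 n))) \<le>
      1 / 8448 * (4 * 4 ^ log4 n / real t * ln (real (16 ^ log4 n)))"
    using power_log4_bounds(1)[OF n1] t_pos by (intro mult_left_mono mult_right_mono divide_right_mono) auto
  also have "\<dots> = 4 ^ log4 n / real t * ln (16 ^ log4 n) / 2112" by simp
  finally have "exp (1 / 8448 * (real n / real t * ln (real (16 ^ log4 n)))) \<le>
      exp (4 ^ log4 n / real t * ln (16 ^ log4 n) / 2112)" by simp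
  also have "\<dots> \<le> real (top_fan_in C)" by (rule hard_poly_lower_bound[OF C h ht t33])
  finally show ?thesis .
qed

theorem theorem2p3:
  shows "\<exists>(Q :: nat \<Rightarrow> 'a::field mpoly) (N :: nat \<Rightarrow> nat) (\<epsilon> :: real).
    \<epsilon> > 0 \<and>
    explicit_family N Q \<and>
    (\<forall>n. poly_vars (Q n) \<subseteq> {..<N n}) \<and>
    (\<lambda>n. real (N n)) \<in> \<Theta>(\<lambda>n. real n ^ 2) \<and>
    (\<lambda>n. real (total_degree (Q n))) \<in> \<Theta>(\<lambda>n. real n) \<and>
    (\<exists>k. \<forall>n\<ge>2. \<exists>C :: 'a circuit.
        arith_circuit (N n) C \<and> sigma_pi_sigma_pi C \<and> homogeneous_circuit C \<and>
        is_formula C \<and> computes C (Q n) \<and>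
        real (top_fan_in C) \<le> log 2 (real n) \<and> circuit_size C \<le> n ^ k) \<and>
    (\<exists>c>0. \<forall>t :: nat \<Rightarrow> nat.
        (\<lambda>n. real (t n)) \<in> \<omega>(\<lambda>n. ln (real n)) \<longrightarrow>
        (\<forall>\<^sub>F n in sequentially. real (t n) \<le> \<epsilon> * real n) \<longrightarrow>
        (\<forall>\<^sub>F n in sequentially. \<forall>C :: 'a circuit.
            arith_circuit (N n) C \<and> sigma_pi_sigma_pi C \<and> homogeneous_circuit C \<and>
            bottom_degree_le C (t n) \<and> computes C (Q n) \<longrightarrow>
            real (top_fan_in C) \<ge> exp (c * (real n / real (t n) * ln (real (N n))))))"
proof (intro exI conjI)
  let ?N = "\<lambda>n. 16 ^ log4 n :: nat" and ?Q = "\<lambda>n. hard_poly (log4 n) :: 'a mpoly"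
  show "(1 / 132 :: real) > 0" by simp
  show "explicit_family ?N ?Q" by (rule explicit_family_hard_poly)
  show "\<forall>n. poly_vars (?Q n) \<subseteq> {..<?N n}" using poly_vars_hard_poly by blast
  have ev: "eventually (\<lambda>n::nat. 1 \<le> n) sequentially" by (rule eventually_ge_at_top)
  show "(\<lambda>n. real (?N n)) \<in> \<Theta>(\<lambda>n. real n ^ 2)"
  proof (rule bigthetaI'[of "1 / 16" 1])
    show "\<forall>\<^sub>F n in sequentially. 1 / 16 * norm (real n ^ 2) \<le> norm (real (?N n)) \<and>
        norm (real (?N n)) \<le> 1 * norm (real n ^ 2)"
      using ev
    proof eventually_elim
      fix n :: nat assume n: "1 \<le> n"
      have sq: "(4 ^ log4 n)\<^sup>2 = (16::real) ^ log4 n" by (simp add: power_mult_distrib power2_eq_square flip: power_mult_distrib)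
      have "real n ^ 2 \<le> (4 * 4 ^ log4 n)\<^sup>2" using power_log4_bounds(1)[OF n] by (intro power_mono) auto
      moreover have "(4 ^ log4 n)\<^sup>2 \<le> real n ^ 2" using power_log4_bounds(2)[OF n] by (intro power_mono) auto
      ultimately show "1 / 16 * norm (real n ^ 2) \<le> norm (real (?N n)) \<and> norm (real (?N n)) \<le> 1 * norm (real n ^ 2)"
        by (simp add: power_mult_distrib sq)
    qed
  qed auto
  show "(\<lambda>n. real (total_degree (?Q n))) \<in> \<Theta>(\<lambda>n. real n)"
  proof (rule bigthetaI'[of "1 / 4" 1])
    show "\<forall>\<^sub>F n in sequentially. 1 / 4 * norm (real n) \<le> norm (real (total_degree (?Q n))) \<and>
        norm (real (total_degree (?Q n))) \<le> 1 * norm (real n)"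
      using ev
    proof eventually_elim
      fix n :: nat assume n: "1 \<le> n"
      show "1 / 4 * norm (real n) \<le> norm (real (total_degree (?Q n))) \<and>
          norm (real (total_degree (?Q n))) \<le> 1 * norm (real n)"
        using power_log4_bounds[OF n] by (simp add: total_degree_hard_poly)
    qed
  qed auto
  show "\<forall>n\<ge>2. \<exists>C :: 'a circuit. arith_circuit (?N n) C \<and> sigma_pi_sigma_pi C \<and> homogeneous_circuit C \<and>
      is_formula C \<and> computes C (?Q n) \<and> real (top_fan_in C) \<le> log 2 (real n) \<and> circuit_size C \<le> n ^ 6"
    using log4_formula by metis
  show "(1 / 8448 :: real) > 0" by simp
  show "\<forall>t :: nat \<Rightarrow> nat. (\<lambda>n. real (t n)) \<in> \<omega>(\<lambda>n. ln (real n)) \<longrightarrow>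
      (\<forall>\<^sub>F n in sequentially. real (t n) \<le> 1 / 132 * real n) \<longrightarrow>
      (\<forall>\<^sub>F n in sequentially. \<forall>C :: 'a circuit.
          arith_circuit (?N n) C \<and> sigma_pi_sigma_pi C \<and> homogeneous_circuit C \<and>
          bottom_degree_le C (t n) \<and> computes C (?Q n) \<longrightarrow>
          real (top_fan_in C) \<ge> exp (1 / 8448 * (real n / real (t n) * ln (real (?N n)))))"
  proof (intro allI impI)
    fix t :: "nat \<Rightarrow> nat"
    assume omega: "(\<lambda>n. real (t n)) \<in> \<omega>(\<lambda>n. ln (real n))"
      and le: "\<forall>\<^sub>F n in sequentially. real (t n) \<le> 1 / 132 * real n"
    \<comment> \<open>The growth condition on \<open>t\<close> is used with the single constant 2.
      Only the point from which the bound holds depends on \<open>t\<close>; the constants 1 / 132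
      and 1 / 8448 do not.\<close>
    have "\<forall>\<^sub>F n in sequentially. norm (real (t n)) \<ge> 2 * norm (ln (real n))"
      using omega by (rule landau_omega.smallD) simp
    moreover have "\<forall>\<^sub>F n in sequentially. (4::nat) ^ 1064 \<le> n" by (rule eventually_ge_at_top)
    ultimately show "\<forall>\<^sub>F n in sequentially. \<forall>C :: 'a circuit.
        arith_circuit (?N n) C \<and> sigma_pi_sigma_pi C \<and> homogeneous_circuit C \<and>
        bottom_degree_le C (t n) \<and> computes C (?Q n) \<longrightarrow>
        real (top_fan_in C) \<ge> exp (1 / 8448 * (real n / real (t n) * ln (real (?N n))))"
      using le
    proof eventually_elim
      fix n assume n: "2 * norm (ln (real n)) \<le> norm (real (t n))" "(4::nat) ^ 1064 \<le> n"
        "real (t n) \<le> 1 / 132 * real n"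
      from n(1) have "2 * ln (real n) \<le> real (t n)" by simp
      with log4_lower_bound[of n _ "t n"] n(2,3) show "\<forall>C :: 'a circuit.
        arith_circuit (?N n) C \<and> sigma_pi_sigma_pi C \<and> homogeneous_circuit C \<and>
        bottom_degree_le C (t n) \<and> computes C (?Q n) \<longrightarrow>
        real (top_fan_in C) \<ge> exp (1 / 8448 * (real n / real (t n) * ln (real (?N n))))"
        by blast
    qed
  qed
qed

end
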